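(* Let $a<b$ be real numbers, $n\ge 1$ an integer, $0<d<\pi/2$, $\alpha>0$, and $\mathbf{r}\in\mathbb{C}^n$. Let $K=[k_{ij}]$ be an $n\times n$ matrix of functions and $\mathbf{g}=[g_1,\ldots,g_n]^{\mathrm T}$ a vector of functions, and put $Q(z)=(z-a)(b-z)$. Assume that $k_{ij}Q\in \mathbf{L}_{\alpha}(\psi^{\mathrm{DE}}(\mathscr{D}_d))$ for all $i,j=1,\ldots,n$ and $g_iQ\in \mathbf{L}_{\alpha}(\psi^{\mathrm{DE}}(\mathscr{D}_d))$ for all $i=1,\ldots,n$. Let $\mathbf{y}=[y_1,\ldots,y_n]^{\mathrm T}$ be the solution of $\mathbf{y}'(t)=K(t)\mathbf{y}(t)+\mathbf{g}(t)$ $(a\le t\le b)$, $\mathbf{y}(a)=\mathbf{r}$, and for each positive integer $N$ let $h=\log(2dN/\alpha)/N$. Then there exist $N_0$ and a constant $C$ independent of $N$ such that for all $N\ge N_0$ the DE-Sinc linear system (defined in the context) is uniquely solvable, and the DE-Sinc-Nystr\"om solution $\mathbf{y}^{(N)}=[y_1^{(N)},\ldots,y_n^{(N)}]^{\mathrm T}$ (defined in the context) satisfies $$\max_{i=1,\ldots,n}\Bigl\{\max_{a\le t\le b}|y_i(t)-y_i^{(N)}(t)|\Bigr\}\le C\,\frac{\log(2dN/\alpha)}{N}\exp\left\{\frac{-\pi dN}{\log(2dN/\alpha)}\right\}.$$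
   Context: $\mathscr{D}_d=\{\zeta\in\mathbb{C}:|\operatorname{Im}\zeta|<d\}$, $\psi^{\mathrm{DE}}(\zeta)=\frac{b-a}{2}\tanh\left(\frac{\pi}{2}\sinh\zeta\right)+\frac{b+a}{2}$, with inverse $\phi^{\mathrm{DE}}(t)=\operatorname{arcsinh}\left[\frac{2}{\pi}\operatorname{arctanh}\left(\frac{2t-b-a}{b-a}\right)\right]$ on $(a,b)$. The image $\mathscr{D}=\psi^{\mathrm{DE}}(\mathscr{D}_d)$ is regarded as a Riemann surface (since $\psi^{\mathrm{DE}}$ is not injective on $\mathscr{D}_d$). Concretely, a function $f$ on $\mathscr{D}$ is identified with the function $F$ on $\mathscr{D}_d$, written $F(\zeta)=f(\psi^{\mathrm{DE}}(\zeta))$, and is called analytic if $F$ is analytic; in inequalities "for all $z\in\mathscr{D}$", $f(z)$ means $F(\zeta)$ and $z$ means $\psi^{\mathrm{DE}}(\zeta)$, for all $\zeta\in\mathscr{D}_d$. The interval $(a,b)$ corresponds to $\zeta\in\mathbb{R}$. For $\alpha>0$, $\mathbf{L}_{\alpha}(\mathscr{D})$ is the set of bounded analytic functions $f$ on $\mathscr{D}$ for which there is a constant $L$ with $|f(z)|\le L|Q(z)|^{\alpha}$ for all $z\in\mathscr{D}$, where $Q(z)=(z-a)(b-z)$. The initial value problem is understood in the equivalent integrated form $\mathbf{y}(t)=\mathbf{r}+\int_a^t\{\mathbf{g}(s)+K(s)\mathbf{y}(s)\}\,ds$, $a\le t\le b$, with $\mathbf{y}$ continuous on $[a,b]$ ($k_{ij},g_i$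 may have integrable singularities at $a,b$); under the stated assumptions it has a unique solution. Sampling points: $t_j^{\mathrm{DE}}=\psi^{\mathrm{DE}}(jh)$, $j=-N,\ldots,N$. Sine integral: $\operatorname{Si}(x)=\int_0^x\frac{\sin u}{u}\,du$. Put $J(j,h)(x)=h\left\{\frac12+\frac1\pi\operatorname{Si}[\pi(x/h-j)]\right\}$, with limiting values $J(j,h)(-\infty)=0$, $J(j,h)(+\infty)=h$ used for $x=\phi^{\mathrm{DE}}(t)$ at $t=a,b$. DE-Sinc linear system: let $\sigma_k=\frac12+\frac1\pi\operatorname{Si}(\pi k)$, $I_N^{(-1)}=[\sigma_{i-j}]_{i,j=-N}^{N}$ (a $(2N+1)\times(2N+1)$ matrix), $D_N^{\mathrm{DE}}=\operatorname{diag}[(\psi^{\mathrm{DE}})'(-Nh),\ldots,(\psi^{\mathrm{DE}})'(Nh)]$, $K_{ij}^{\mathrm{DE}}=\operatorname{diag}[k_{ij}(t_{-N}^{\mathrm{DE}}),\ldots,k_{ij}(t_N^{\mathrm{DE}})]$, and $[K_{ij}^{\mathrm{DE}}]$ the $n\times n$ block matrix with blocks $K_{ij}^{\mathrm{DE}}$. Let $I_N$, $I_n$ be the identity matrices of order $2N+1$ and $n$, respectively. Let $\mathbf{R}=[r_1,\ldots,r_1,r_2,\ldots,r_2,\ldots,r_n]^{\mathrm T}$ (each $r_i$ repeated $2N+1$ times) and $\mathbf{G}^{\mathrm{DE}}=[g_1(t_{-N}^{\mathrm{DE}}),\ldots,g_1(t_N^{\mathrm{DE}}),\ldots,g_n(t_{-N}^{\mathrm{DE}}),\ldots,g_n(t_N^{\mathrm{DE}})]^{\mathrm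 T}$. The system for the unknown vector $\mathbf{Y}^{\mathrm{DE}}=[y_1^{(N)}(t_{-N}^{\mathrm{DE}}),\ldots,y_1^{(N)}(t_N^{\mathrm{DE}}),\ldots,y_n^{(N)}(t_{-N}^{\mathrm{DE}}),\ldots,y_n^{(N)}(t_N^{\mathrm{DE}})]^{\mathrm T}$ is $$\bigl(I_n\otimes I_N-\bigl(I_n\otimes\{hI_N^{(-1)}D_N^{\mathrm{DE}}\}\bigr)[K_{ij}^{\mathrm{DE}}]\bigr)\mathbf{Y}^{\mathrm{DE}}=\bigl(I_n\otimes\{hI_N^{(-1)}D_N^{\mathrm{DE}}\}\bigr)\mathbf{G}^{\mathrm{DE}}+\mathbf{R},$$ where $\otimes$ is the Kronecker product. DE-Sinc-Nystr\"om solution: with the values $\mathbf{y}^{(N)}(t_j^{\mathrm{DE}})$ obtained from this system, $$\mathbf{y}^{(N)}(t)=\mathbf{r}+\sum_{j=-N}^N\left\{\mathbf{g}(t_j^{\mathrm{DE}})+K(t_j^{\mathrm{DE}})\mathbf{y}^{(N)}(t_j^{\mathrm{DE}})\right\}(\psi^{\mathrm{DE}})'(jh)\,J(j,h)(\phi^{\mathrm{DE}}(t)).$$ *)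

theory Defs
  imports "HOL-Analysis.Analysis" "HOL-Probability.Sinc_Integral" "Jordan_Normal_Form.Matrix"
begin

unbundle no vec_syntax

section \<open>The double-exponential map and the function spaces\<close>

definition strip :: "real \<Rightarrow> complex set" where
  "strip d = {\<zeta>. \<bar>Im \<zeta>\<bar> < d}"

text \<open>Polymorphic, because the map is needed both on the complex strip and on the real line.\<close>

definition psi_DE :: "real \<Rightarrow> real \<Rightarrow> 'a \<Rightarrow> 'a::{banach,real_normed_field}" where
  "psi_DE a b \<zeta> =
     of_real ((b - a) / 2) * tanh (of_real (pi / 2) * sinh \<zeta>) + of_real ((b + a) / 2)"

text \<open>Only meaningful for \<open>a < t < b\<close>.\<close>

definition phi_DE :: "real \<Rightarrow> real \<Rightarrow> real \<Rightarrow> real" where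
  "phi_DE a b t = arsinh (2 / pi * artanh ((2 * t - b - a) / (b - a)))"

definition Q_fun :: "real \<Rightarrow> real \<Rightarrow> complex \<Rightarrow> complex" where
  "Q_fun a b z = (z - of_real a) * (of_real b - z)"

text \<open>
  A function \<open>f\<close> on the Riemann surface \<open>\<psi>(strip d)\<close> is represented by its
  pull-back \<open>F = f \<circ> \<psi>\<close> to the strip; the map \<open>\<psi>\<close> need not be injective there, so
  \<open>F\<close> need not factor through the image set. All coefficient functions
  below are represented in this way.
\<close>

definition L_space :: "real \<Rightarrow> real \<Rightarrow> real \<Rightarrow> real \<Rightarrow> (complex \<Rightarrow> complex) set" where
  "L_space a b d \<alpha> =
     {F. F analytic_on strip d \<and> bounded (F ` strip d) \<and>
         (\<exists>L. \<forall>\<zeta>\<in>strip d. cmod (F \<zeta>) \<le> L * cmod (Q_fun a b (psi_DE a b \<zeta>)) powr \<alpha>)}"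

text \<open>The value at \<open>t \<in> (a, b)\<close> of the function on the surface represented by \<open>F\<close>; the interval
  corresponds to the real line in the strip.\<close>

definition at_real :: "real \<Rightarrow> real \<Rightarrow> (complex \<Rightarrow> complex) \<Rightarrow> real \<Rightarrow> complex" where
  "at_real a b F t = F (of_real (phi_DE a b t))"

section \<open>The initial value problem\<close>

text \<open>
  Components are indexed by \<open>i < n\<close>. The values of the integrand at \<open>a\<close> and \<open>b\<close> are
  irrelevant to the integral.
\<close>

definition ivp_solution ::
  "real \<Rightarrow> real \<Rightarrow> nat \<Rightarrow> (nat \<Rightarrow> nat \<Rightarrow> complex \<Rightarrow> complex) \<Rightarrow> (nat \<Rightarrow> complex \<Rightarrow> complex) \<Rightarrow>
     (nat \<Rightarrow> complex) \<Rightarrow> (nat \<Rightarrow> real \<Rightarrow> complex) \<Rightarrow> bool" where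
  "ivp_solution a b n k g r y \<longleftrightarrow>
     (\<forall>i<n. continuous_on {a..b} (y i) \<and>
       (\<forall>t\<in>{a..b}.
          ((\<lambda>s. at_real a b (g i) s + (\<Sum>l<n. at_real a b (k i l) s * y l s))
             has_integral (y i t - r i)) {a..t}))"

section \<open>The DE-Sinc linear system\<close>

definition h_DE :: "real \<Rightarrow> real \<Rightarrow> nat \<Rightarrow> real" where
  "h_DE d \<alpha> N = ln (2 * d * real N / \<alpha>) / real N"

definition t_DE :: "real \<Rightarrow> real \<Rightarrow> real \<Rightarrow> int \<Rightarrow> real" where
  "t_DE a b h j = psi_DE a b (real_of_int j * h)"

definition psi_DE_deriv :: "real \<Rightarrow> real \<Rightarrow> real \<Rightarrow> real" where
  "psi_DE_deriv a b x = deriv (psi_DE a b) x"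

definition sigma :: "int \<Rightarrow> real" where
  "sigma k = 1 / 2 + 1 / pi * Si (pi * real_of_int k)"

definition kron :: "complex mat \<Rightarrow> complex mat \<Rightarrow> complex mat" where
  "kron A B = Matrix.mat (dim_row A * dim_row B) (dim_col A * dim_col B)
     (\<lambda>(p, q). A $$ (p div dim_row B, q div dim_col B) * B $$ (p mod dim_row B, q mod dim_col B))"

definition diag_of :: "nat \<Rightarrow> (nat \<Rightarrow> complex) \<Rightarrow> complex mat" where
  "diag_of m f = Matrix.mat m m (\<lambda>(p, q). if p = q then f p else 0)"

definition block_mat :: "nat \<Rightarrow> nat \<Rightarrow> (nat \<Rightarrow> nat \<Rightarrow> complex mat) \<Rightarrow> complex mat" where
  "block_mat n m B = Matrix.mat (n * m) (n * m)
     (\<lambda>(p, q). B (p div m) (q div m) $$ (p mod m, q mod m))"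

text \<open>
  The nodes \<open>j = -N, \<dots>, N\<close> are numbered \<open>p = 0, \<dots>, 2N\<close> by \<open>p = j + N\<close>; in stacked vectors
  the entry for component \<open>i < n\<close> and node \<open>j\<close> has index \<open>i (2N + 1) + (j + N)\<close>.
\<close>

definition node :: "nat \<Rightarrow> nat \<Rightarrow> int" where
  "node N p = int p - int N"

definition I_mat :: "nat \<Rightarrow> complex mat" where
  "I_mat N = Matrix.mat (2 * N + 1) (2 * N + 1) (\<lambda>(p, q). of_real (sigma (node N p - node N q)))"

definition D_mat :: "real \<Rightarrow> real \<Rightarrow> real \<Rightarrow> nat \<Rightarrow> complex mat" where
  "D_mat a b h N =
     diag_of (2 * N + 1) (\<lambda>p. of_real (psi_DE_deriv a b (real_of_int (node N p) * h)))"

definition K_mat ::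
  "real \<Rightarrow> real \<Rightarrow> nat \<Rightarrow> (nat \<Rightarrow> nat \<Rightarrow> complex \<Rightarrow> complex) \<Rightarrow> real \<Rightarrow> nat \<Rightarrow> complex mat" where
  "K_mat a b n k h N = block_mat n (2 * N + 1)
     (\<lambda>i l. diag_of (2 * N + 1) (\<lambda>p. at_real a b (k i l) (t_DE a b h (node N p))))"

definition G_vec ::
  "real \<Rightarrow> real \<Rightarrow> nat \<Rightarrow> (nat \<Rightarrow> complex \<Rightarrow> complex) \<Rightarrow> real \<Rightarrow> nat \<Rightarrow> complex Matrix.vec" where
  "G_vec a b n g h N = Matrix.vec (n * (2 * N + 1))
     (\<lambda>p. at_real a b (g (p div (2 * N + 1))) (t_DE a b h (node N (p mod (2 * N + 1)))))"

definition R_vec :: "nat \<Rightarrow> (nat \<Rightarrow> complex) \<Rightarrow> nat \<Rightarrow> complex Matrix.vec" where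
  "R_vec n r N = Matrix.vec (n * (2 * N + 1)) (\<lambda>p. r (p div (2 * N + 1)))"

definition integration_mat :: "real \<Rightarrow> real \<Rightarrow> nat \<Rightarrow> real \<Rightarrow> nat \<Rightarrow> complex mat" where
  "integration_mat a b n h N =
     kron (1\<^sub>m n) (of_real h \<cdot>\<^sub>m (I_mat N * D_mat a b h N))"

definition DE_system ::
  "real \<Rightarrow> real \<Rightarrow> nat \<Rightarrow> (nat \<Rightarrow> nat \<Rightarrow> complex \<Rightarrow> complex) \<Rightarrow> (nat \<Rightarrow> complex \<Rightarrow> complex) \<Rightarrow>
     (nat \<Rightarrow> complex) \<Rightarrow> real \<Rightarrow> nat \<Rightarrow> complex Matrix.vec \<Rightarrow> bool" where
  "DE_system a b n k g r h N Y \<longleftrightarrow>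
     Y \<in> carrier_vec (n * (2 * N + 1)) \<and>
     (kron (1\<^sub>m n) (1\<^sub>m (2 * N + 1)) - integration_mat a b n h N * K_mat a b n k h N) *\<^sub>v Y =
       integration_mat a b n h N *\<^sub>v G_vec a b n g h N + R_vec n r N"

section \<open>The DE-Sinc-Nystroem solution\<close>

definition J_fun :: "int \<Rightarrow> real \<Rightarrow> real \<Rightarrow> real" where
  "J_fun j h x = h * (1 / 2 + 1 / pi * Si (pi * (x / h - real_of_int j)))"

text \<open>The composition of \<open>J_fun j h\<close> with \<open>phi_DE a b\<close> on the closed interval, where the end
  points correspond to \<open>-\<infinity>\<close> and \<open>+\<infinity>\<close> and receive the limiting values.\<close>

definition J_DE :: "real \<Rightarrow> real \<Rightarrow> int \<Rightarrow> real \<Rightarrow> real \<Rightarrow> real" where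
  "J_DE a b j h t = (if t = a then 0 else if t = b then h else J_fun j h (phi_DE a b t))"

definition nystroem ::
  "real \<Rightarrow> real \<Rightarrow> nat \<Rightarrow> (nat \<Rightarrow> nat \<Rightarrow> complex \<Rightarrow> complex) \<Rightarrow> (nat \<Rightarrow> complex \<Rightarrow> complex) \<Rightarrow>
     (nat \<Rightarrow> complex) \<Rightarrow> real \<Rightarrow> nat \<Rightarrow> complex Matrix.vec \<Rightarrow> nat \<Rightarrow> real \<Rightarrow> complex" where
  "nystroem a b n k g r h N Y i t =
     r i + (\<Sum>j = - int N..int N.
       (at_real a b (g i) (t_DE a b h j)
          + (\<Sum>l<n. at_real a b (k i l) (t_DE a b h j) * Y $ (l * (2 * N + 1) + nat (j + int N))))
       * of_real (psi_DE_deriv a b (real_of_int j * h)) * of_real (J_DE a b j h t))"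

end

theory Submission
  imports
    Defs
    "HOL-Complex_Analysis.Complex_Analysis"
    "HOL-Real_Asymp.Real_Asymp"
    "Jordan_Normal_Form.Determinant"
begin

unbundle no vec_syntax and no fps_syntax

text \<open>
  Transported to the strip by \<open>\<psi>\<close>, the problem is \<open>Y' = B + A Y\<close> with \<open>A = \<psi>' (K \<circ> \<psi>)\<close> and
  \<open>B = \<psi>' (g \<circ> \<psi>)\<close>, both holomorphic, dominated by \<open>C / (1 + (Re \<zeta>)\<^sup>2)\<close>, and doubly exponentially
  small on the real line. Picard iteration from \<open>- \<infinity>\<close> along horizontal lines extends the solution
  to a bounded holomorphic function on the strip, so that \<open>F = B + A Y\<close> has the same properties.
  The derivative of the error of the indefinite quadrature of \<open>F\<close> is \<open>sin (\<pi>s/h) I(s)\<close>, where \<open>I\<close> is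
  the Cauchy type integral of \<open>F(w) / sin (\<pi>w/h)\<close> over the boundary of a rectangle; one integration by
  parts gains the factor \<open>h\<close>, and \<open>1 / sin (\<pi>w/h)\<close> contributes \<open>exp (- \<pi>d/h)\<close>. Finally,
  \<open>\<bar>\<sigma>\<^sub>k - [0 < k]\<bar> \<le> 1 / (1 + \<bar>k\<bar>)\<close>, so the matrix of the linear system is a discrete Volterra operator,
  controlled by a discrete Gronwall inequality, up to a perturbation of size \<open>O(h \<surd>N)\<close>, which tends to \<open>0\<close>.
\<close>

section \<open>Linear systems on the strip\<close>

text \<open>The majorant C / (1 + x^2) gives away most of the available decay, but its primitive is
  the bounded function arctan: iteration weights, contour integrals and Riemann sums over the nodes
  then all have explicit bounds independent of h and N. After the transport, the double exponential
  decay serves only the truncation to |j| <= N. The step size makes sinh(N h) nearly d N / \<alpha>,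
  so the truncation term is about exp(- pi d N / 2), negligible against exp(- pi d / h), whose
  exponent carries an extra 1 / ln(2 d N / \<alpha>). The integration by parts is also needed for
  convergence: the Cauchy type integral is merely bounded, while its derivative is dominated by an
  integrable function. Rectangles must stay inside the open strip, so their height v < d is sent to
  d at the end, which is possible because no constant depends on the distance to the boundary. The
  entries of the discrete matrix do not vanish above the diagonal, so forward substitution alone
  does not give stability. The solution on the strip is built without reference to y; uniqueness at
  minus infinity identifies the two.\<close>

lemma norm_increment_le:
  fixes f :: "real \<Rightarrow> 'a::real_normed_vector" and \<phi> :: "real \<Rightarrow> real"
  assumes "x \<le> y"
    and f: "\<And>t. t \<in> {x..y} \<Longrightarrow> (f has_vector_derivative f' t) (at t)"
    and \<phi>: "\<And>t. t \<in> {x..y} \<Longrightarrow> (\<phi> has_real_derivative \<phi>' t) (at t)"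
    and le: "\<And>t. t \<in> {x..y} \<Longrightarrow> norm (f' t) \<le> \<phi>' t"
  shows "norm (f y - f x) \<le> \<phi> y - \<phi> x"
proof (cases "x = y")
  case False
  have "continuous_on {x..y} f"
    using f by (meson continuous_at_imp_continuous_on has_vector_derivative_continuous)
  moreover have "continuous_on {x..y} \<phi>"
    using \<phi> by (meson continuous_at_imp_continuous_on DERIV_isCont)
  ultimately show ?thesis
    using False assms(1) f \<phi> le
    by (intro differentiable_bound_general[where f' = f' and \<phi>' = \<phi>'])
       (auto simp: has_real_derivative_iff_has_vector_derivative)
qed auto

text \<open>The preceding inequality with the left end point sent to minus infinity. It plays the
  role of an integral over a half line, with \<phi> as a primitive of the majorant, so that no
  integrability has to be discussed.\<close>

lemma norm_le_of_tendsto_0_at_bot: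
  fixes f :: "real \<Rightarrow> 'a::real_normed_vector" and \<phi> :: "real \<Rightarrow> real"
  assumes f: "\<And>t. (f has_vector_derivative f' t) (at t)" and "(f \<longlongrightarrow> 0) at_bot"
    and \<phi>: "\<And>t. (\<phi> has_real_derivative \<phi>' t) (at t)" and "(\<phi> \<longlongrightarrow> c) at_bot"
    and le: "\<And>t. norm (f' t) \<le> \<phi>' t"
  shows "norm (f x) \<le> \<phi> x - c"
proof (rule tendsto_le[of "at_bot :: real filter"])
  show "((\<lambda>s. norm (f x - f s)) \<longlongrightarrow> norm (f x)) at_bot"
    using tendsto_norm[OF tendsto_diff[OF tendsto_const[of "f x"] assms(2)]] by simp
  show "((\<lambda>s. \<phi> x - \<phi> s) \<longlongrightarrow> \<phi> x - c) at_bot"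
    by (intro tendsto_intros assms)
  show "\<forall>\<^sub>F s in at_bot. norm (f x - f s) \<le> \<phi> x - \<phi> s"
    using eventually_le_at_bot[of x] by eventually_elim (rule norm_increment_le[OF _ f \<phi> le])
qed auto

section \<open>Primitives on the strip that vanish at minus infinity\<close>

lemma open_strip: "open (strip d)"
proof -
  have "strip d = {\<zeta>. - d < Im \<zeta>} \<inter> {\<zeta>. Im \<zeta> < d}"
    unfolding strip_def by auto
  then show ?thesis
    by (simp add: open_Int open_halfspace_Im_gt open_halfspace_Im_lt)
qed

lemma convex_strip: "convex (strip d)"
proof -
  have "strip d = {\<zeta>. Im \<zeta> > - d} \<inter> {\<zeta>. Im \<zeta> < d}"
    unfolding strip_def by auto
  then show ?thesis
    by (simp add: convex_Int convex_halfspace_Im_gt convex_halfspace_Im_lt)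
qed

lemma has_vector_derivative_horizontal:
  assumes "(P has_field_derivative D) (at (Complex x v))"
  shows "((\<lambda>x. P (Complex x v)) has_vector_derivative D) (at x)"
proof -
  have "((\<lambda>x. Complex x v) has_vector_derivative 1) (at x)"
    unfolding Complex_eq by (auto intro!: derivative_eq_intros)
  from field_vector_diff_chain_at[OF this assms] show ?thesis by (simp add: o_def)
qed

lemma has_real_derivative_arctan_scaled:
  "((\<lambda>x. K * arctan x) has_real_derivative (K / (1 + x\<^sup>2))) (at x)"
  by (auto intro!: derivative_eq_intros simp: field_simps)

lemma tendsto_arctan_scaled_at_bot:
  "((\<lambda>x. K * arctan x) \<longlongrightarrow> K * (- (pi / 2))) at_bot"
  by (intro tendsto_intros tendsto_arctan_at_bot)

text \<open>Convexity of the strip gives some primitive \<open>g\<close>. Along the real axis g(-k)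
  is a Cauchy sequence, since its increments are dominated by those of K arctan; subtracting its
  limit normalises \<open>g\<close>. Vertical increments at abscissa s are O(1 / (1 + s^2)), so
  every horizontal line has the same limit.\<close>

lemma primitive_from_minus_infinity:
  fixes F :: "complex \<Rightarrow> complex"
  assumes hol: "F holomorphic_on strip d" and "0 < d"
    and bound: "\<And>\<zeta>. \<zeta> \<in> strip d \<Longrightarrow> cmod (F \<zeta>) \<le> K / (1 + (Re \<zeta>)\<^sup>2)"
  obtains P where "\<And>\<zeta>. \<zeta> \<in> strip d \<Longrightarrow> (P has_field_derivative F \<zeta>) (at \<zeta>)"
    and "\<And>\<zeta>. \<zeta> \<in> strip d \<Longrightarrow> cmod (P \<zeta>) \<le> K * (arctan (Re \<zeta>) + pi / 2)"
proof -
  obtain g where "\<And>\<zeta>. \<zeta> \<in> strip d \<Longrightarrow> (g has_field_derivative F \<zeta>) (at \<zeta> within strip d)"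
    using holomorphic_convex_primitive'[OF convex_strip open_strip hol] by blast
  then have g: "(g has_field_derivative F \<zeta>) (at \<zeta>)" if "\<zeta> \<in> strip d" for \<zeta>
    using that at_within_open[OF that open_strip] by metis
  have horiz: "cmod (g (Complex x v) - g (Complex s v)) \<le> K * arctan x - K * arctan s"
    if "s \<le> x" "\<bar>v\<bar> < d" for s x v
  proof (rule norm_increment_le[where f = "\<lambda>x. g (Complex x v)"])
    show "((\<lambda>x. g (Complex x v)) has_vector_derivative F (Complex t v)) (at t)" for t
      using that by (intro has_vector_derivative_horizontal g) (simp add: strip_def)
    show "cmod (F (Complex t v)) \<le> K / (1 + t\<^sup>2)" for t
      using bound[of "Complex t v"] that by (simp add: strip_def)
  qed (use that has_real_derivative_arctan_scaled in auto)
  have vert: "cmod (g (Complex s v) - g (Complex s 0)) \<le> K / (1 + s\<^sup>2) * \<bar>v\<bar>" if "\<bar>v\<bar> < d" for s v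
  proof -
    let ?V = "{z. Re z = s} \<inter> strip d"
    have "cmod (g (Complex s v) - g (Complex s 0)) \<le> K / (1 + s\<^sup>2) * cmod (Complex s v - Complex s 0)"
    proof (rule field_differentiable_bound[of ?V g F])
      show "convex ?V"
      proof -
        have "?V = {z. Re z \<le> s} \<inter> {z. Re z \<ge> s} \<inter> strip d" by auto
        then show ?thesis
          by (simp only:) (intro convex_Int convex_strip convex_halfspace_Re_le convex_halfspace_Re_ge)
      qed
      show "(g has_field_derivative F z) (at z within ?V)" if "z \<in> ?V" for z
        using g[of z] that by (auto intro: has_field_derivative_at_within)
      show "cmod (F z) \<le> K / (1 + s\<^sup>2)" if "z \<in> ?V" for z
        using bound[of z] that by auto
    qed (use that \<open>0 < d\<close> in \<open>auto simp: strip_def\<close>)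
    also have "Complex s v - Complex s 0 = \<i> * of_real v"
      by (simp add: complex_eq_iff)
    finally show ?thesis by (simp add: norm_mult)
  qed
  have m_lim: "((\<lambda>k. K * arctan (- real k)) \<longlonglongrightarrow> K * (- (pi / 2)))"
    by (rule filterlim_compose[OF tendsto_arctan_scaled_at_bot])
       (simp add: filterlim_uminus_at_bot filterlim_real_sequentially)
  define c where "c = (\<lambda>k. g (Complex (- real k) 0))"
  have c_diff: "dist (c k) (c l) \<le> dist (K * arctan (- real k)) (K * arctan (- real l))" for k l
  proof (cases "k \<le> l")
    case True
    then show ?thesis
      using horiz[of "- real l" "- real k" 0] \<open>0 < d\<close> by (auto simp: c_def dist_norm)
  next
    case False
    then show ?thesis
      using horiz[of "- real k" "- real l" 0] \<open>0 < d\<close>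
      by (auto simp: c_def dist_norm norm_minus_commute)
  qed
  have "Cauchy c"
    using LIMSEQ_imp_Cauchy[OF m_lim] unfolding Cauchy_def by (meson c_diff le_less_trans)
  then obtain L where L: "c \<longlonglongrightarrow> L"
    using Cauchy_convergent convergent_def by blast
  show thesis
  proof (rule that[of "\<lambda>\<zeta>. g \<zeta> - L"])
    fix \<zeta> assume \<zeta>: "\<zeta> \<in> strip d"
    show "((\<lambda>\<zeta>. g \<zeta> - L) has_field_derivative F \<zeta>) (at \<zeta>)"
      using g[OF \<zeta>] by (auto intro!: derivative_eq_intros)
    define x v where "x = Re \<zeta>" and "v = Im \<zeta>"
    have v: "\<bar>v\<bar> < d" and \<zeta>_eq: "\<zeta> = Complex x v"
      using \<zeta> by (auto simp: strip_def x_def v_def)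
    \<comment> \<open>The right-hand side is the unsimplified limit of a bound along a path: left
      from \<zeta> to abscissa -k, vertically to the real axis, and finally the difference between
      g(-k) and its limit. The last two contributions vanish.\<close>
    have "cmod (g \<zeta> - L) \<le> K * arctan x - K * (- (pi / 2)) + 0 + cmod (L - L)"
    proof (rule tendsto_lowerbound)
      have "((\<lambda>s. K / (1 + s\<^sup>2) * \<bar>v\<bar>) \<longlongrightarrow> 0) at_bot" by real_asymp
      then have "(\<lambda>k. K / (1 + (- real k)\<^sup>2) * \<bar>v\<bar>) \<longlonglongrightarrow> 0"
        by (rule filterlim_compose) (simp add: filterlim_uminus_at_bot filterlim_real_sequentially)
      then show "(\<lambda>k. K * arctan x - K * arctan (- real k) + K / (1 + (- real k)\<^sup>2) * \<bar>v\<bar> + cmod (c k - L))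
          \<longlonglongrightarrow> K * arctan x - K * (- (pi / 2)) + 0 + cmod (L - L)"
        by (intro tendsto_intros L m_lim)
      show "\<forall>\<^sub>F k in sequentially. cmod (g \<zeta> - L) \<le>
          K * arctan x - K * arctan (- real k) + K / (1 + (- real k)\<^sup>2) * \<bar>v\<bar> + cmod (c k - L)"
        using eventually_ge_at_top[of "nat \<lceil>\<bar>x\<bar>\<rceil>"]
      proof eventually_elim
        case (elim k)
        then have "- real k \<le> x" by linarith
        have "g \<zeta> - L = (g (Complex x v) - g (Complex (- real k) v))
            + (g (Complex (- real k) v) - g (Complex (- real k) 0)) + (c k - L)"
          by (simp add: \<zeta>_eq c_def)
        also have "cmod \<dots> \<le> cmod (g (Complex x v) - g (Complex (- real k) v))
            + cmod (g (Complex (- real k) v) - g (Complex (- real k) 0)) + cmod (c k - L)"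
          by (intro norm_triangle_mono order_refl)
        finally show ?case
          using horiz[OF \<open>- real k \<le> x\<close> v] vert[OF v, of "- real k"] by linarith
      qed
    qed simp
    then show "cmod (g \<zeta> - L) \<le> K * (arctan (Re \<zeta>) + pi / 2)"
      by (simp add: x_def algebra_simps)
  qed
qed

text \<open>Picard iteration contracts by 1/2 in the sup norm weighted with exp(c arctan(Re
  \<zeta>)), for c = 2 n C, on the whole strip at once. The uniform limit is holomorphic, and the
  arctan bound common to all iterates survives in the limit, which gives the value r at minus
  infinity.\<close>

lemma linear_system_on_strip:
  fixes A :: "nat \<Rightarrow> nat \<Rightarrow> complex \<Rightarrow> complex" and b :: "nat \<Rightarrow> complex \<Rightarrow> complex"
    and r :: "nat \<Rightarrow> complex"
  assumes "0 < d"
    and holA: "\<And>i l. i < n \<Longrightarrow> l < n \<Longrightarrow> A i l holomorphic_on strip d"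
    and holb: "\<And>i. i < n \<Longrightarrow> b i holomorphic_on strip d"
    and A: "\<And>i l \<zeta>. i < n \<Longrightarrow> l < n \<Longrightarrow> \<zeta> \<in> strip d \<Longrightarrow> cmod (A i l \<zeta>) \<le> C / (1 + (Re \<zeta>)\<^sup>2)"
    and b: "\<And>i \<zeta>. i < n \<Longrightarrow> \<zeta> \<in> strip d \<Longrightarrow> cmod (b i \<zeta>) \<le> C / (1 + (Re \<zeta>)\<^sup>2)"
    and "0 \<le> C"
  obtains Y B where
    "\<And>i \<zeta>. i < n \<Longrightarrow> \<zeta> \<in> strip d \<Longrightarrow>
       (Y i has_field_derivative (b i \<zeta> + (\<Sum>l<n. A i l \<zeta> * Y l \<zeta>))) (at \<zeta>)"
    and "\<And>i \<zeta>. i < n \<Longrightarrow> \<zeta> \<in> strip d \<Longrightarrow> cmod (Y i \<zeta> - r i) \<le> B * (arctan (Re \<zeta>) + pi / 2)"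
    and "0 \<le> B"
proof -
  let ?S = "strip d"
  define adm where "adm F K \<longleftrightarrow> F holomorphic_on ?S \<and> (\<forall>\<zeta>\<in>?S. cmod (F \<zeta>) \<le> K / (1 + (Re \<zeta>)\<^sup>2))"
    for F and K :: real
  define good where "good F P \<longleftrightarrow> (\<forall>\<zeta>\<in>?S. (P has_field_derivative F \<zeta>) (at \<zeta>)) \<and>
      (\<exists>K. \<forall>\<zeta>\<in>?S. cmod (P \<zeta>) \<le> K * (arctan (Re \<zeta>) + pi / 2))"
    for F P :: "complex \<Rightarrow> complex"
  \<comment> \<open>An arbitrary choice is harmless: \<open>good\<close> forces the limit 0 at minus
    infinity on every horizontal line, so two good primitives of the same function coincide. The
    unspecified constant in \<open>good\<close> is sharpened later by
    \<open>good_bound\<close>.\<close>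
  define T where "T F = (SOME P. good F P)" for F
  have T_good: "good F (T F)" if "adm F K" for F K
  proof -
    have "\<exists>P. good F P"
      unfolding good_def using primitive_from_minus_infinity[of F d K] that \<open>0 < d\<close>
      unfolding adm_def by metis
    then show ?thesis unfolding T_def by (rule someI_ex)
  qed
  have good_tendsto: "((\<lambda>x. P (Complex x v)) \<longlongrightarrow> 0) at_bot" if P: "good F P" and v: "\<bar>v\<bar> < d" for F P v
  proof -
    obtain K where K: "\<forall>\<zeta>\<in>?S. cmod (P \<zeta>) \<le> K * (arctan (Re \<zeta>) + pi / 2)"
      using P unfolding good_def by blast
    show ?thesis
    proof (rule Lim_null_comparison)
      show "\<forall>\<^sub>F x in at_bot. cmod (P (Complex x v)) \<le> K * (arctan x + pi / 2)"
      proof (rule always_eventually, rule allI)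
        fix x
        have "Complex x v \<in> ?S" using v by (simp add: strip_def)
        from bspec[OF K this] show "cmod (P (Complex x v)) \<le> K * (arctan x + pi / 2)" by simp
      qed
      show "((\<lambda>x. K * (arctan x + pi / 2)) \<longlongrightarrow> 0) at_bot"
        using tendsto_mult[OF tendsto_const tendsto_add[OF tendsto_arctan_at_bot tendsto_const[of "pi / 2"]], of K]
        by simp
    qed
  qed
  \<comment> \<open>This comparison drives the iteration: a majorant of the difference of two
    integrands that depends on the abscissa only is integrated from minus infinity along the
    horizontal line through \<zeta>.\<close>
  have good_diff: "cmod (P \<zeta> - P' \<zeta>) \<le> m (Re \<zeta>) - m0"
    if P: "good F P" "good F' P'" and m: "\<And>x. (m has_real_derivative m' x) (at x)" "(m \<longlongrightarrow> m0) at_bot"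
      and le: "\<And>\<zeta>. \<zeta> \<in> ?S \<Longrightarrow> cmod (F \<zeta> - F' \<zeta>) \<le> m' (Re \<zeta>)" and \<zeta>: "\<zeta> \<in> ?S"
    for F F' P P' m m' m0 \<zeta>
  proof -
    define v where "v = Im \<zeta>"
    have v: "\<bar>v\<bar> < d" using \<zeta> by (simp add: v_def strip_def)
    then have in_S: "Complex x v \<in> ?S" for x by (simp add: strip_def)
    have "norm (P (Complex (Re \<zeta>) v) - P' (Complex (Re \<zeta>) v)) \<le> m (Re \<zeta>) - m0"
    proof (rule norm_le_of_tendsto_0_at_bot[where f = "\<lambda>x. P (Complex x v) - P' (Complex x v)"])
      show "((\<lambda>x. P (Complex x v) - P' (Complex x v)) has_vector_derivative
          F (Complex t v) - F' (Complex t v)) (at t)" for t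
        using that in_S unfolding good_def
        by (intro has_vector_derivative_diff has_vector_derivative_horizontal) auto
      show "((\<lambda>x. P (Complex x v) - P' (Complex x v)) \<longlongrightarrow> 0) at_bot"
        using tendsto_diff[OF good_tendsto[OF P(1) v] good_tendsto[OF P(2) v]] by simp
      show "cmod (F (Complex t v) - F' (Complex t v)) \<le> m' t" for t
        using le[OF in_S[of t]] by simp
    qed fact+
    then show ?thesis by (simp add: v_def)
  qed
  define \<Phi> where "\<Phi> i Z \<zeta> = b i \<zeta> + (\<Sum>l<n. A i l \<zeta> * Z l \<zeta>)" for i Z \<zeta>
  define Z where "Z = rec_nat (\<lambda>i \<zeta>. r i) (\<lambda>_ Z i \<zeta>. r i + T (\<Phi> i Z) \<zeta>)"
  have Z_0: "Z 0 = (\<lambda>i \<zeta>. r i)" and Z_Suc: "Z (Suc m) = (\<lambda>i \<zeta>. r i + T (\<Phi> i (Z m)) \<zeta>)" for m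
    by (simp_all add: Z_def)
  define R where "R = (\<Sum>l<n. cmod (r l))"
  have R: "cmod (r l) \<le> R" if "l < n" for l
    unfolding R_def using that by (intro member_le_sum) auto
  have R0: "0 \<le> R" unfolding R_def by (simp add: sum_nonneg)
  have sum_bound: "cmod (\<Sum>l<n. A i l \<zeta> * z l) \<le> real n * C * q / (1 + (Re \<zeta>)\<^sup>2)"
    if "i < n" "\<zeta> \<in> ?S" "\<And>l. l < n \<Longrightarrow> cmod (z l) \<le> q" for i \<zeta> z q
  proof -
    have "cmod (\<Sum>l<n. A i l \<zeta> * z l) \<le> (\<Sum>l<n. C / (1 + (Re \<zeta>)\<^sup>2) * q)"
    proof (rule sum_norm_le)
      fix l assume "l \<in> {..<n}"
      then show "cmod (A i l \<zeta> * z l) \<le> C / (1 + (Re \<zeta>)\<^sup>2) * q"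
        unfolding norm_mult by (intro mult_mono A that) (use that(1) \<open>0 \<le> C\<close> in auto)
    qed
    then show ?thesis by (simp add: mult_ac)
  qed
  have \<Phi>_adm: "adm (\<Phi> i Z) (C + real n * C * q)"
    if "i < n" "\<And>l. l < n \<Longrightarrow> Z l holomorphic_on ?S" "\<And>l \<zeta>. l < n \<Longrightarrow> \<zeta> \<in> ?S \<Longrightarrow> cmod (Z l \<zeta>) \<le> q"
    for i Z q
    unfolding adm_def
  proof (intro conjI ballI)
    show "\<Phi> i Z holomorphic_on ?S"
      unfolding \<Phi>_def using that holA holb by (intro holomorphic_intros) auto
    fix \<zeta> assume \<zeta>: "\<zeta> \<in> ?S"
    have "cmod (\<Phi> i Z \<zeta>) \<le> cmod (b i \<zeta>) + cmod (\<Sum>l<n. A i l \<zeta> * Z l \<zeta>)"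
      unfolding \<Phi>_def by (rule norm_triangle_ineq)
    also have "\<dots> \<le> C / (1 + (Re \<zeta>)\<^sup>2) + real n * C * q / (1 + (Re \<zeta>)\<^sup>2)"
      using that \<zeta> b by (intro add_mono sum_bound) auto
    finally show "cmod (\<Phi> i Z \<zeta>) \<le> (C + real n * C * q) / (1 + (Re \<zeta>)\<^sup>2)"
      by (simp add: add_divide_distrib)
  qed
  have good_bound: "cmod (P \<zeta>) \<le> K * (arctan (Re \<zeta>) + pi / 2)" if "good F P" "adm F K" "\<zeta> \<in> ?S" for F P K \<zeta>
  proof -
    have "good (\<lambda>_. 0) (\<lambda>_. 0)" unfolding good_def by (auto intro!: exI[of _ 0])
    from good_diff[OF that(1) this has_real_derivative_arctan_scaled tendsto_arctan_scaled_at_bot, of K \<zeta>]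
    show ?thesis using that unfolding adm_def by (simp add: algebra_simps)
  qed
  have arctan_le: "arctan x + pi / 2 \<le> pi" "0 \<le> arctan x + pi / 2" for x
    using arctan_ubound[of x] arctan_lbound[of x] by linarith+
  have Z_good: "(\<forall>l<n. Z m l holomorphic_on ?S) \<and> (\<exists>q\<ge>0. \<forall>l<n. \<forall>\<zeta>\<in>?S. cmod (Z m l \<zeta>) \<le> q)" for m
  proof (induction m)
    case 0
    then show ?case using R R0 by (auto simp: Z_0)
  next
    case (Suc m)
    then obtain q where q: "0 \<le> q" "\<And>l \<zeta>. l < n \<Longrightarrow> \<zeta> \<in> ?S \<Longrightarrow> cmod (Z m l \<zeta>) \<le> q" by auto
    let ?K = "C + real n * C * q"
    have adm: "adm (\<Phi> i (Z m)) ?K" if "i < n" for i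
      using \<Phi>_adm that Suc q by auto
    have "T (\<Phi> i (Z m)) holomorphic_on ?S" if "i < n" for i
      using T_good[OF adm[OF that]] unfolding good_def holomorphic_on_def
      by (metis field_differentiable_at_within field_differentiable_def)
    moreover have "cmod (Z (Suc m) i \<zeta>) \<le> R + ?K * pi" if "i < n" "\<zeta> \<in> ?S" for i \<zeta>
    proof -
      have "cmod (T (\<Phi> i (Z m)) \<zeta>) \<le> ?K * (arctan (Re \<zeta>) + pi / 2)"
        using good_bound T_good adm that by blast
      also have "\<dots> \<le> ?K * pi"
        using arctan_le[of "Re \<zeta>"] q \<open>0 \<le> C\<close> by (intro mult_left_mono) auto
      finally show ?thesis
        using R[OF that(1)] norm_triangle_ineq[of "r i" "T (\<Phi> i (Z m)) \<zeta>"] by (simp add: Z_Suc)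
    qed
    moreover have "0 \<le> R + ?K * pi" using R0 q \<open>0 \<le> C\<close> by simp
    ultimately show ?case
      by (auto simp: Z_Suc intro!: holomorphic_intros exI[of _ "R + ?K * pi"])
  qed
  have Z_T: "good (\<Phi> i (Z m)) (\<lambda>\<zeta>. Z (Suc m) i \<zeta> - r i)" if "i < n" for i m
  proof -
    obtain q where "0 \<le> q" "\<And>l \<zeta>. l < n \<Longrightarrow> \<zeta> \<in> ?S \<Longrightarrow> cmod (Z m l \<zeta>) \<le> q"
      using Z_good[of m] by auto
    then have "good (\<Phi> i (Z m)) (T (\<Phi> i (Z m)))"
      using T_good \<Phi>_adm[of i "Z m" q] that Z_good[of m] by blast
    then show ?thesis by (simp add: Z_Suc)
  qed
  \<comment> \<open>With this exponent n C w / (1 + x^2) is half of the derivative of w, so one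
    Picard step halves a bound of the form const * w.\<close>
  define c where "c = 2 * real n * C"
  define w where "w x = exp (c * arctan x)" for x
  have w_deriv: "(w has_real_derivative (c / (1 + x\<^sup>2) * w x)) (at x)" for x
    unfolding w_def by (auto intro!: derivative_eq_intros simp: field_simps)
  have w_lim: "(w \<longlongrightarrow> exp (c * (- (pi / 2)))) at_bot"
    unfolding w_def by (intro tendsto_intros tendsto_arctan_at_bot)
  have c0: "0 \<le> c" using \<open>0 \<le> C\<close> by (simp add: c_def)
  have w_low: "exp (- (c * (pi / 2))) \<le> w x" for x
    using mult_left_mono[OF less_imp_le[OF arctan_lbound[of x]] c0] by (simp add: w_def)
  have w_up: "w x \<le> exp (c * (pi / 2))" for x
    using mult_left_mono[OF less_imp_le[OF arctan_ubound[of x]] c0] by (simp add: w_def)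
  \<comment> \<open>The last factor is the reciprocal of the infimum of the weight; it turns the
    constant bound of the first increment into a multiple of \<open>w\<close>.\<close>
  define K0 where "K0 = (C + real n * C * R) * pi * exp (c * (pi / 2))"
  have K0: "0 \<le> K0" unfolding K0_def using \<open>0 \<le> C\<close> R0 by simp
  have D: "cmod (Z (Suc m) i \<zeta> - Z m i \<zeta>) \<le> K0 * (1/2) ^ m * w (Re \<zeta>)"
    if "i < n" "\<zeta> \<in> ?S" for m i \<zeta>
    using that
  proof (induction m arbitrary: i \<zeta>)
    case 0
    have "adm (\<Phi> i (Z 0)) (C + real n * C * R)"
      using 0 R by (intro \<Phi>_adm) (auto simp: Z_0)
    then have "cmod (Z (Suc 0) i \<zeta> - r i) \<le> (C + real n * C * R) * (arctan (Re \<zeta>) + pi / 2)"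
      using good_bound Z_T 0 by blast
    also have "\<dots> \<le> (C + real n * C * R) * pi"
      using arctan_le[of "Re \<zeta>"] R0 \<open>0 \<le> C\<close> by (intro mult_left_mono) auto
    also have "\<dots> = K0 * exp (- (c * (pi / 2)))"
      by (simp add: K0_def mult.assoc flip: exp_add)
    also have "\<dots> \<le> K0 * w (Re \<zeta>)" by (intro mult_left_mono w_low K0)
    finally show ?case by (simp add: Z_0)
  next
    case (Suc m)
    let ?k = "K0 * (1/2) ^ Suc m"
    have "cmod ((Z (Suc (Suc m)) i \<zeta> - r i) - (Z (Suc m) i \<zeta> - r i))
        \<le> ?k * w (Re \<zeta>) - ?k * exp (c * (- (pi / 2)))"
    proof (rule good_diff[OF Z_T Z_T, where m = "\<lambda>x. ?k * w x"
          and m' = "\<lambda>x. ?k * (c / (1 + x\<^sup>2) * w x)"])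
      show "((\<lambda>x. ?k * w x) \<longlongrightarrow> ?k * exp (c * (- (pi / 2)))) at_bot"
        by (intro tendsto_intros w_lim)
      show "((\<lambda>x. ?k * w x) has_real_derivative ?k * (c / (1 + x\<^sup>2) * w x)) (at x)" for x
        by (intro DERIV_cmult w_deriv)
      fix \<xi> assume \<xi>: "\<xi> \<in> ?S"
      have "\<Phi> i (Z (Suc m)) \<xi> - \<Phi> i (Z m) \<xi> = (\<Sum>l<n. A i l \<xi> * (Z (Suc m) l \<xi> - Z m l \<xi>))"
        by (simp add: \<Phi>_def algebra_simps sum_subtractf)
      also have "cmod \<dots> \<le> real n * C * (K0 * (1/2) ^ m * w (Re \<xi>)) / (1 + (Re \<xi>)\<^sup>2)"
        using Suc \<xi> by (intro sum_bound) auto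
      also have "\<dots> = ?k * (c / (1 + (Re \<xi>)\<^sup>2) * w (Re \<xi>))"
        by (simp add: c_def)
      finally show "cmod (\<Phi> i (Z (Suc m)) \<xi> - \<Phi> i (Z m) \<xi>) \<le> ?k * (c / (1 + (Re \<xi>)\<^sup>2) * w (Re \<xi>))" .
    qed (use Suc in auto)
    also have "\<dots> \<le> ?k * w (Re \<zeta>)" using K0 by simp
    finally show ?case by simp
  qed
  define M where "M = K0 * exp (c * (pi / 2))"
  have M0: "0 \<le> M" using K0 by (simp add: M_def)
  have D': "cmod (Z (Suc m) i \<zeta> - Z m i \<zeta>) \<le> M * (1/2) ^ m" if "i < n" "\<zeta> \<in> ?S" for m i \<zeta>
  proof -
    have "K0 * (1/2) ^ m * w (Re \<zeta>) \<le> K0 * (1/2) ^ m * exp (c * (pi / 2))"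
      using K0 by (intro mult_left_mono w_up) auto
    then show ?thesis using D[OF that, of m] by (simp add: M_def mult_ac)
  qed
  have sm: "summable (\<lambda>m. M * (1/2) ^ m)" by (intro summable_mult summable_geometric) simp
  define Y where "Y i \<zeta> = r i + (\<Sum>m. Z (Suc m) i \<zeta> - Z m i \<zeta>)" for i \<zeta>
  have unif: "uniform_limit ?S (\<lambda>m. Z m i) (Y i) sequentially" if "i < n" for i
  proof -
    have "uniform_limit ?S (\<lambda>N \<zeta>. \<Sum>m<N. Z (Suc m) i \<zeta> - Z m i \<zeta>)
        (\<lambda>\<zeta>. \<Sum>m. Z (Suc m) i \<zeta> - Z m i \<zeta>) sequentially"
      by (rule Weierstrass_m_test[OF _ sm]) (use D' that in auto)
    then have "uniform_limit ?S (\<lambda>N \<zeta>. r i + (\<Sum>m<N. Z (Suc m) i \<zeta> - Z m i \<zeta>)) (Y i) sequentially"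
      unfolding Y_def by (intro uniform_limit_intros)
    moreover have "r i + (\<Sum>m<N. Z (Suc m) i \<zeta> - Z m i \<zeta>) = Z N i \<zeta>" for N \<zeta>
      by (subst sum_lessThan_telescope) (simp add: Z_0)
    ultimately show ?thesis by simp
  qed
  have Z_bound: "cmod (Z m i \<zeta>) \<le> R + M * 2" if "i < n" "\<zeta> \<in> ?S" for m i \<zeta>
  proof -
    have "Z m i \<zeta> = r i + (\<Sum>k<m. Z (Suc k) i \<zeta> - Z k i \<zeta>)"
      by (subst sum_lessThan_telescope) (simp add: Z_0)
    moreover have "cmod (\<Sum>k<m. Z (Suc k) i \<zeta> - Z k i \<zeta>) \<le> (\<Sum>k<m. M * (1/2) ^ k)"
      by (intro sum_norm_le) (use D' that in auto)
    moreover have "(\<Sum>k<m. M * (1/2) ^ k) \<le> (\<Sum>k. M * (1/2) ^ k)"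
      by (intro sum_le_suminf sm) (use M0 in auto)
    moreover have "(\<Sum>k. M * (1/2) ^ k) = M * 2"
      by (subst suminf_mult) (auto simp: suminf_geometric)
    ultimately show ?thesis
      using R[OF that(1)] norm_triangle_ineq[of "r i" "\<Sum>k<m. Z (Suc k) i \<zeta> - Z k i \<zeta>"] by simp
  qed
  define B where "B = C + real n * C * (R + M * 2)"
  have B0: "0 \<le> B" using R0 M0 \<open>0 \<le> C\<close> by (simp add: B_def)
  show thesis
  proof (rule that[of Y B])
    fix i \<zeta> assume i: "i < n" and \<zeta>: "\<zeta> \<in> ?S"
    have lim: "(\<lambda>m. Z m l \<zeta>) \<longlonglongrightarrow> Y l \<zeta>" if "l < n" for l
      using tendsto_uniform_limitI[OF unif[OF that] \<zeta>] .
    have "cmod (Z (Suc m) i \<zeta> - r i) \<le> B * (arctan (Re \<zeta>) + pi / 2)" for m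
    proof -
      have "adm (\<Phi> i (Z m)) B"
        unfolding B_def using Z_good[of m] Z_bound i by (intro \<Phi>_adm) auto
      then show ?thesis using good_bound Z_T i \<zeta> by blast
    qed
    then show "cmod (Y i \<zeta> - r i) \<le> B * (arctan (Re \<zeta>) + pi / 2)"
      by (intro LIMSEQ_le_const2[OF tendsto_norm[OF tendsto_diff[OF LIMSEQ_Suc[OF lim[OF i]] tendsto_const]]])
         auto
    obtain g' where g': "\<And>x. x \<in> ?S \<Longrightarrow> (Y i has_field_derivative g' x) (at x) \<and>
        (\<lambda>m. \<Phi> i (Z m) x) \<longlonglongrightarrow> g' x"
    proof -
      have "\<exists>g'. \<forall>x\<in>?S. (Y i has_field_derivative g' x) (at x) \<and> (\<lambda>m. \<Phi> i (Z m) x) \<longlonglongrightarrow> g' x"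
      proof (rule has_complex_derivative_uniform_sequence[OF open_strip, where f = "\<lambda>m. Z (Suc m) i"])
        fix m x assume "x \<in> ?S"
        then have "((\<lambda>\<zeta>. Z (Suc m) i \<zeta> - r i) has_field_derivative \<Phi> i (Z m) x) (at x)"
          using Z_T[OF i] unfolding good_def by blast
        from DERIV_add[OF this DERIV_const[of "r i"]]
        show "(Z (Suc m) i has_field_derivative \<Phi> i (Z m) x) (at x)" by simp
      next
        fix x assume "x \<in> ?S"
        then obtain e where "0 < e" "cball x e \<subseteq> ?S"
          using open_strip open_contains_cball by blast
        moreover have "uniform_limit ?S (\<lambda>m. Z (Suc m) i) (Y i) sequentially"
          using unif[OF i] by (subst filterlim_sequentially_Suc)
        ultimately show "\<exists>d>0. cball x d \<subseteq> ?S \<and>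
            uniform_limit (cball x d) (\<lambda>m. Z (Suc m) i) (Y i) sequentially"
          using uniform_limit_on_subset by blast
      qed
      then show thesis using that by blast
    qed
    \<comment> \<open>The derivatives of the iterates converge to the derivative of the limit;
      computing their limit through the equation identifies it.\<close>
    have "(\<lambda>m. \<Phi> i (Z m) \<zeta>) \<longlonglongrightarrow> b i \<zeta> + (\<Sum>l<n. A i l \<zeta> * Y l \<zeta>)"
      unfolding \<Phi>_def by (intro tendsto_add tendsto_const tendsto_sum tendsto_mult lim) auto
    then show "(Y i has_field_derivative (b i \<zeta> + (\<Sum>l<n. A i l \<zeta> * Y l \<zeta>))) (at \<zeta>)"
      using g'[OF \<zeta>] LIMSEQ_unique[OF _ conjunct2[OF g'[OF \<zeta>]]] by metis
  qed (rule B0)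
qed

text \<open>The weight of the existence proof, rescaled so that it tends to 1 at minus infinity and
  is at least 1 everywhere. The a priori bound K is then at most K w, and each pass through the
  equation halves it, so only 0 remains.\<close>

lemma linear_system_unique_at_bot:
  fixes u :: "nat \<Rightarrow> real \<Rightarrow> complex" and A :: "nat \<Rightarrow> nat \<Rightarrow> real \<Rightarrow> complex"
  assumes u: "\<And>i x. i < n \<Longrightarrow> (u i has_vector_derivative (\<Sum>l<n. A i l x * u l x)) (at x)"
    and lim: "\<And>i. i < n \<Longrightarrow> (u i \<longlongrightarrow> 0) at_bot"
    and bdd: "\<And>i x. i < n \<Longrightarrow> cmod (u i x) \<le> K"
    and A: "\<And>i l x. i < n \<Longrightarrow> l < n \<Longrightarrow> cmod (A i l x) \<le> C / (1 + x\<^sup>2)"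
    and "0 \<le> C" and "0 \<le> K" and i: "i < n"
  shows "u i x = 0"
proof -
  define c where "c = 2 * real n * C"
  have c0: "0 \<le> c" using \<open>0 \<le> C\<close> by (simp add: c_def)
  define w where "w x = exp (c * (pi / 2)) * exp (c * arctan x)" for x
  have w_deriv: "(w has_real_derivative (c / (1 + x\<^sup>2) * w x)) (at x)" for x
    unfolding w_def by (auto intro!: derivative_eq_intros simp: field_simps)
  have "(w \<longlongrightarrow> exp (c * (pi / 2)) * exp (c * (- (pi / 2)))) at_bot"
    unfolding w_def by (intro tendsto_intros tendsto_arctan_at_bot)
  then have w_lim: "(w \<longlongrightarrow> 1) at_bot" by (simp flip: exp_add)
  have w1: "1 \<le> w x" for x
  proof -
    have "0 \<le> c * (pi / 2 + arctan x)" using c0 arctan_lbound[of x] by simp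
    then show ?thesis by (simp add: w_def distrib_left flip: exp_add)
  qed
  have *: "cmod (u i x) \<le> K * (1/2) ^ m * w x" if "i < n" for m i x
    using that
  proof (induction m arbitrary: i x)
    case 0
    then show ?case using bdd[of i x] mult_left_mono[OF w1[of x] \<open>0 \<le> K\<close>] by simp
  next
    case (Suc m)
    let ?k = "K * (1/2) ^ Suc m"
    have "cmod (u i x) \<le> ?k * w x - ?k * 1"
    proof (rule norm_le_of_tendsto_0_at_bot[where \<phi>' = "\<lambda>x. ?k * (c / (1 + x\<^sup>2) * w x)", OF u lim])
      show "((\<lambda>x. ?k * w x) has_real_derivative ?k * (c / (1 + x\<^sup>2) * w x)) (at x)" for x
        by (intro DERIV_cmult w_deriv)
      show "((\<lambda>x. ?k * w x) \<longlongrightarrow> ?k * 1) at_bot" by (intro tendsto_intros w_lim)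
      fix t
      have "cmod (\<Sum>l<n. A i l t * u l t) \<le> (\<Sum>l<n. C / (1 + t\<^sup>2) * (K * (1/2) ^ m * w t))"
      proof (rule sum_norm_le)
        fix l assume "l \<in> {..<n}"
        then show "cmod (A i l t * u l t) \<le> C / (1 + t\<^sup>2) * (K * (1/2) ^ m * w t)"
          unfolding norm_mult by (intro mult_mono A Suc) (use Suc.prems \<open>0 \<le> C\<close> in auto)
      qed
      also have "\<dots> = ?k * (c / (1 + t\<^sup>2) * w t)" by (simp add: c_def mult_ac)
      finally show "cmod (\<Sum>l<n. A i l t * u l t) \<le> ?k * (c / (1 + t\<^sup>2) * w t)" .
    qed (use Suc in auto)
    also have "\<dots> \<le> ?k * w x" using \<open>0 \<le> K\<close> by simp
    finally show ?case .
  qed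
  have "(\<lambda>m. K * (1/2) ^ m * w x) \<longlonglongrightarrow> K * 0 * w x"
    by (intro tendsto_intros LIMSEQ_realpow_zero) auto
  then have "cmod (u i x) \<le> K * 0 * w x"
    by (rule LIMSEQ_le_const) (use * i in auto)
  then show ?thesis by simp
qed

section \<open>The sine integral and contour integrals over rectangles\<close>

text \<open>Integration by parts in the tail: Si t + cos t / t has derivative - cos t / t^2. Its
  increments beyond x cost at most 1/x, and the correction cos x / x costs another 1/x.\<close>

lemma abs_Si_minus_half_pi_le:
  assumes "0 < x"
  shows "\<bar>Si x - pi / 2\<bar> \<le> 2 / x"
proof -
  define G where "G t = Si t + cos t / t" for t :: real
  have G': "(G has_vector_derivative (- cos t / t\<^sup>2)) (at t)" if "x \<le> t" for t
  proof -
    have "t \<noteq> 0" using that assms by simp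
    then show ?thesis
      unfolding G_def has_real_derivative_iff_has_vector_derivative[symmetric]
      by (auto intro!: derivative_eq_intros DERIV_Si simp: field_simps power2_eq_square)
  qed
  have le: "\<bar>G s - G x\<bar> \<le> 1 / x - 1 / s" if "x \<le> s" for s
  proof -
    have "norm (G s - G x) \<le> - 1 / s - (- 1 / x)"
    proof (rule norm_increment_le[OF that G'])
      fix t assume "t \<in> {x..s}"
      then have "t \<noteq> 0" using assms by simp
      then show "((\<lambda>t. - 1 / t) has_real_derivative 1 / t\<^sup>2) (at t)"
        by (auto intro!: derivative_eq_intros simp: field_simps power2_eq_square)
      show "norm (- cos t / t\<^sup>2) \<le> 1 / t\<^sup>2"
        by (simp add: divide_right_mono)
    qed auto
    then show ?thesis by simp
  qed
  have "((\<lambda>t::real. cos t / t) \<longlongrightarrow> 0) at_top"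
  proof (rule Lim_null_comparison)
    show "\<forall>\<^sub>F t in at_top. norm (cos t / t) \<le> 1 / t"
      using eventually_gt_at_top[of 0] by eventually_elim (simp add: divide_right_mono)
    show "((\<lambda>t::real. 1 / t) \<longlongrightarrow> 0) at_top" by real_asymp
  qed
  then have G_lim: "(G \<longlongrightarrow> pi / 2 + 0) at_top"
    unfolding G_def by (rule tendsto_add[OF Si_at_top])
  have "((\<lambda>s::real. 1 / x - 1 / s) \<longlongrightarrow> 1 / x) at_top" by real_asymp
  moreover have "((\<lambda>s. \<bar>G s - G x\<bar>) \<longlongrightarrow> \<bar>pi / 2 + 0 - G x\<bar>) at_top"
    by (intro tendsto_rabs tendsto_diff G_lim tendsto_const)
  moreover have "\<forall>\<^sub>F s in at_top. \<bar>G s - G x\<bar> \<le> 1 / x - 1 / s"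
    using eventually_ge_at_top[of x] by eventually_elim (rule le)
  ultimately have "\<bar>pi / 2 + 0 - G x\<bar> \<le> 1 / x"
    by (intro tendsto_le[of at_top _ "1 / x" _ "\<bar>pi / 2 + 0 - G x\<bar>"]) auto
  moreover have "\<bar>cos x / x\<bar> \<le> 1 / x"
    using assms by (simp add: divide_right_mono)
  moreover have "1 / x + 1 / x = 2 / x" by simp
  ultimately show ?thesis unfolding G_def by linarith
qed

lemma Si_at_bot: "(Si \<longlongrightarrow> - pi / 2) at_bot"
proof -
  have "((\<lambda>x. - Si x) \<longlongrightarrow> - (pi / 2)) at_top"
    by (intro tendsto_minus Si_at_top)
  moreover have "\<forall>\<^sub>F x in at_top. - Si x = Si (- x)"
    using eventually_ge_at_top[of 0] by eventually_elim (simp add: Si_neg)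
  ultimately have "((\<lambda>x. Si (- x)) \<longlongrightarrow> - (pi / 2)) at_top"
    by (rule Lim_transform_eventually)
  then show ?thesis unfolding filterlim_at_bot_mirror by simp
qed

text \<open>For k > 0 the tail bound gives 2 / (pi^2 k), which is at most 1 / (1 + k) because pi >=
  2 and k >= 1; negative k follows by oddness of \<open>Si\<close>. The strict inequality in the
  indicator makes the main part strictly triangular; the diagonal value 1/2 is left to the
  remainder.\<close>

lemma abs_sigma_minus_indicator_le:
  "\<bar>sigma k - of_bool (0 < k)\<bar> \<le> 1 / (1 + \<bar>real_of_int k\<bar>)"
proof -
  have pos: "\<bar>Si (pi * real_of_int m) / pi - 1 / 2\<bar> \<le> 1 / (1 + real_of_int m)" if "0 < m" for m :: int
  proof -
    have "\<bar>Si (pi * real_of_int m) - pi / 2\<bar> \<le> 2 / (pi * real_of_int m)"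
      using that by (intro abs_Si_minus_half_pi_le) simp
    then have "\<bar>(Si (pi * real_of_int m) - pi / 2) / pi\<bar> \<le> 2 / (pi * real_of_int m) / pi"
      unfolding abs_divide by (metis abs_of_pos divide_right_mono pi_gt_zero less_imp_le)
    moreover have "(Si (pi * real_of_int m) - pi / 2) / pi = Si (pi * real_of_int m) / pi - 1 / 2"
      by (simp add: diff_divide_distrib)
    moreover have "2 / (pi * real_of_int m) / pi \<le> 1 / (1 + real_of_int m)"
    proof -
      have "2 * (1 + real_of_int m) \<le> 4 * real_of_int m" using that by simp
      also have "\<dots> \<le> (pi * pi) * real_of_int m"
        using that mult_mono[of 2 pi 2 pi] pi_ge_two by (intro mult_right_mono) auto
      finally show ?thesis using that by (simp add: field_simps)
    qed
    ultimately show ?thesis by linarith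
  qed
  consider "0 < k" | "k = 0" | "k < 0" by linarith
  then show ?thesis
  proof cases
    case 1
    then show ?thesis using pos[of k] by (simp add: sigma_def)
  next
    case 2
    then show ?thesis using Si_neg[of 0] by (simp add: sigma_def)
  next
    case 3
    have "Si (pi * real_of_int k) = - Si (pi * real_of_int (- k))"
      using Si_neg[of "pi * real_of_int (- k)"] 3 by (simp add: mult_nonneg_nonpos)
    then have "sigma k - of_bool (0 < k) = - (Si (pi * real_of_int (- k)) / pi - 1 / 2)"
      using 3 by (simp add: sigma_def)
    then show ?thesis using pos[of "- k"] 3 by simp
  qed
qed

lemma J_fun_bounded:
  obtains c where "0 \<le> c" and "\<And>j h x. 0 < h \<Longrightarrow> \<bar>J_fun j h x\<bar> \<le> c * h"
proof -
  obtain B where B: "\<And>T. \<bar>Si T\<bar> \<le> B" using bounded_Si by auto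
  have B0: "0 \<le> B" using B[of 0] by simp
  show thesis
  proof (rule that[of "1 / 2 + 1 / pi * B"])
    fix j :: int and h x :: real assume "0 < h"
    have "\<bar>J_fun j h x\<bar> = h * \<bar>1 / 2 + 1 / pi * Si (pi * (x / h - real_of_int j))\<bar>"
      using \<open>0 < h\<close> by (simp add: J_fun_def abs_mult)
    also have "\<bar>1 / 2 + 1 / pi * Si (pi * (x / h - real_of_int j))\<bar>
        \<le> 1 / 2 + 1 / pi * \<bar>Si (pi * (x / h - real_of_int j))\<bar>"
      using abs_triangle_ineq[of "1/2" "1 / pi * Si (pi * (x / h - real_of_int j))"]
      by (simp add: abs_mult)
    also have "\<dots> \<le> 1 / 2 + 1 / pi * B"
      by (intro add_left_mono mult_left_mono B) auto
    finally show "\<bar>J_fun j h x\<bar> \<le> (1 / 2 + 1 / pi * B) * h"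
      using \<open>0 < h\<close> by (simp add: mult.commute)
  qed (use B0 in simp)
qed

text \<open>The inner derivative pi / h cancels both prefactors: differentiating the indefinite
  quadrature returns the cardinal sinc interpolant, whose error is a contour integral.\<close>

lemma J_fun_has_derivative:
  assumes "h \<noteq> 0"
  shows "(J_fun j h has_real_derivative sinc (pi * (x / h - real_of_int j))) (at x)"
proof -
  have "((\<lambda>x. pi * (x / h - real_of_int j)) has_real_derivative pi / h) (at x)"
    using assms by (auto intro!: derivative_eq_intros)
  from DERIV_chain2[OF DERIV_Si this]
  have "((\<lambda>x. Si (pi * (x / h - real_of_int j))) has_real_derivative
      sinc (pi * (x / h - real_of_int j)) * (pi / h)) (at x)" .
  from DERIV_cmult[OF DERIV_add[OF DERIV_const[of "1/2"] DERIV_cmult[OF this, of "1 / pi"]], of h]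
  show ?thesis unfolding J_fun_def[abs_def] using assms by (simp add: field_simps)
qed

lemma J_fun_at_bot:
  assumes "0 < h"
  shows "(J_fun j h \<longlongrightarrow> 0) at_bot"
proof -
  have "filterlim (\<lambda>x. pi * (x / h - real_of_int j)) at_bot at_bot"
    using assms by real_asymp
  from filterlim_compose[OF Si_at_bot this]
  have "((\<lambda>x. h * (1 / 2 + 1 / pi * Si (pi * (x / h - real_of_int j))))
      \<longlongrightarrow> h * (1 / 2 + 1 / pi * (- pi / 2))) at_bot"
    by (intro tendsto_mult tendsto_add tendsto_const)
  then show ?thesis unfolding J_fun_def by simp
qed

lemma J_fun_at_top:
  assumes "0 < h"
  shows "(J_fun j h \<longlongrightarrow> h) at_top"
proof -
  have "filterlim (\<lambda>x. pi * (x / h - real_of_int j)) at_top at_top"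
    using assms by real_asymp
  from filterlim_compose[OF Si_at_top this]
  have "((\<lambda>x. h * (1 / 2 + 1 / pi * Si (pi * (x / h - real_of_int j))))
      \<longlongrightarrow> h * (1 / 2 + 1 / pi * (pi / 2))) at_top"
    by (intro tendsto_mult tendsto_add tendsto_const)
  then show ?thesis unfolding J_fun_def by simp
qed

section \<open>Lower bounds for the sine, and residues at its zeros\<close>

text \<open>The square of |sin z| is sin(Re z)^2 + sinh(Im z)^2, and the first term is dropped. On
  the horizontal sides this is the source of the factor 1 / sinh(pi v / h).\<close>

lemma sinh_abs_Im_le_norm_sin: "sinh \<bar>Im z\<bar> \<le> cmod (sin z)"
proof (rule power2_le_imp_le)
  define E where "E = exp (Im z)"
  have E: "E \<noteq> 0" "exp (2 * Im z) = E * E" "exp (- Im z) = inverse E"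
    by (simp_all add: E_def exp_double power2_eq_square exp_minus)
  have "(sinh \<bar>Im z\<bar>)\<^sup>2 = (sinh (Im z))\<^sup>2" by (cases "0 \<le> Im z") auto
  also have "\<dots> = (exp (2 * Im z) + inverse (exp (2 * Im z)) - 2) / 4"
    unfolding sinh_field_def E(2,3) E_def[symmetric] using E(1)
    by (simp add: power2_eq_square field_simps)
  also have "\<dots> \<le> (cmod (sin z))\<^sup>2"
    unfolding norm_sin_squared using cos_le_one[of "2 * Re z"] by simp
  finally show "(sinh \<bar>Im z\<bar>)\<^sup>2 \<le> (cmod (sin z))\<^sup>2" .
qed simp

text \<open>The hypothesis says that Re z is an odd multiple of pi / 2, where |sin z| = cosh(Im z).
  This is the situation on the vertical sides, which lie halfway between two nodes.\<close>

lemma one_le_norm_sin: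
  assumes "cos (2 * Re z) = - 1"
  shows "1 \<le> cmod (sin z)"
proof (rule power2_le_imp_le)
  define E where "E = exp (Im z)"
  have E: "0 < E" "exp (2 * Im z) = E * E"
    by (simp_all add: E_def exp_double power2_eq_square)
  have "0 \<le> (E - inverse E)\<^sup>2" by simp
  then have "2 \<le> exp (2 * Im z) + inverse (exp (2 * Im z))"
    unfolding E(2) using E(1) by (simp add: power2_eq_square algebra_simps)
  then show "1\<^sup>2 \<le> (cmod (sin z))\<^sup>2"
    unfolding norm_sin_squared using assms by simp
qed simp

text \<open>Where \<open>f\<close> vanishes the quotient has no pole and the simple pole formula
  does not apply; f / g = (f + 1) / g - 1 / g then reduces to two genuine poles. The case matters
  because the integrand may vanish at a node.\<close>

lemma residue_quotient_simple_zero: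
  assumes "f holomorphic_on s" "g holomorphic_on s" and s: "open s" "z \<in> s"
    and g': "(g has_field_derivative g') (at z)" and "g z = 0" "g' \<noteq> 0"
    and nz: "\<And>w. w \<in> s - {z} \<Longrightarrow> g w \<noteq> 0"
  shows "residue (\<lambda>w. f w / g w) z = f z / g'"
proof -
  obtain e where e: "0 < e" "ball z e \<subseteq> s" using s open_contains_ball by blast
  have f: "f holomorphic_on ball z e" and g: "g holomorphic_on ball z e"
    using assms(1,2) e(2) holomorphic_on_subset by blast+
  have simple: "residue (\<lambda>w. F w / g w) z = F z / g'" if "F holomorphic_on ball z e" "F z \<noteq> 0" for F
    by (rule residue_simple_pole_deriv[OF that(1) g _ _ _ g' that(2)]) (use e assms in auto)
  show ?thesis
  proof (cases "f z = 0")
    case False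
    then show ?thesis using simple f by blast
  next
    case True
    have "residue (\<lambda>w. (f w + 1) / g w - 1 / g w) z
        = residue (\<lambda>w. (f w + 1) / g w) z - residue (\<lambda>w. 1 / g w) z"
      by (rule residue_diff[of "ball z e"])
         (use f g e nz in \<open>auto intro!: holomorphic_intros simp: subset_iff
            intro: holomorphic_on_subset\<close>)
    also have "residue (\<lambda>w. (f w + 1) / g w) z = (f z + 1) / g'"
      by (rule simple) (use f True in \<open>auto intro!: holomorphic_intros\<close>)
    also have "residue (\<lambda>w. 1 / g w) z = 1 / g'"
      by (rule simple) auto
    finally show ?thesis using True by (simp add: diff_divide_distrib[symmetric])
  qed
qed

section \<open>Contour integrals over the boundary of a rectangle\<close>

text \<open>The four sides, counterclockwise, are kept as separate segments so that estimates and
  differentiation with respect to a parameter apply side by side.\<close>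

definition rect_integral :: "real \<Rightarrow> real \<Rightarrow> (complex \<Rightarrow> complex) \<Rightarrow> complex" where
  "rect_integral R v f =
     contour_integral (linepath (Complex (- R) (- v)) (Complex R (- v))) f
     + contour_integral (linepath (Complex R (- v)) (Complex R v)) f
     + contour_integral (linepath (Complex R v) (Complex (- R) v)) f
     + contour_integral (linepath (Complex (- R) v) (Complex (- R) (- v))) f"

definition rect_frontier :: "real \<Rightarrow> real \<Rightarrow> complex set" where
  "rect_frontier R v = {w. \<bar>Re w\<bar> \<le> R \<and> \<bar>Im w\<bar> = v} \<union> {w. \<bar>Re w\<bar> = R \<and> \<bar>Im w\<bar> \<le> v}"

lemma rect_sides_subset:
  assumes "0 < R" "0 < v"
  shows "closed_segment (Complex (- R) (- v)) (Complex R (- v)) \<subseteq> rect_frontier R v"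
    "closed_segment (Complex R (- v)) (Complex R v) \<subseteq> rect_frontier R v"
    "closed_segment (Complex R v) (Complex (- R) v) \<subseteq> rect_frontier R v"
    "closed_segment (Complex (- R) v) (Complex (- R) (- v)) \<subseteq> rect_frontier R v"
  using assms
  by (auto simp: rect_frontier_def closed_segment_same_Im closed_segment_same_Re
      closed_segment_eq_real_ivl split: if_splits)

lemma path_image_rectpath_eq_rect_frontier:
  assumes "0 < R" "0 < v"
  shows "path_image (rectpath (Complex (- R) (- v)) (Complex R v)) = rect_frontier R v"
  using assms by (subst path_image_rectpath) (auto simp: rect_frontier_def abs_le_iff abs_if)

lemma contour_integral_rectpath:
  assumes "0 < R" "0 < v" and f: "continuous_on (rect_frontier R v) f"
  shows "contour_integral (rectpath (Complex (- R) (- v)) (Complex R v)) f = rect_integral R v f"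
proof -
  have "f contour_integrable_on linepath p q" if "closed_segment p q \<subseteq> rect_frontier R v" for p q
    using f that by (intro contour_integrable_continuous_linepath) (rule continuous_on_subset)
  note i = this[OF rect_sides_subset(1)[OF assms(1,2)]] this[OF rect_sides_subset(2)[OF assms(1,2)]]
    this[OF rect_sides_subset(3)[OF assms(1,2)]] this[OF rect_sides_subset(4)[OF assms(1,2)]]
  show ?thesis
    unfolding rectpath_def Let_def rect_integral_def using i by simp
qed

text \<open>A majorant given as a derivative m' yields a bound that stays finite for long segments,
  where supremum times length would grow with the width of the rectangle.\<close>

lemma norm_contour_integral_horizontal_le:
  fixes m :: "real \<Rightarrow> real"
  assumes "p < q" and f: "continuous_on (closed_segment (Complex p v) (Complex q v)) f"
    and m: "\<And>u. (m has_real_derivative m' u) (at u)"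
    and le: "\<And>u. u \<in> {p..q} \<Longrightarrow> cmod (f (Complex u v)) \<le> m' u"
  shows "cmod (contour_integral (linepath (Complex p v) (Complex q v)) f) \<le> m q - m p"
proof -
  let ?\<gamma> = "linepath (Complex p v) (Complex q v)"
  have \<gamma>: "?\<gamma> t = Complex (p + (q - p) * t) v" for t
    by (simp add: linepath_def complex_eq_iff algebra_simps)
  have "f contour_integrable_on ?\<gamma>" using f by (rule contour_integrable_continuous_linepath)
  then have "(f has_contour_integral contour_integral ?\<gamma> f) ?\<gamma>" by (rule has_contour_integral_integral)
  then have 1: "((\<lambda>t. f (?\<gamma> t) * (Complex q v - Complex p v)) has_integral contour_integral ?\<gamma> f) {0..1}"
    by (simp add: has_contour_integral_linepath)
  have 2: "((\<lambda>t. m' (p + (q - p) * t) * (q - p)) has_integral m (p + (q - p) * 1) - m (p + (q - p) * 0)) {0..1}"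
  proof (rule fundamental_theorem_of_calculus)
    fix t :: real
    have "((\<lambda>t. p + (q - p) * t) has_real_derivative q - p) (at t)"
      by (auto intro!: derivative_eq_intros)
    from DERIV_chain2[OF m this]
    show "((\<lambda>t. m (p + (q - p) * t)) has_vector_derivative m' (p + (q - p) * t) * (q - p)) (at t within {0..1})"
      by (simp add: has_real_derivative_iff_has_vector_derivative has_vector_derivative_at_within)
  qed simp
  have "cmod (f (?\<gamma> t) * (Complex q v - Complex p v)) \<le> m' (p + (q - p) * t) * (q - p)"
    if t: "t \<in> {0..1}" for t
  proof -
    have "Complex q v - Complex p v = of_real (q - p)" by (simp add: complex_eq_iff)
    moreover have "p + (q - p) * t \<in> {p..q}"
      using t \<open>p < q\<close> mult_left_le[of t "q - p"] unfolding atLeastAtMost_iff by (intro conjI; (simp; fail | linarith))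
    ultimately show ?thesis
      using le[of "p + (q - p) * t"] \<open>p < q\<close>
      by (simp add: \<gamma> norm_mult mult_right_mono del: of_real_diff)
  qed
  from has_integral_norm_bound_integral_component[OF 1 2, of 1] this
  show ?thesis by simp
qed

lemma linepath_Cauchy_kernel_has_field_derivative:
  assumes G: "continuous_on (closed_segment p q) G" and w: "w \<notin> closed_segment p q"
  shows "((\<lambda>w. contour_integral (linepath p q) (\<lambda>u. G u / (u - w))) has_field_derivative
           contour_integral (linepath p q) (\<lambda>u. G u / (u - w)\<^sup>2)) (at w)"
proof -
  have "((\<lambda>w. contour_integral (linepath p q) (\<lambda>u. G u / (u - w))) has_field_derivative
      of_nat 1 * contour_integral (linepath p q) (\<lambda>u. G u / (u - w) ^ Suc 1)) (at w)"
  proof (rule Cauchy_next_derivative(2)[where S = UNIV and B = "cmod (q - p)"])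
    fix z assume z: "z \<in> UNIV - path_image (linepath p q)"
    then have "continuous_on (closed_segment p q) (\<lambda>u. G u / (u - z))"
      using G by (auto intro!: continuous_intros)
    then show "((\<lambda>u. G u / (u - z) ^ 1) has_contour_integral
        contour_integral (linepath p q) (\<lambda>u. G u / (u - z))) (linepath p q)"
      by (simp add: contour_integrable_continuous_linepath has_contour_integral_integral)
  qed (use assms in auto)
  then show ?thesis by (simp add: numeral_2_eq_2)
qed

lemma sin_node_zero:
  assumes "0 < h" and "sin (of_real (pi / h) * w) = (0 :: complex)"
  obtains j :: int where "w = of_real (of_int j * h)"
proof -
  obtain j :: int where "of_real (pi / h) * w = of_real (of_int j * pi)"
    using assms(2) unfolding sin_eq_0 by blast
  then have "w = of_real (of_int j * h)"
    using assms(1) by (simp add: field_simps)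
  then show thesis using that by blast
qed

text \<open>The half integer in R decides: a zero on a vertical side would be a node with 2 |j| = 2
  M + 1. The horizontal sides avoid the real axis, where all zeros lie.\<close>

lemma frontier_sin_nonzero:
  assumes "0 < h" "0 < v" and R: "R = (real M + 1 / 2) * h" and w: "w \<in> rect_frontier R v"
  shows "sin (of_real (pi / h) * w) \<noteq> 0"
proof
  assume "sin (of_real (pi / h) * w) = 0"
  then obtain j :: int where j: "w = of_real (of_int j * h)"
    using sin_node_zero \<open>0 < h\<close> by blast
  then have "\<bar>real_of_int j\<bar> * h = (real M + 1 / 2) * h"
    using w \<open>0 < v\<close> \<open>0 < h\<close> by (auto simp: rect_frontier_def R abs_mult)
  then have "2 * \<bar>real_of_int j\<bar> = 2 * real M + 1" using \<open>0 < h\<close> by simp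
  then have "2 * \<bar>j\<bar> = 2 * int M + 1" by linarith
  then show False by presburger
qed

text \<open>Residue theorem. The integrand has a pole at s with residue F(s) / sin(pi s / h), and at
  each node with a residue that becomes - F(j h) sinc(pi (s / h - j)) after multiplication by sin(pi
  s / h).\<close>

lemma sinc_interpolation_error:
  fixes F :: "complex \<Rightarrow> complex"
  assumes F: "F holomorphic_on strip d" and v: "0 < v" "v < d" and "0 < h"
    and R: "R = (real M + 1 / 2) * h" and s: "\<bar>s\<bar> < R"
  shows "F (of_real s) - (\<Sum>j = - int M..int M. F (of_real (of_int j * h)) * of_real (sinc (pi * (s / h - of_int j))))
    = of_real (sin (pi * s / h)) / (2 * of_real pi * \<i>)
        * rect_integral R v (\<lambda>w. F w / sin (of_real (pi / h) * w) / (w - of_real s))"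
proof (cases "\<exists>j0 :: int. s = of_int j0 * h")
  \<comment> \<open>At a node the poles would collide, but the claim is trivial there: the sinc
    functions interpolate exactly and the prefactor sin(pi s / h) is 0.\<close>
  case True
  then obtain j0 :: int where j0: "s = of_int j0 * h" by blast
  have sh: "s / h = of_int j0" using j0 \<open>0 < h\<close> by simp
  have "\<bar>real_of_int j0\<bar> * h < (real M + 1 / 2) * h"
    using s \<open>0 < h\<close> by (simp add: j0 R abs_mult)
  then have "\<bar>real_of_int j0\<bar> < real M + 1 / 2" using \<open>0 < h\<close> by simp
  then have j0_in: "j0 \<in> {- int M..int M}" by auto
  have spi: "sin (pi * real_of_int m) = 0" for m
    by (simp add: sin_zero_iff_int2 mult.commute)
  have sinc: "sinc (pi * (s / h - of_int j)) = of_bool (j = j0)" for j :: int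
    using spi[of "j0 - j"] unfolding sh by auto
  have "(\<Sum>j = - int M..int M. F (of_real (of_int j * h)) * of_real (sinc (pi * (s / h - of_int j))))
      = (\<Sum>j = - int M..int M. if j = j0 then F (of_real s) else 0)"
    unfolding sinc by (intro sum.cong refl) (auto simp: j0)
  also have "\<dots> = F (of_real s)" using j0_in by simp
  moreover have "sin (pi * s / h) = 0"
    using spi[of j0] sh by (simp flip: times_divide_eq_right)
  ultimately show ?thesis by simp
next
  case False
  define \<kappa> :: complex where "\<kappa> = of_real (pi / h)"
  \<comment> \<open>An open neighbourhood of the closed rectangle that contains no further node: the
    strict inequality excludes those with |j| = M + 1.\<close>
  define S where "S = {w. \<bar>Re w\<bar> < (real M + 1) * h} \<inter> strip d"
  define node where "node j = complex_of_real (of_int j * h)" for j :: int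
  define J where "J = {- int M..int M}"
  define pts where "pts = insert (of_real s) (node ` J)"
  let ?f = "\<lambda>w. F w / sin (\<kappa> * w) / (w - of_real s)"
  have "S = {w. Re w < (real M + 1) * h} \<inter> {w. Re w > - ((real M + 1) * h)} \<inter> strip d"
    by (auto simp: S_def)
  then have S: "open S" "convex S"
    by (auto intro!: open_Int convex_Int open_strip convex_strip open_halfspace_Re_lt
        open_halfspace_Re_gt convex_halfspace_Re_lt convex_halfspace_Re_gt)
  have zero: "w \<in> node ` J" if w: "w \<in> S" "sin (\<kappa> * w) = 0" for w
  proof -
    obtain j :: int where j: "w = node j"
      using sin_node_zero[OF \<open>0 < h\<close>] w(2) unfolding \<kappa>_def node_def by blast
    have "\<bar>real_of_int j\<bar> * h < (real M + 1) * h"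
      using w(1) \<open>0 < h\<close> by (simp add: S_def j node_def abs_mult)
    then have "\<bar>real_of_int j\<bar> < real M + 1" using \<open>0 < h\<close> by simp
    then have "\<bar>j\<bar> < int M + 1" by linarith
    then have "j \<in> J" by (auto simp: J_def)
    then show ?thesis using j by blast
  qed
  have R0: "0 < R" using \<open>0 < h\<close> by (simp add: R)
  have "R < (real M + 1) * h" using \<open>0 < h\<close> by (simp add: R)
  then have front_S: "rect_frontier R v \<subseteq> S"
    using v R0 by (auto simp: rect_frontier_def S_def strip_def)
  have front_pts: "w \<notin> pts" if "w \<in> rect_frontier R v" for w
  proof -
    have "sin (\<kappa> * node j) = 0" for j :: int
    proof -
      have "\<kappa> * node j = of_real (of_int j * pi)"
        using \<open>0 < h\<close> by (simp add: \<kappa>_def node_def)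
      then show ?thesis unfolding sin_eq_0 by blast
    qed
    then have "w \<notin> node ` J"
      using frontier_sin_nonzero[OF \<open>0 < h\<close> v(1) R that] by (auto simp: \<kappa>_def)
    moreover have "w \<noteq> of_real s" using that s v by (auto simp: rect_frontier_def)
    ultimately show ?thesis by (simp add: pts_def)
  qed
  have pts_box: "p \<in> box (Complex (- R) (- v)) (Complex R v)" if "p \<in> pts" for p
  proof -
    have "\<bar>real_of_int j * h\<bar> < R" if "j \<in> J" for j
    proof -
      have "\<bar>real_of_int j\<bar> < real M + 1 / 2" using that by (auto simp: J_def)
      then show ?thesis using \<open>0 < h\<close> by (simp add: R abs_mult)
    qed
    then show ?thesis
      using that s v by (force simp: pts_def node_def in_box_complex_iff abs_less_iff)
  qed
  have box_S: "box (Complex (- R) (- v)) (Complex R v) \<subseteq> S"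
    using v \<open>R < (real M + 1) * h\<close> by (auto simp: S_def strip_def in_box_complex_iff)
  have cbox_S: "cbox (Complex (- R) (- v)) (Complex R v) \<subseteq> S"
    using v \<open>R < (real M + 1) * h\<close> by (auto simp: S_def strip_def in_cbox_complex_iff)
  have F_S: "F holomorphic_on S" using F by (rule holomorphic_on_subset) (simp add: S_def)
  have "contour_integral (rectpath (Complex (- R) (- v)) (Complex R v)) ?f
      = 2 * pi * \<i> * (\<Sum>p\<in>pts. winding_number (rectpath (Complex (- R) (- v)) (Complex R v)) p * residue ?f p)"
  proof (rule Residue_theorem[OF S(1)])
    show "connected S" using S(2) by (rule convex_connected)
    show "finite pts" by (simp add: pts_def J_def)
    show "?f holomorphic_on S - pts"
      using zero by (intro holomorphic_intros holomorphic_on_subset[OF F_S]) (auto simp: pts_def)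
    show "path_image (rectpath (Complex (- R) (- v)) (Complex R v)) \<subseteq> S - pts"
      using path_image_rectpath_eq_rect_frontier[OF R0 v(1)] front_S front_pts by auto
    show "\<forall>z. z \<notin> S \<longrightarrow> winding_number (rectpath (Complex (- R) (- v)) (Complex R v)) z = 0"
      using cbox_S R0 v by (auto intro!: winding_number_rectpath_outside)
  qed auto
  also have "(\<Sum>p\<in>pts. winding_number (rectpath (Complex (- R) (- v)) (Complex R v)) p * residue ?f p)
      = (\<Sum>p\<in>pts. residue ?f p)"
    by (intro sum.cong refl) (simp add: winding_number_rectpath[OF pts_box])
  also have "\<dots> = residue ?f (of_real s) + (\<Sum>j\<in>J. residue ?f (node j))"
  proof -
    have "complex_of_real s \<notin> node ` J" using False by (auto simp: node_def simp del: of_real_mult)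
    moreover have "inj_on node J" using \<open>0 < h\<close> by (auto simp: inj_on_def node_def)
    ultimately show ?thesis
      by (simp add: pts_def sum.reindex J_def)
  qed
  also have "residue ?f (of_real s) = F (of_real s) / sin (\<kappa> * of_real s)"
  proof (rule residue_simple)
    show "open (S - node ` J)" using S(1) by (auto intro!: open_Diff finite_imp_closed simp: J_def)
    show "complex_of_real s \<in> S - node ` J"
      using False pts_box[of "of_real s"] box_S
      by (auto simp: node_def pts_def simp del: of_real_mult)
    show "(\<lambda>w. F w / sin (\<kappa> * w)) holomorphic_on S - node ` J"
      using zero by (intro holomorphic_intros holomorphic_on_subset[OF F_S]) auto
  qed
  also have "(\<Sum>j\<in>J. residue ?f (node j))
      = (\<Sum>j\<in>J. F (node j) / (node j - of_real s) / (\<kappa> * of_real (cos (pi * of_int j))))"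
  proof (rule sum.cong[OF refl])
    fix j assume j: "j \<in> J"
    let ?V = "S - (pts - {node j})"
    have arg: "\<kappa> * node j = of_real (pi * of_int j)"
      using \<open>0 < h\<close> by (simp add: \<kappa>_def node_def)
    have ne: "node j \<noteq> of_real s" using False by (auto simp: node_def simp del: of_real_mult)
    have "residue (\<lambda>w. F w / (w - of_real s) / sin (\<kappa> * w)) (node j)
        = F (node j) / (node j - of_real s) / (\<kappa> * of_real (cos (pi * of_int j)))"
    proof (rule residue_quotient_simple_zero)
      show "open ?V" using S(1) by (auto intro!: open_Diff finite_imp_closed simp: pts_def J_def)
      show "node j \<in> ?V" using pts_box[of "node j"] box_S j by (auto simp: pts_def)
      show "(\<lambda>w. F w / (w - of_real s)) holomorphic_on ?V"
        using ne by (intro holomorphic_intros holomorphic_on_subset[OF F_S]) (auto simp: pts_def)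
      show "(\<lambda>w. sin (\<kappa> * w)) holomorphic_on ?V" by (intro holomorphic_intros)
      have "((\<lambda>w. sin (\<kappa> * w)) has_field_derivative cos (\<kappa> * node j) * \<kappa>) (at (node j))"
        by (auto intro!: derivative_eq_intros)
      then show "((\<lambda>w. sin (\<kappa> * w)) has_field_derivative \<kappa> * of_real (cos (pi * of_int j))) (at (node j))"
        unfolding arg cos_of_real by (simp add: mult.commute)
      show "sin (\<kappa> * node j) = 0"
        unfolding arg sin_of_real by (simp add: sin_zero_iff_int2 mult.commute)
      have "cos (pi * of_int j) \<noteq> 0"
        using sin_cos_squared_add[of "pi * of_int j"] by (auto simp: mult.commute)
      then show "\<kappa> * of_real (cos (pi * of_int j)) \<noteq> 0" using \<open>0 < h\<close> by (simp add: \<kappa>_def)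
      show "sin (\<kappa> * w) \<noteq> 0" if "w \<in> ?V - {node j}" for w
        using zero[of w] that by (auto simp: pts_def)
    qed
    moreover have "?f = (\<lambda>w. F w / (w - of_real s) / sin (\<kappa> * w))"
      by (simp add: mult.commute)
    ultimately show "residue ?f (node j)
        = F (node j) / (node j - of_real s) / (\<kappa> * of_real (cos (pi * of_int j)))" by simp
  qed
  finally have ci: "contour_integral (rectpath (Complex (- R) (- v)) (Complex R v)) ?f
      = 2 * pi * \<i> * (F (of_real s) / sin (\<kappa> * of_real s)
        + (\<Sum>j\<in>J. F (node j) / (node j - of_real s) / (\<kappa> * of_real (cos (pi * of_int j)))))" .
  have "continuous_on (rect_frontier R v) ?f"
    using frontier_sin_nonzero[OF \<open>0 < h\<close> v(1) R] front_pts front_S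
    by (intro continuous_intros holomorphic_on_imp_continuous_on[THEN continuous_on_subset, OF F_S])
       (auto simp: \<kappa>_def pts_def)
  note contour_integral_rectpath[OF R0 v(1) this]
  note ri = ci[unfolded this]
  have sin_s: "sin (\<kappa> * of_real s) = of_real (sin (pi * s / h))"
    by (simp add: \<kappa>_def flip: sin_of_real)
  have sin_ne: "sin (pi * s / h) \<noteq> 0"
  proof
    assume "sin (pi * s / h) = 0"
    then obtain i :: int where "pi * s / h = of_int i * pi" unfolding sin_zero_iff_int2 by blast
    then have "s = of_int i * h" using \<open>0 < h\<close> by (simp add: field_simps)
    then show False using False by blast
  qed
  have term_eq: "of_real (sin (pi * s / h)) * (F (node j) / (node j - of_real s) / (\<kappa> * of_real (cos (pi * of_int j))))
      = - (F (node j) * of_real (sinc (pi * (s / h - of_int j))))" for j :: int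
  proof -
    \<comment> \<open>This is a sign, hence its own inverse; that lets cos(pi j) change sides
      between the residue and the addition formula for the sine.\<close>
    define c where "c = cos (pi * of_int j)"
    have sj: "sin (pi * of_int j) = 0" by (simp add: sin_zero_iff_int2 mult.commute)
    then have cc: "c * c = 1" using sin_cos_squared_add[of "pi * of_int j"] by (simp add: c_def power2_eq_square)
    then have c0: "c \<noteq> 0" by auto
    have ne: "s - of_int j * h \<noteq> 0" using False by auto
    have "sin (pi * (s / h - of_int j)) = sin (pi * s / h) * c"
      using sin_diff[of "pi * s / h" "pi * of_int j"] sj by (simp add: right_diff_distrib c_def)
    moreover have "pi * (s / h - of_int j) = pi / h * (s - of_int j * h)"
      using \<open>0 < h\<close> by (simp add: field_simps)
    ultimately have "sinc (pi * (s / h - of_int j)) = sin (pi * s / h) * c / (pi / h * (s - of_int j * h))"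
      using ne \<open>0 < h\<close> by simp
    also have "\<dots> = - (sin (pi * s / h) / (of_int j * h - s) / (pi / h * c))"
    proof -
      have c_inv: "x / c = x * c" for x
        using cc c0 by (simp add: divide_eq_eq mult.assoc)
      have "sin (pi * s / h) / (of_int j * h - s) / (pi / h * c)
          = sin (pi * s / h) / (- (s - of_int j * h)) / (pi / h) / c" by simp
      then show ?thesis unfolding c_inv minus_divide_right[symmetric] by (simp add: mult_ac)
    qed
    finally have "of_real (sinc (pi * (s / h - of_int j)))
        = - (complex_of_real (sin (pi * s / h)) / (node j - of_real s) / (\<kappa> * of_real c))"
      by (simp add: node_def \<kappa>_def)
    then show ?thesis unfolding c_def by simp
  qed
  have cancel: "of_real x / (2 * of_real pi * \<i>) * (2 * pi * \<i> * X) = of_real x * X"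
    for x :: real and X :: complex
    by (simp add: field_simps)
  have "of_real (sin (pi * s / h)) / (2 * of_real pi * \<i>) * rect_integral R v ?f
      = of_real (sin (pi * s / h)) * (F (of_real s) / sin (\<kappa> * of_real s)
        + (\<Sum>j\<in>J. F (node j) / (node j - of_real s) / (\<kappa> * of_real (cos (pi * of_int j)))))"
    unfolding ri by (rule cancel)
  also have "\<dots> = F (of_real s) - (\<Sum>j\<in>J. F (node j) * of_real (sinc (pi * (s / h - of_int j))))"
    using sin_ne unfolding distrib_left sin_s sum_distrib_left term_eq by (simp add: sum_negf)
  finally show ?thesis by (simp only: J_def node_def \<kappa>_def)
qed

section \<open>Sinc indefinite quadrature\<close>

text \<open>The horizontal sides grow with R and need the primitive of a majorant; the vertical
  sides have the fixed length 2 v, so a supremum is enough.\<close>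

lemma norm_rect_integral_le:
  fixes m :: "real \<Rightarrow> real"
  assumes R: "0 < R" and v: "0 < v" and f: "continuous_on (rect_frontier R v) f"
    and m: "\<And>u. (m has_real_derivative m' u) (at u)"
    and hor: "\<And>u t. \<bar>u\<bar> \<le> R \<Longrightarrow> \<bar>t\<bar> = v \<Longrightarrow> cmod (f (Complex u t)) \<le> m' u"
    and ver: "\<And>w. \<bar>Re w\<bar> = R \<Longrightarrow> \<bar>Im w\<bar> \<le> v \<Longrightarrow> cmod (f w) \<le> V" and "0 \<le> V"
  shows "cmod (rect_integral R v f) \<le> 2 * (m R - m (- R)) + 4 * v * V"
proof -
  note sub = rect_sides_subset[OF R v]
  have hor': "cmod (contour_integral (linepath (Complex (- R) t) (Complex R t)) f) \<le> m R - m (- R)"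
    if t: "\<bar>t\<bar> = v" for t
  proof (rule norm_contour_integral_horizontal_le[OF _ _ m])
    have "closed_segment (Complex (- R) t) (Complex R t) \<subseteq> rect_frontier R v"
      using t R by (auto simp: rect_frontier_def closed_segment_same_Im closed_segment_eq_real_ivl)
    then show "continuous_on (closed_segment (Complex (- R) t) (Complex R t)) f"
      using f by (rule continuous_on_subset[rotated])
  qed (use R hor t in auto)
  have ver': "cmod (contour_integral (linepath (Complex c p) (Complex c q)) f) \<le> V * (2 * v)"
    if c: "\<bar>c\<bar> = R" "\<bar>p\<bar> = v" "\<bar>q\<bar> = v" for c p q
  proof -
    have seg: "closed_segment (Complex c p) (Complex c q) \<subseteq> {w. \<bar>Re w\<bar> = R \<and> \<bar>Im w\<bar> \<le> v}"
      using c by (auto simp: closed_segment_same_Re closed_segment_eq_real_ivl split: if_splits)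
    then have "continuous_on (closed_segment (Complex c p) (Complex c q)) f"
      by (intro continuous_on_subset[OF f]) (auto simp: rect_frontier_def)
    then have "(f has_contour_integral contour_integral (linepath (Complex c p) (Complex c q)) f)
        (linepath (Complex c p) (Complex c q))"
      by (intro has_contour_integral_integral contour_integrable_continuous_linepath)
    then have "cmod (contour_integral (linepath (Complex c p) (Complex c q)) f)
        \<le> V * cmod (Complex c q - Complex c p)"
      by (rule has_contour_integral_bound_linepath) (use \<open>0 \<le> V\<close> seg ver in auto)
    also have "\<dots> \<le> V * (2 * v)"
    proof (rule mult_left_mono[OF _ \<open>0 \<le> V\<close>])
      have "Complex c q - Complex c p = \<i> * of_real (q - p)" by (simp add: complex_eq_iff)
      then have "cmod (Complex c q - Complex c p) = \<bar>q - p\<bar>" by (simp add: norm_mult del: of_real_diff)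
      then show "cmod (Complex c q - Complex c p) \<le> 2 * v" using c by linarith
    qed
    finally show ?thesis .
  qed
  have rev: "contour_integral (linepath (Complex R v) (Complex (- R) v)) f
      = - contour_integral (linepath (Complex (- R) v) (Complex R v)) f"
    by (intro contour_integral_reverse_linepath continuous_on_subset[OF f sub(3)])
  have "cmod (rect_integral R v f) \<le> (m R - m (- R)) + V * (2 * v) + (m R - m (- R)) + V * (2 * v)"
    unfolding rect_integral_def rev
    by (intro norm_triangle_mono) (use hor'[of v] hor'[of "- v"] ver' R v in auto)
  then show ?thesis by (simp add: algebra_simps)
qed

lemma rect_integral_Cauchy_kernel_has_field_derivative:
  assumes "0 < R" "0 < v" and G: "continuous_on (rect_frontier R v) G" and w: "w \<notin> rect_frontier R v"
  shows "((\<lambda>w. rect_integral R v (\<lambda>u. G u / (u - w))) has_field_derivative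
           rect_integral R v (\<lambda>u. G u / (u - w)\<^sup>2)) (at w)"
  unfolding rect_integral_def
  by (intro DERIV_add linepath_Cauchy_kernel_has_field_derivative continuous_on_subset[OF G]
      rect_sides_subset[OF assms(1,2)]) (use rect_sides_subset[OF assms(1,2)] w in blast)+

text \<open>Since s = u - (u - s), 1 + s^2 is at most twice the sum of 1 + u^2 and 1 + (u - s)^2;
  dividing by their product extracts the decay in s and leaves two functions of u with arctan
  primitives. The factor 1 + 1 / v^2 pays for replacing v^2 by 1.\<close>

lemma kernel_product_le:
  fixes u s v :: real
  assumes "0 < v"
  shows "1 / ((1 + u\<^sup>2) * ((u - s)\<^sup>2 + v\<^sup>2))
    \<le> 2 * (1 + 1 / v\<^sup>2) / (1 + s\<^sup>2) * (1 / (1 + u\<^sup>2) + 1 / (1 + (u - s)\<^sup>2))"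
proof -
  define A B where "A = 1 + u\<^sup>2" and "B = 1 + (u - s)\<^sup>2"
  have pos: "0 < A" "0 < B" "0 < 1 + s\<^sup>2" by (simp_all add: A_def B_def add_pos_nonneg)
  have "1 + s\<^sup>2 \<le> 2 * (A + B)"
  proof -
    have "0 \<le> (u + (u - s))\<^sup>2" by simp
    then show ?thesis by (simp add: A_def B_def power2_eq_square algebra_simps)
  qed
  then have "1 * (1 / (A * B)) \<le> (2 * (A + B) / (1 + s\<^sup>2)) * (1 / (A * B))"
    using pos by (intro mult_right_mono) (auto simp: pos_le_divide_eq)
  moreover have "1 / A + 1 / B = (A + B) / (A * B)"
    using pos by (simp add: field_simps)
  ultimately have 1: "1 / (A * B) \<le> 2 / (1 + s\<^sup>2) * (1 / A + 1 / B)" by simp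
  have "B \<le> (1 + 1 / v\<^sup>2) * ((u - s)\<^sup>2 + v\<^sup>2)"
    using assms by (simp add: B_def field_simps)
  moreover have "1 / X \<le> C / B" if "B \<le> C * X" "0 < X" for X C
    using that pos by (simp add: field_simps)
  ultimately have "1 / ((u - s)\<^sup>2 + v\<^sup>2) \<le> (1 + 1 / v\<^sup>2) / B"
    using assms by (simp add: add_nonneg_pos)
  then have "1 / A * (1 / ((u - s)\<^sup>2 + v\<^sup>2)) \<le> 1 / A * ((1 + 1 / v\<^sup>2) / B)"
    using pos by (intro mult_left_mono) auto
  also have "\<dots> = (1 + 1 / v\<^sup>2) * (1 / (A * B))" by simp
  also have "\<dots> \<le> (1 + 1 / v\<^sup>2) * (2 / (1 + s\<^sup>2) * (1 / A + 1 / B))"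
    using assms by (intro mult_left_mono[OF 1]) simp
  finally have fin: "1 / A * (1 / ((u - s)\<^sup>2 + v\<^sup>2))
      \<le> (1 + 1 / v\<^sup>2) * (2 / (1 + s\<^sup>2) * (1 / A + 1 / B))" .
  have "p * (2 / q * z) = 2 * p / q * z" for p q z :: real by simp
  then show ?thesis
    using fin by (simp only: A_def B_def times_divide_times_eq mult_1)
qed

text \<open>The derivative of \<open>D\<close> is sin(pi s / h) I(s) with \<open>I\<close> only
  bounded, so direct integration would grow with x - x0. Adding (h / pi) cos(pi s / h) I(s) moves
  the derivative onto \<open>I\<close>, and I' is dominated by a multiple of 1 / (1 + s^2). Only the
  contribution of the vertical sides still grows with x - x0, and it carries the factor 1 / (1 +
  R^2).\<close>

lemma sinc_quadrature_increment:
  fixes F Y :: "complex \<Rightarrow> complex"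
  assumes F: "F holomorphic_on strip d" and K: "0 \<le> K"
    and bound: "\<And>\<zeta>. \<zeta> \<in> strip d \<Longrightarrow> cmod (F \<zeta>) \<le> K / (1 + (Re \<zeta>)\<^sup>2)"
    and Y: "\<And>\<zeta>. \<zeta> \<in> strip d \<Longrightarrow> (Y has_field_derivative F \<zeta>) (at \<zeta>)"
    and v: "0 < v" "v < d" and h: "0 < h" and "x0 \<le> x"
    and R: "R = (real M + 1 / 2) * h" and x: "\<bar>x0\<bar> + 1 \<le> R" "\<bar>x\<bar> + 1 \<le> R"
  defines "D \<equiv> \<lambda>s. Y (of_real s) - (\<Sum>j = - int M..int M. F (of_real (of_int j * h)) * of_real (J_fun j h s))"
  shows "cmod (D x - D x0) \<le> h / pi * (K / sinh (pi * v / h) * (2 / v + 4 * pi * (1 + 1 / v\<^sup>2))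
           + 2 * v * K / (pi * (1 + R\<^sup>2)) * (2 + (x - x0)))"
proof -
  define S where "S = sinh (pi * v / h)"
  define c where "c = 1 + 1 / v\<^sup>2"
  \<comment> \<open>Both vertical sides together, each of length 2 v, after division by 2
    pi.\<close>
  define e where "e = 2 * v * K / (pi * (1 + R\<^sup>2))"
  have e_eq: "2 * pi * e = 4 * v * (K / (1 + R\<^sup>2))"
    by (simp add: e_def)
  define G where "G w = F w / sin (of_real (pi / h) * w)" for w
  define I where "I s = rect_integral R v (\<lambda>u. G u / (u - of_real s)) / (2 * of_real pi * \<i>)" for s :: real
  define I' where "I' s = rect_integral R v (\<lambda>u. G u / (u - of_real s)\<^sup>2) / (2 * of_real pi * \<i>)" for s :: real
  have S0: "0 < S" using v h by (simp add: S_def)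
  have c0: "0 \<le> c" by (simp add: c_def)
  have R0: "0 < R" using x by linarith
  have front: "rect_frontier R v \<subseteq> strip d" using v by (auto simp: rect_frontier_def strip_def)
  have G_cont: "continuous_on (rect_frontier R v) G"
    unfolding G_def using frontier_sin_nonzero[OF h v(1) R]
    by (intro continuous_intros continuous_on_subset[OF holomorphic_on_imp_continuous_on[OF F] front]) auto
  have G_hor: "cmod (G (Complex u t)) \<le> K / (1 + u\<^sup>2) / S" if "\<bar>t\<bar> = v" for u t
  proof -
    have "S \<le> cmod (sin (of_real (pi / h) * Complex u t))"
      using sinh_abs_Im_le_norm_sin[of "of_real (pi / h) * Complex u t"] that h
      by (simp add: S_def abs_mult)
    then show ?thesis
      unfolding G_def norm_divide using S0 bound[of "Complex u t"] that v
      by (intro frac_le) (use K in \<open>auto simp: strip_def\<close>)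
  qed
  have G_ver: "cmod (G w) \<le> K / (1 + R\<^sup>2)" if w: "\<bar>Re w\<bar> = R" "\<bar>Im w\<bar> \<le> v" for w
  proof -
    have "cos (2 * Re (of_real (pi / h) * w)) = cos (2 * (pi / h) * R)"
      using w(1) by (cases "0 \<le> Re w") (auto simp: mult.assoc simp flip: minus_mult_right)
    also have "2 * (pi / h) * R = pi + real M * (2 * pi)"
      using h by (simp add: R field_simps)
    also have "cos \<dots> = - 1"
      using cos_2npi[of M] by (simp add: cos_add mult_ac)
    finally have "1 \<le> cmod (sin (of_real (pi / h) * w))" by (rule one_le_norm_sin)
    moreover have "cmod (F w) \<le> K / (1 + R\<^sup>2)"
      using bound[of w] w v by (auto simp: strip_def simp flip: power2_abs[of "Re w"])
    ultimately have "cmod (F w) / cmod (sin (of_real (pi / h) * w)) \<le> K / (1 + R\<^sup>2) / 1"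
      using K by (intro frac_le) auto
    then show ?thesis unfolding G_def norm_divide by simp
  qed
  have off: "of_real s \<notin> rect_frontier R v" if "\<bar>s\<bar> < R" for s
    using that v by (auto simp: rect_frontier_def)
  \<comment> \<open>The margin 1 between the points and the vertical sides makes every power of the
    Cauchy kernel at most 1 there, so one bound serves both \<open>I\<close> and its
    derivative.\<close>
  have far: "1 \<le> cmod (w - of_real s)" if "\<bar>Re w\<bar> = R" "\<bar>s\<bar> + 1 \<le> R" for w s
    using that abs_Re_le_cmod[of "w - of_real s"] by (simp add: abs_le_iff) linarith
  have kcont: "continuous_on (rect_frontier R v) (\<lambda>u. G u / (u - of_real s) ^ n)" if "\<bar>s\<bar> < R" for s n
    using off[OF that] by (intro continuous_intros G_cont) auto
  have ver: "cmod (G w / (w - of_real s) ^ n) \<le> K / (1 + R\<^sup>2)"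
    if "\<bar>s\<bar> + 1 \<le> R" "\<bar>Re w\<bar> = R" "\<bar>Im w\<bar> \<le> v" for s w n
  proof -
    have "cmod (G w) / cmod (w - of_real s) ^ n \<le> K / (1 + R\<^sup>2) / 1"
      using that G_ver far K one_le_power by (intro frac_le) auto
    then show ?thesis by (simp add: norm_divide norm_power)
  qed
  have V0: "0 \<le> K / (1 + R\<^sup>2)" using K by simp
  have norm_2pi: "cmod (2 * of_real pi * \<i>) = 2 * pi" by (simp add: norm_mult)
  have atan: "arctan p - arctan q \<le> pi" for p q
    using arctan_ubound[of p] arctan_lbound[of q] by linarith
  have I_le: "cmod (I s) \<le> K / (v * S) + e" if s: "\<bar>s\<bar> + 1 \<le> R" for s
  proof -
    have "cmod (rect_integral R v (\<lambda>u. G u / (u - of_real s) ^ 1))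
        \<le> 2 * (K / (v * S) * arctan R - K / (v * S) * arctan (- R)) + 4 * v * (K / (1 + R\<^sup>2))"
    proof (rule norm_rect_integral_le[OF R0 v(1) kcont has_real_derivative_arctan_scaled _ ver V0])
      fix u t assume "\<bar>t\<bar> = v"
      then have "v \<le> cmod (Complex u t - of_real s)"
        using abs_Im_le_cmod[of "Complex u t - of_real s"] by simp
      then have "cmod (G (Complex u t)) / cmod (Complex u t - of_real s) \<le> K / (1 + u\<^sup>2) / S / v"
        using G_hor[OF \<open>\<bar>t\<bar> = v\<close>, of u] v K S0 by (intro frac_le) auto
      then show "cmod (G (Complex u t) / (Complex u t - of_real s) ^ 1) \<le> K / (v * S) / (1 + u\<^sup>2)"
        by (simp add: norm_divide mult_ac)
    qed (use s in auto)
    also have "\<dots> = 2 * (K / (v * S)) * (arctan R - arctan (- R)) + 4 * v * (K / (1 + R\<^sup>2))"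
      by (simp only: right_diff_distrib mult.assoc)
    also have "\<dots> \<le> 2 * (K / (v * S)) * pi + 4 * v * (K / (1 + R\<^sup>2))"
      using K v S0 by (intro add_right_mono mult_left_mono atan) auto
    also have "\<dots> = 2 * pi * (K / (v * S) + e)"
      unfolding distrib_left e_eq by simp
    finally show ?thesis unfolding I_def norm_divide norm_2pi by (simp add: divide_le_eq mult.commute)
  qed
  have I'_le: "cmod (I' s) \<le> 4 * K * c / S / (1 + s\<^sup>2) + e" if s: "\<bar>s\<bar> + 1 \<le> R" for s
  proof -
    define q where "q = 2 * K * c / S / (1 + s\<^sup>2)"
    have q0: "0 \<le> q" using K c0 S0 by (simp add: q_def)
    have "cmod (rect_integral R v (\<lambda>u. G u / (u - of_real s) ^ 2))
        \<le> 2 * (q * (arctan R + arctan (R - s)) - q * (arctan (- R) + arctan (- R - s)))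
            + 4 * v * (K / (1 + R\<^sup>2))"
    proof (rule norm_rect_integral_le[OF R0 v(1) kcont _ _ ver V0])
      show "((\<lambda>u. q * (arctan u + arctan (u - s))) has_real_derivative
          q * (1 / (1 + u\<^sup>2) + 1 / (1 + (u - s)\<^sup>2))) (at u)" for u
        by (auto intro!: derivative_eq_intros simp: divide_inverse)
      fix u t assume t: "\<bar>t\<bar> = v"
      have "(cmod (Complex u t - of_real s))\<^sup>2 = (u - s)\<^sup>2 + v\<^sup>2"
        using t by (simp add: cmod_power2 flip: power2_abs[of t])
      then have "cmod (G (Complex u t) / (Complex u t - of_real s) ^ 2) = cmod (G (Complex u t)) / ((u - s)\<^sup>2 + v\<^sup>2)"
        by (simp add: norm_divide norm_power)
      also have "\<dots> \<le> K / (1 + u\<^sup>2) / S / ((u - s)\<^sup>2 + v\<^sup>2)"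
        by (intro divide_right_mono G_hor t) simp
      also have "\<dots> = K / S * (1 / ((1 + u\<^sup>2) * ((u - s)\<^sup>2 + v\<^sup>2)))" by simp
      also have "\<dots> \<le> K / S * (2 * c / (1 + s\<^sup>2) * (1 / (1 + u\<^sup>2) + 1 / (1 + (u - s)\<^sup>2)))"
        unfolding c_def using K S0 by (intro mult_left_mono kernel_product_le v) auto
      finally show "cmod (G (Complex u t) / (Complex u t - of_real s) ^ 2)
          \<le> q * (1 / (1 + u\<^sup>2) + 1 / (1 + (u - s)\<^sup>2))"
        by (simp add: q_def mult_ac)
    qed (use s in auto)
    also have "\<dots> = 2 * q * ((arctan R - arctan (- R)) + (arctan (R - s) - arctan (- R - s)))
        + 4 * v * (K / (1 + R\<^sup>2))"
      by (simp add: algebra_simps)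
    also have "\<dots> \<le> 2 * q * (pi + pi) + 4 * v * (K / (1 + R\<^sup>2))"
      using q0 by (intro add_right_mono mult_left_mono add_mono atan) auto
    also have "\<dots> = 2 * pi * (2 * q + e)"
      unfolding distrib_left e_eq by simp
    finally have "cmod (I' s) \<le> 2 * q + e"
      unfolding I'_def norm_divide norm_2pi by (simp add: divide_le_eq mult.commute)
    then show ?thesis by (simp add: q_def)
  qed
  have I_deriv: "(I has_vector_derivative I' s) (at s)" if "\<bar>s\<bar> < R" for s
  proof -
    have "((\<lambda>w. rect_integral R v (\<lambda>u. G u / (u - w)) / (2 * of_real pi * \<i>)) has_field_derivative I' s) (at (of_real s))"
      unfolding I'_def
      by (intro DERIV_cdivide rect_integral_Cauchy_kernel_has_field_derivative R0 v G_cont off that)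
    then show ?thesis unfolding I_def[abs_def] by (rule has_vector_derivative_real_field)
  qed
  have D_deriv: "(D has_vector_derivative of_real (sin (pi * s / h)) * I s) (at s)" if s: "\<bar>s\<bar> < R" for s
  proof -
    have "((\<lambda>s. Y (of_real s)) has_vector_derivative F (of_real s)) (at s)"
      using v by (intro has_vector_derivative_real_field Y) (simp add: strip_def)
    moreover have "((\<lambda>s. complex_of_real (J_fun j h s)) has_vector_derivative
        of_real (sinc (pi * (s / h - of_int j)))) (at s)" for j
      by (rule has_vector_derivative_of_real[OF J_fun_has_derivative]) (use h in simp)
    ultimately have "(D has_vector_derivative F (of_real s)
        - (\<Sum>j = - int M..int M. F (of_real (of_int j * h)) * of_real (sinc (pi * (s / h - of_int j))))) (at s)"
      unfolding D_def
      by (intro has_vector_derivative_diff has_vector_derivative_sum has_vector_derivative_mult_right)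
    then show ?thesis
      unfolding sinc_interpolation_error[OF F v h R s] by (simp add: I_def G_def)
  qed
  define \<Theta> where "\<Theta> s = D s + of_real (h / pi * cos (pi * s / h)) * I s" for s
  have \<Theta>_deriv: "(\<Theta> has_vector_derivative of_real (h / pi * cos (pi * s / h)) * I' s) (at s)"
    if s: "\<bar>s\<bar> < R" for s
  proof -
    have "((\<lambda>s. h / pi * cos (pi * s / h)) has_real_derivative - sin (pi * s / h)) (at s)"
      using h by (auto intro!: derivative_eq_intros)
    then have "((\<lambda>s. complex_of_real (h / pi * cos (pi * s / h))) has_vector_derivative
        of_real (- sin (pi * s / h))) (at s)"
      by (intro has_vector_derivative_of_real) (simp add: has_real_derivative_iff_has_vector_derivative)
    from has_vector_derivative_add[OF D_deriv[OF s] has_vector_derivative_mult[OF this I_deriv[OF s]]]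
    show ?thesis unfolding \<Theta>_def[abs_def] by simp
  qed
  have cos_le: "cmod (of_real (h / pi * cos (pi * s / h)) * z) \<le> h / pi * cmod z" for s z
  proof -
    have "\<bar>h / pi * cos (pi * s / h)\<bar> \<le> h / pi"
      using h mult_left_mono[OF abs_cos_le_one[of "pi * s / h"], of "h / pi"] by (simp add: abs_mult)
    then show ?thesis unfolding norm_mult norm_of_real by (rule mult_right_mono) simp
  qed
  have "cmod (\<Theta> x - \<Theta> x0) \<le> h / pi * (4 * K * c / S * arctan x + e * x) - h / pi * (4 * K * c / S * arctan x0 + e * x0)"
  proof (rule norm_increment_le[OF \<open>x0 \<le> x\<close> \<Theta>_deriv])
    fix t assume t: "t \<in> {x0..x}"
    then have tR: "\<bar>t\<bar> + 1 \<le> R" using x by auto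
    then show "\<bar>t\<bar> < R" by simp
    show "((\<lambda>t. h / pi * (4 * K * c / S * arctan t + e * t)) has_real_derivative
        h / pi * (4 * K * c / S / (1 + t\<^sup>2) + e)) (at t)"
      by (intro DERIV_cmult DERIV_add has_real_derivative_arctan_scaled) (auto intro!: derivative_eq_intros)
    have "cmod (of_real (h / pi * cos (pi * t / h)) * I' t) \<le> h / pi * cmod (I' t)" by (rule cos_le)
    also have "\<dots> \<le> h / pi * (4 * K * c / S / (1 + t\<^sup>2) + e)"
      using h by (intro mult_left_mono I'_le tR) auto
    finally show "cmod (of_real (h / pi * cos (pi * t / h)) * I' t) \<le> h / pi * (4 * K * c / S / (1 + t\<^sup>2) + e)" .
  qed
  also have "\<dots> = h / pi * (4 * K * c / S * (arctan x - arctan x0) + e * (x - x0))"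
  proof -
    have "p * (q * a + e * x) - p * (q * b + e * x0) = p * (q * (a - b) + e * (x - x0))" for p q a b
      by (simp add: algebra_simps)
    then show ?thesis .
  qed
  also have "\<dots> \<le> h / pi * (4 * K * c / S * pi + e * (x - x0))"
    using h K c0 S0 by (intro mult_left_mono add_right_mono atan) auto
  finally have \<Theta>_le: "cmod (\<Theta> x - \<Theta> x0) \<le> h / pi * (4 * K * c / S * pi + e * (x - x0))" .
  \<comment> \<open>The boundary terms of the integration by parts. Occurring at both ends, they
    produce the summands 2 / v and 2 in the final constant.\<close>
  have bd: "cmod (of_real (h / pi * cos (pi * s / h)) * I s) \<le> h / pi * (K / (v * S) + e)" if "\<bar>s\<bar> + 1 \<le> R" for s
    using order_trans[OF cos_le mult_left_mono[OF I_le[OF that]]] h by simp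
  have "D x - D x0 = (\<Theta> x - \<Theta> x0) - of_real (h / pi * cos (pi * x / h)) * I x
      + of_real (h / pi * cos (pi * x0 / h)) * I x0"
    by (simp add: \<Theta>_def)
  also have "cmod \<dots> \<le> h / pi * (4 * K * c / S * pi + e * (x - x0))
      + h / pi * (K / (v * S) + e) + h / pi * (K / (v * S) + e)"
    by (intro norm_triangle_mono norm_triangle_le_diff add_mono \<Theta>_le bd x)
  also have "\<dots> = h / pi * (K / S * (2 / v + 4 * pi * c) + e * (2 + (x - x0)))"
    using v S0 by (simp add: field_simps)
  finally show ?thesis by (simp only: S_def c_def e_def)
qed

text \<open>Three limits in succession. M tends to infinity with v and x0 fixed and removes the
  vertical sides; v tends to d from the left, as F is holomorphic only on the open strip; x0 tends
  to minus infinity, where every \<open>J_fun\<close> vanishes and \<open>D\<close> tends to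
  L.\<close>

lemma sinc_quadrature_error:
  fixes F Y :: "complex \<Rightarrow> complex"
  assumes F: "F holomorphic_on strip d" and K: "0 \<le> K"
    and bound: "\<And>\<zeta>. \<zeta> \<in> strip d \<Longrightarrow> cmod (F \<zeta>) \<le> K / (1 + (Re \<zeta>)\<^sup>2)"
    and Y: "\<And>\<zeta>. \<zeta> \<in> strip d \<Longrightarrow> (Y has_field_derivative F \<zeta>) (at \<zeta>)"
    and lim: "((\<lambda>x. Y (of_real x)) \<longlongrightarrow> L) at_bot"
    and d: "0 < d" and h: "0 < h"
    and c: "\<And>j x. \<bar>J_fun j h x\<bar> \<le> c * h" "0 \<le> c"
    and tail: "\<And>M. N \<le> M \<Longrightarrow>
      (\<Sum>j\<in>{- int M..int M} - {- int N..int N}. cmod (F (of_real (of_int j * h)))) \<le> T"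
  shows "cmod (Y (of_real x) - L - (\<Sum>j = - int N..int N. F (of_real (of_int j * h)) * of_real (J_fun j h x)))
    \<le> h / pi * (K / sinh (pi * d / h) * (2 / d + 4 * pi * (1 + 1 / d\<^sup>2))) + 2 * c * h * T"
proof -
  define D where "D M s = Y (of_real s) - (\<Sum>j = - int M..int M. F (of_real (of_int j * h)) * of_real (J_fun j h s))"
    for M s
  define B where "B v = h / pi * (K / sinh (pi * v / h) * (2 / v + 4 * pi * (1 + 1 / v\<^sup>2)))" for v :: real
  have inc: "cmod (D N x - D N x0) \<le> B v + 2 * c * h * T"
    if "x0 \<le> x" and v: "0 < v" "v < d" for x0 v
  proof (rule tendsto_lowerbound)
    let ?e = "\<lambda>M::nat. 2 * v * K / (pi * (1 + ((real M + 1 / 2) * h)\<^sup>2)) * (2 + (x - x0))"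
    have "?e \<longlonglongrightarrow> 0" using h by real_asymp
    then have "(\<lambda>M. h / pi * (K / sinh (pi * v / h) * (2 / v + 4 * pi * (1 + 1 / v\<^sup>2)) + ?e M) + 2 * c * h * T)
        \<longlonglongrightarrow> h / pi * (K / sinh (pi * v / h) * (2 / v + 4 * pi * (1 + 1 / v\<^sup>2)) + 0) + 2 * c * h * T"
      by (intro tendsto_add tendsto_mult tendsto_const)
    then show "(\<lambda>M. h / pi * (K / sinh (pi * v / h) * (2 / v + 4 * pi * (1 + 1 / v\<^sup>2)) + ?e M) + 2 * c * h * T)
        \<longlonglongrightarrow> B v + 2 * c * h * T"
      by (simp add: B_def)
    have "filterlim (\<lambda>M::nat. (real M + 1 / 2) * h) at_top sequentially" using h by real_asymp
    then have "\<forall>\<^sub>F M in sequentially. max (\<bar>x0\<bar> + 1) (\<bar>x\<bar> + 1) \<le> (real M + 1 / 2) * h"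
      unfolding filterlim_at_top by blast
    then show "\<forall>\<^sub>F M in sequentially. cmod (D N x - D N x0)
        \<le> h / pi * (K / sinh (pi * v / h) * (2 / v + 4 * pi * (1 + 1 / v\<^sup>2)) + ?e M) + 2 * c * h * T"
      using eventually_ge_at_top[of N]
    proof eventually_elim
      case (elim M)
      \<comment> \<open>The truncation index N stays fixed while the rectangle grows; the nodes
        between N and M are charged to T, whose bound is uniform in M.\<close>
      let ?I = "{- int M..int M} - {- int N..int N}"
      have D_eq: "D N s = D M s + (\<Sum>j\<in>?I. F (of_real (of_int j * h)) * of_real (J_fun j h s))" for s
      proof -
        have "(\<Sum>j\<in>?I. F (of_real (of_int j * h)) * of_real (J_fun j h s))
            = (\<Sum>j = - int M..int M. F (of_real (of_int j * h)) * of_real (J_fun j h s))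
              - (\<Sum>j = - int N..int N. F (of_real (of_int j * h)) * of_real (J_fun j h s))"
          using elim(2) by (intro sum_diff) auto
        then show ?thesis by (simp add: D_def)
      qed
      have "D N x - D N x0 = (D M x - D M x0)
          + (\<Sum>j\<in>?I. F (of_real (of_int j * h)) * of_real (J_fun j h x - J_fun j h x0))"
        unfolding D_eq by (simp add: sum_subtractf right_diff_distrib)
      moreover have "cmod (D M x - D M x0)
          \<le> h / pi * (K / sinh (pi * v / h) * (2 / v + 4 * pi * (1 + 1 / v\<^sup>2)) + ?e M)"
        unfolding D_def
        by (rule sinc_quadrature_increment[OF F K bound Y v h \<open>x0 \<le> x\<close> refl]) (use elim(1) in auto)
      moreover have "cmod (\<Sum>j\<in>?I. F (of_real (of_int j * h)) * of_real (J_fun j h x - J_fun j h x0))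
          \<le> 2 * c * h * T"
      proof -
        have "cmod (\<Sum>j\<in>?I. F (of_real (of_int j * h)) * of_real (J_fun j h x - J_fun j h x0))
            \<le> (\<Sum>j\<in>?I. cmod (F (of_real (of_int j * h))) * (2 * c * h))"
        proof (rule sum_norm_le)
          fix j assume "j \<in> ?I"
          have "\<bar>J_fun j h x - J_fun j h x0\<bar> \<le> 2 * c * h"
            using c(1)[of j x] c(1)[of j x0] by linarith
          then show "cmod (F (of_real (of_int j * h)) * of_real (J_fun j h x - J_fun j h x0))
              \<le> cmod (F (of_real (of_int j * h))) * (2 * c * h)"
            unfolding norm_mult norm_of_real by (rule mult_left_mono) simp
        qed
        also have "\<dots> = 2 * c * h * (\<Sum>j\<in>?I. cmod (F (of_real (of_int j * h))))"
          by (subst sum_distrib_right[symmetric]) (rule mult.commute)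
        also have "\<dots> \<le> 2 * c * h * T"
          using c h by (intro mult_left_mono tail elim) auto
        finally show ?thesis .
      qed
      ultimately show ?case
        by (metis (no_types, lifting) add_mono norm_triangle_le)
    qed
  qed simp
  have inc_d: "cmod (D N x - D N x0) \<le> B d + 2 * c * h * T" if "x0 \<le> x" for x0
  proof (rule tendsto_lowerbound)
    have "sinh (pi * d / h) \<noteq> 0" using d h by simp
    then have "isCont (\<lambda>v. B v + 2 * c * h * T) d"
      unfolding B_def using d h by (intro continuous_intros) auto
    then have "((\<lambda>v. B v + 2 * c * h * T) \<longlongrightarrow> B d + 2 * c * h * T) (at d)"
      by (simp add: isCont_def)
    then show "((\<lambda>v. B v + 2 * c * h * T) \<longlongrightarrow> B d + 2 * c * h * T) (at_left d)"
      by (rule filterlim_mono) (simp_all add: at_le)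
    show "\<forall>\<^sub>F v in at_left d. cmod (D N x - D N x0) \<le> B v + 2 * c * h * T"
      using eventually_at_left_real[OF d]
      by eventually_elim (use inc that in auto)
  qed simp
  have D_lim: "(D N \<longlongrightarrow> L) at_bot"
  proof -
    have "(D N \<longlongrightarrow> L - (\<Sum>j = - int N..int N. F (of_real (of_int j * h)) * of_real 0)) at_bot"
      unfolding D_def[abs_def]
      by (intro tendsto_diff lim tendsto_sum tendsto_mult tendsto_const tendsto_of_real J_fun_at_bot h)
    then show ?thesis by simp
  qed
  have "cmod (D N x - L) \<le> B d + 2 * c * h * T"
  proof (rule tendsto_upperbound)
    show "((\<lambda>x0. cmod (D N x - D N x0)) \<longlongrightarrow> cmod (D N x - L)) at_bot"
      by (intro tendsto_norm tendsto_diff tendsto_const D_lim)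
    show "\<forall>\<^sub>F x0 in at_bot. cmod (D N x - D N x0) \<le> B d + 2 * c * h * T"
      using eventually_le_at_bot[of x] by eventually_elim (rule inc_d)
  qed simp
  then show ?thesis by (simp add: D_def B_def algebra_simps)
qed

section \<open>Sums over the nodes and discrete Gronwall inequalities\<close>

lemma sum_nodes:
  "(\<Sum>j = - int N..int N. f j) = (\<Sum>p<2 * N + 1. f (node N p))"
  by (rule sum.reindex_bij_witness[of _ "node N" "\<lambda>j. nat (j + int N)"]) (auto simp: node_def)

text \<open>For h <= 1 the density 1 / (1 + t^2) varies by at most a factor 4 on [x, x + h], so each
  term of a Riemann sum is controlled by an increment of its primitive.\<close>

lemma lorentzian_le_arctan_increment:
  assumes "0 \<le> h" "h \<le> 1"
  shows "h / (1 + x\<^sup>2) \<le> 4 * (arctan (x + h) - arctan x)"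
proof -
  have "norm ((x + h) / (4 * (1 + x\<^sup>2)) - x / (4 * (1 + x\<^sup>2))) \<le> arctan (x + h) - arctan x"
  proof (rule norm_increment_le)
    fix t assume t: "t \<in> {x..x + h}"
    show "((\<lambda>t. t / (4 * (1 + x\<^sup>2))) has_vector_derivative 1 / (4 * (1 + x\<^sup>2))) (at t)"
      unfolding has_real_derivative_iff_has_vector_derivative[symmetric]
      by (intro DERIV_cdivide DERIV_ident)
    show "(arctan has_real_derivative inverse (1 + t\<^sup>2)) (at t)" by (rule DERIV_arctan)
    have "t\<^sup>2 \<le> 2 * x\<^sup>2 + 2 * (t - x)\<^sup>2"
      using zero_le_power2[of "t - 2 * x"] by (simp add: power2_eq_square algebra_simps)
    moreover have "(t - x)\<^sup>2 \<le> 1\<^sup>2" using t assms by (intro power_mono) auto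
    ultimately have "t\<^sup>2 \<le> 2 * x\<^sup>2 + 2" by simp
    then have "1 + t\<^sup>2 \<le> 4 + 4 * x\<^sup>2"
      using zero_le_power2[of x] by linarith
    then have "1 + t\<^sup>2 \<le> 4 * (1 + x\<^sup>2)" by (simp only: distrib_left mult_1_right)
    then show "norm (1 / (4 * (1 + x\<^sup>2))) \<le> inverse (1 + t\<^sup>2)"
      by (simp add: divide_inverse[symmetric] inverse_eq_divide frac_le add_pos_nonneg)
  qed (use assms in auto)
  then have "h / (4 * (1 + x\<^sup>2)) \<le> arctan (x + h) - arctan x"
    using assms by (simp add: diff_divide_distrib[symmetric])
  then have "4 * (h / (4 * (1 + x\<^sup>2))) \<le> 4 * (arctan (x + h) - arctan x)"
    by (rule mult_left_mono) simp
  moreover have "4 * (h / (4 * (1 + x\<^sup>2))) = h / (1 + x\<^sup>2)"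
    by (subst times_divide_eq_right) (rule mult_divide_mult_cancel_left, simp)
  ultimately show ?thesis by simp
qed

text \<open>The increments telescope to the total variation of arctan, so neither h nor N enters the
  bound.\<close>

lemma sum_lorentzian_nodes_le:
  assumes "0 < h" "h \<le> 1"
  shows "(\<Sum>j = - int N..int N. h / (1 + (of_int j * h)\<^sup>2)) \<le> 4 * pi"
proof -
  have "(\<Sum>j = - int N..int N. h / (1 + (of_int j * h)\<^sup>2))
      \<le> (\<Sum>p<2 * N + 1. 4 * (arctan (of_int (node N (Suc p)) * h) - arctan (of_int (node N p) * h)))"
    unfolding sum_nodes
  proof (rule sum_mono)
    fix p
    have "of_int (node N (Suc p)) * h = of_int (node N p) * h + h"
      by (simp add: node_def algebra_simps)
    then show "h / (1 + (of_int (node N p) * h)\<^sup>2)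
        \<le> 4 * (arctan (of_int (node N (Suc p)) * h) - arctan (of_int (node N p) * h))"
      using lorentzian_le_arctan_increment[of h "of_int (node N p) * h"] assms by simp
  qed
  also have "\<dots> = 4 * (arctan (of_int (node N (2 * N + 1)) * h) - arctan (of_int (node N 0) * h))"
    unfolding sum_distrib_left[symmetric] by (subst sum_lessThan_telescope) simp
  also have "\<dots> \<le> 4 * pi"
    using arctan_ubound[of "of_int (node N (2 * N + 1)) * h"] arctan_lbound[of "of_int (node N 0) * h"]
    by simp
  finally show ?thesis .
qed

lemma discrete_Gronwall:
  fixes u w :: "nat \<Rightarrow> real"
  assumes u: "\<And>p. p < m \<Longrightarrow> u p \<le> \<beta> + (\<Sum>q<p. w q * u q)"
    and w: "\<And>q. q < m \<Longrightarrow> 0 \<le> w q" and "0 \<le> \<beta>" and "p < m"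
  shows "u p \<le> \<beta> * exp (\<Sum>q<p. w q)"
proof -
  have "\<beta> + (\<Sum>q<p. w q * u q) \<le> \<beta> * exp (\<Sum>q<p. w q)" if "p < m" for p
    using that
  proof (induction p)
    case (Suc p)
    let ?E = "\<beta> * exp (\<Sum>q<p. w q)"
    have IH: "\<beta> + (\<Sum>q<p. w q * u q) \<le> ?E" using Suc by simp
    then have "u p \<le> ?E" using u[of p] Suc by simp
    then have "w p * u p \<le> w p * ?E" using w[of p] Suc by (intro mult_left_mono) auto
    then have "\<beta> + (\<Sum>q<Suc p. w q * u q) \<le> ?E * (1 + w p)"
      using IH by (simp add: algebra_simps)
    also have "\<dots> \<le> ?E * exp (w p)"
      using exp_ge_add_one_self[of "w p"] \<open>0 \<le> \<beta>\<close> by (intro mult_left_mono) auto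
    also have "\<dots> = \<beta> * exp (\<Sum>q<Suc p. w q)"
      by (simp add: exp_add mult_ac)
    finally show ?case .
  qed simp
  then show ?thesis using u[OF \<open>p < m\<close>] \<open>p < m\<close> by fastforce
qed

text \<open>At an index where u attains its maximum X the perturbation contributes at most \<delta>
  X. Gronwall gives X <= (\<beta> + \<delta> X) exp W, and the smallness of \<delta> absorbs half of
  X.\<close>

lemma perturbed_Volterra_stability:
  fixes u w :: "nat \<Rightarrow> real" and D :: "nat \<Rightarrow> nat \<Rightarrow> real"
  assumes u: "\<And>p. p < m \<Longrightarrow> u p \<le> \<beta> + (\<Sum>q<p. w q * u q) + (\<Sum>q<m. D p q * u q)"
    and u0: "\<And>p. p < m \<Longrightarrow> 0 \<le> u p"
    and w: "\<And>q. q < m \<Longrightarrow> 0 \<le> w q" and W: "(\<Sum>q<m. w q) \<le> W"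
    and D0: "\<And>p q. p < m \<Longrightarrow> q < m \<Longrightarrow> 0 \<le> D p q"
    and D: "\<And>p. p < m \<Longrightarrow> (\<Sum>q<m. D p q) \<le> \<delta>"
    and \<delta>: "\<delta> * exp W \<le> 1 / 2" and "0 \<le> \<beta>" and p: "p < m"
  shows "u p \<le> 2 * exp W * \<beta>"
proof -
  define X where "X = Max (u ` {..<m})"
  have X: "u q \<le> X" if "q < m" for q using that by (simp add: X_def)
  have "X \<in> u ` {..<m}" unfolding X_def using p by (intro Max_in) auto
  then obtain p0 where p0: "p0 < m" "u p0 = X" by auto
  have X0: "0 \<le> X" using u0[OF p0(1)] p0 by simp
  have \<delta>0: "0 \<le> \<delta>" using order_trans[OF sum_nonneg D[OF p]] D0 p by auto
  have "u p0 \<le> (\<beta> + \<delta> * X) * exp (\<Sum>q<p0. w q)"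
  proof (rule discrete_Gronwall[of m u])
    fix p assume p: "p < m"
    have "(\<Sum>q<m. D p q * u q) \<le> (\<Sum>q<m. D p q * X)"
      using D0[OF p] X by (intro sum_mono mult_left_mono) auto
    also have "\<dots> \<le> \<delta> * X"
      using D[OF p] X0 by (simp add: sum_distrib_right[symmetric] mult_right_mono)
    finally show "u p \<le> \<beta> + \<delta> * X + (\<Sum>q<p. w q * u q)" using u[OF p] by simp
  qed (use w p0 X0 \<delta>0 \<open>0 \<le> \<beta>\<close> in auto)
  also have "\<dots> \<le> (\<beta> + \<delta> * X) * exp W"
  proof -
    have "(\<Sum>q<p0. w q) \<le> (\<Sum>q<m. w q)" using p0 w by (intro sum_mono2) auto
    then show ?thesis using W X0 \<delta>0 \<open>0 \<le> \<beta>\<close> by (intro mult_left_mono) auto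
  qed
  also have "\<dots> = \<beta> * exp W + \<delta> * exp W * X" by (simp add: algebra_simps)
  also have "\<dots> \<le> \<beta> * exp W + 1 / 2 * X"
    using \<delta> X0 by (intro add_left_mono mult_right_mono)
  finally have "X \<le> 2 * (\<beta> * exp W)" using p0 by linarith
  then have "X \<le> 2 * exp W * \<beta>" by (simp only: mult_ac)
  then show ?thesis using X[OF p] by linarith
qed

text \<open>The true growth is logarithmic, but a square root suffices because h sqrt N tends to 0.
  It telescopes: the new term is at most 2 (sqrt(m + 1) - sqrt m).\<close>

lemma sum_inverse_Suc_le_sqrt: "(\<Sum>k<m. 1 / (1 + real k)) \<le> 2 * sqrt (real m)"
proof (induction m)
  case (Suc m)
  define a b where "a = sqrt (real m)" and "b = sqrt (real (Suc m))"
  have ab: "0 \<le> a" "a \<le> b" "1 \<le> b" "b * b = 1 + real m" "b * b - a * a = 1"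
    by (auto simp: a_def b_def)
  have "1 / (b * b) \<le> 2 * (b - a)"
  proof -
    have "(b - a) * (b + a) = 1" using ab by (simp add: algebra_simps)
    then have "1 \<le> (b - a) * (2 * b)"
      using ab mult_left_mono[of "b + a" "2 * b" "b - a"] by simp
    also have "\<dots> \<le> (b - a) * (2 * (b * b))"
      using ab mult_left_mono[of 1 b b] by (intro mult_left_mono) auto
    finally have "1 \<le> 2 * (b - a) * (b * b)" by (simp only: mult_ac)
    moreover have "0 < b * b" using ab(3) by simp
    ultimately show ?thesis by (simp only: pos_divide_le_eq)
  qed
  moreover have "(\<Sum>k<Suc m. 1 / (1 + real k)) = (\<Sum>k<m. 1 / (1 + real k)) + 1 / (b * b)"
    by (simp only: ab(4) sum.lessThan_Suc)
  ultimately have "(\<Sum>k<Suc m. 1 / (1 + real k)) \<le> 2 * a + 2 * (b - a)"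
    using Suc unfolding a_def[symmetric] by (metis add_mono)
  then show ?case by (simp add: b_def)
qed simp

lemma sum_inverse_distance_le:
  assumes "p < m"
  shows "(\<Sum>q<m. 1 / (1 + \<bar>real p - real q\<bar>)) \<le> 4 * sqrt (real m)"
proof -
  have mono: "(\<Sum>k<i. 1 / (1 + real k)) \<le> 2 * sqrt (real m)" if "i \<le> m" for i
    using sum_inverse_Suc_le_sqrt[of i] that by (meson order_trans mult_left_mono real_sqrt_le_mono of_nat_mono zero_le_numeral)
  have "(\<Sum>q<m. 1 / (1 + \<bar>real p - real q\<bar>))
      = (\<Sum>q<p. 1 / (1 + \<bar>real p - real q\<bar>)) + (\<Sum>q\<in>{p..<m}. 1 / (1 + \<bar>real p - real q\<bar>))"
    using assms by (subst sum.union_disjoint[symmetric]) (auto intro!: sum.cong)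
  also have "(\<Sum>q<p. 1 / (1 + \<bar>real p - real q\<bar>)) \<le> (\<Sum>q<p. 1 / (1 + real (p - Suc q)))"
    by (intro sum_mono frac_le) (auto simp: of_nat_diff)
  also have "\<dots> = (\<Sum>k<p. 1 / (1 + real k))"
    by (rule sum.nat_diff_reindex)
  also have "(\<Sum>q\<in>{p..<m}. 1 / (1 + \<bar>real p - real q\<bar>)) = (\<Sum>k<m - p. 1 / (1 + real k))"
    by (rule sum.reindex_bij_witness[of _ "\<lambda>k. k + p" "\<lambda>q. q - p"]) auto
  finally show ?thesis using mono[of p] mono[of "m - p"] assms by simp
qed

section \<open>The double-exponential map\<close>

lemma one_minus_tanh_squared:
  fixes z :: "'a::{banach,real_normed_field}"
  assumes "cosh z \<noteq> 0"
  shows "1 - (tanh z)\<^sup>2 = 1 / (cosh z)\<^sup>2"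
proof -
  have "1 - (s / c)\<^sup>2 = (c\<^sup>2 - s\<^sup>2) / c\<^sup>2" if "c \<noteq> 0" for c s :: 'a
    using that by (simp add: power_divide diff_divide_distrib)
  from this[OF assms] show ?thesis
    by (simp add: tanh_def cosh_square_eq)
qed

text \<open>With T the hyperbolic tangent, z - a and b - z are (b - a) / 2 times 1 + T and 1 - T,
  and 1 - T^2 is a reciprocal squared cosh. The hypothesis keeps \<zeta> away from the poles of
  T.\<close>

lemma Q_psi_DE:
  assumes "cosh (of_real (pi / 2) * sinh \<zeta>) \<noteq> 0"
  shows "Q_fun a b (psi_DE a b \<zeta>) = of_real (((b - a) / 2)\<^sup>2) / (cosh (of_real (pi / 2) * sinh \<zeta>))\<^sup>2"
proof -
  define T where "T = tanh (of_real (pi / 2) * sinh \<zeta>)"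
  have "Q_fun a b (psi_DE a b \<zeta>) = of_real (((b - a) / 2)\<^sup>2) * (1 - T\<^sup>2)"
    unfolding Q_fun_def psi_DE_def T_def[symmetric] by (simp add: power2_eq_square field_simps)
  also have "1 - T\<^sup>2 = 1 / (cosh (of_real (pi / 2) * sinh \<zeta>))\<^sup>2"
    unfolding T_def by (rule one_minus_tanh_squared[OF assms])
  finally show ?thesis by simp
qed

lemma psi_DE_has_derivative:
  "((psi_DE a b :: real \<Rightarrow> real) has_real_derivative
     (b - a) / 2 * (pi / 2) * cosh x / (cosh (pi / 2 * sinh x))\<^sup>2) (at x)"
proof -
  have "cosh (pi / 2 * sinh x) \<noteq> 0" using cosh_real_pos[of "pi / 2 * sinh x"] by linarith
  note tanh = one_minus_tanh_squared[OF this]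
  have "((psi_DE a b :: real \<Rightarrow> real) has_real_derivative
      (b - a) / 2 * ((1 - (tanh (pi / 2 * sinh x))\<^sup>2) * (pi / 2 * cosh x))) (at x)"
    unfolding psi_DE_def[abs_def] by (auto intro!: derivative_eq_intros)
  then show ?thesis unfolding tanh by (simp add: mult_ac)
qed

lemma psi_DE_deriv_eq:
  "psi_DE_deriv a b x = (b - a) / 2 * (pi / 2) * cosh x / (cosh (pi / 2 * sinh x))\<^sup>2"
  unfolding psi_DE_deriv_def by (rule DERIV_imp_deriv[OF psi_DE_has_derivative])

lemma phi_DE_psi_DE:
  assumes "a < b"
  shows "phi_DE a b (psi_DE a b x) = x"
proof -
  have "(2 * psi_DE a b x - b - a) / (b - a) = tanh (pi / 2 * sinh x)"
    using assms by (simp add: psi_DE_def field_simps)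
  then show ?thesis
    by (simp add: phi_DE_def artanh_tanh_real arsinh_sinh_real)
qed

lemma tanh_artanh_real:
  fixes u :: real
  assumes "\<bar>u\<bar> < 1"
  shows "tanh (artanh u) = u"
proof -
  have pos: "0 < 1 + u" "0 < 1 - u" using assms by auto
  then have "artanh u = ln (sqrt ((1 + u) / (1 - u)))" by (simp add: artanh_def ln_sqrt)
  then have "tanh (artanh u) = ((1 + u) / (1 - u) - 1) / ((1 + u) / (1 - u) + 1)"
    using pos by (simp add: tanh_ln_real)
  also have "\<dots> = u" using pos by (simp add: field_simps)
  finally show ?thesis .
qed

lemma sinh_complex_of_real: "sinh (complex_of_real x) = of_real (sinh x)"
  by (simp add: sinh_field_def flip: exp_of_real)

lemma cosh_complex_of_real: "cosh (complex_of_real x) = of_real (cosh x)"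
  by (simp add: cosh_field_def flip: exp_of_real)

lemma psi_DE_phi_DE:
  assumes "a < t" "t < b"
  shows "psi_DE a b (phi_DE a b t) = t"
proof -
  have "\<bar>(2 * t - b - a) / (b - a)\<bar> < 1" using assms by (auto simp: abs_less_iff field_simps)
  then have "tanh (artanh ((2 * t - b - a) / (b - a))) = (2 * t - b - a) / (b - a)"
    by (rule tanh_artanh_real)
  then show ?thesis
    using assms by (simp add: psi_DE_def phi_DE_def field_simps)
qed

lemma psi_DE_in_interval:
  assumes "a < b"
  shows "a < psi_DE a b (x :: real)" "psi_DE a b x < b"
proof -
  define T where "T = tanh (pi / 2 * sinh x)"
  have "- 1 < T" "T < 1" unfolding T_def by (rule tanh_real_gt_neg1 tanh_real_lt_1)+
  then have "(b - a) / 2 * (- 1) < (b - a) / 2 * T" "(b - a) / 2 * T < (b - a) / 2 * 1"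
    using assms by (intro mult_strict_left_mono; simp)+
  moreover have "psi_DE a b x = (b - a) / 2 * T + (b + a) / 2" by (simp add: psi_DE_def T_def)
  ultimately show "a < psi_DE a b x" "psi_DE a b x < b" by (simp_all add: field_simps)
qed

lemma psi_DE_at_bot: "((psi_DE a b :: real \<Rightarrow> real) \<longlongrightarrow> a) at_bot"
proof -
  have "filterlim (\<lambda>x::real. pi / 2 * sinh x) at_bot at_bot" by real_asymp
  from filterlim_compose[OF tanh_real_at_bot this]
  have "((\<lambda>x. (b - a) / 2 * tanh (pi / 2 * sinh x) + (b + a) / 2) \<longlongrightarrow> (b - a) / 2 * (- 1) + (b + a) / 2) at_bot"
    by (intro tendsto_add tendsto_mult tendsto_const)
  then show ?thesis by (simp add: psi_DE_def[abs_def] field_simps)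
qed

lemma psi_DE_at_top: "((psi_DE a b :: real \<Rightarrow> real) \<longlongrightarrow> b) at_top"
proof -
  have "filterlim (\<lambda>x::real. pi / 2 * sinh x) at_top at_top" by real_asymp
  from filterlim_compose[OF tanh_real_at_top this]
  have "((\<lambda>x. (b - a) / 2 * tanh (pi / 2 * sinh x) + (b + a) / 2) \<longlongrightarrow> (b - a) / 2 * 1 + (b + a) / 2) at_top"
    by (intro tendsto_add tendsto_mult tendsto_const)
  then show ?thesis by (simp add: psi_DE_def[abs_def] field_simps)
qed

text \<open>The bound for the sine after a quarter period shift and a rotation, which exchange real
  and imaginary parts up to sign.\<close>

lemma sinh_abs_Re_le_norm_cosh: "sinh \<bar>Re z\<bar> \<le> cmod (cosh z)"
proof -
  have "cosh z = sin (of_real pi / 2 - \<i> * z)"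
    by (simp add: cosh_conv_cos sin_diff)
  then show ?thesis
    using sinh_abs_Im_le_norm_sin[of "of_real pi / 2 - \<i> * z"] by simp
qed

lemma norm_cosh_le: "cmod (cosh z) \<le> cosh (Re z)"
proof -
  have "cmod (cosh z) \<le> (cmod (exp z) + cmod (exp (- z))) / 2"
    unfolding cosh_field_def using norm_triangle_ineq[of "exp z" "exp (- z)"] by (simp add: norm_divide)
  then show ?thesis by (simp add: cosh_field_def)
qed

lemma cosh_ge_exp_abs: "exp \<bar>x\<bar> / 2 \<le> cosh (x :: real)"
  by (cases "0 \<le> x") (simp_all add: cosh_field_def)

text \<open>The weight \<open>pi / (b - a) * cosh \<zeta>\<close> is \<open>\<psi>'(\<zeta>) / Q (\<psi>(\<zeta>))\<close>: it turns a function of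
  \<open>L_space\<close> into the integrand transported to the strip.\<close>

lemma L_space_transported:
  assumes "a < b" "0 < d" "d < pi / 2" "0 < \<alpha>" and G: "G \<in> L_space a b d \<alpha>"
  defines "A \<equiv> \<lambda>\<zeta>. G \<zeta> * (of_real (pi / (b - a)) * cosh \<zeta>)"
  shows "A holomorphic_on strip d"
    and "\<exists>C\<ge>0. \<forall>\<zeta>\<in>strip d. cmod (A \<zeta>) \<le> C / (1 + (Re \<zeta>)\<^sup>2)"
    and "\<exists>C\<ge>0. \<forall>x. cmod (A (of_real x)) \<le> C * exp (- (pi * \<alpha> / 2) * sinh \<bar>x\<bar>) / (1 + x\<^sup>2)"
proof -
  from G have an: "G analytic_on strip d" and bdd: "bounded (G ` strip d)"
    and "\<exists>L. \<forall>\<zeta>\<in>strip d. cmod (G \<zeta>) \<le> L * cmod (Q_fun a b (psi_DE a b \<zeta>)) powr \<alpha>"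
    by (auto simp: L_space_def)
  then obtain L0 where L0: "\<And>\<zeta>. \<zeta> \<in> strip d \<Longrightarrow> cmod (G \<zeta>) \<le> L0 * cmod (Q_fun a b (psi_DE a b \<zeta>)) powr \<alpha>"
    by blast
  define L where "L = \<bar>L0\<bar> * (((b - a) / 2)\<^sup>2) powr \<alpha>"
  define k where "k = pi / (b - a)"
  have k0: "0 < k" using assms by (simp add: k_def)
  have L_nonneg: "0 \<le> L" by (simp add: L_def)
  obtain B where "0 < B" and B: "\<And>\<zeta>. \<zeta> \<in> strip d \<Longrightarrow> cmod (G \<zeta>) \<le> B"
    using bdd unfolding bounded_pos by blast
  show "A holomorphic_on strip d"
    unfolding A_def cosh_field_def
    using an by (intro holomorphic_intros) (auto simp: analytic_on_open open_strip)
  \<comment> \<open>The lower bound \<open>q\<close> is left free: it becomes sinh(c sinh |Re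
    \<zeta>|) in the strip, and half an exponential with the sharper rate pi / 2 on the real
    line.\<close>
  have G_le: "cmod (G \<zeta>) \<le> L * q powr (- (2 * \<alpha>))"
    if \<zeta>: "\<zeta> \<in> strip d" and q: "0 < q" "q \<le> cmod (cosh (of_real (pi / 2) * sinh \<zeta>))" for \<zeta> q
  proof -
    let ?c = "cosh (of_real (pi / 2) * sinh \<zeta>)"
    have "?c \<noteq> 0" using q by auto
    then have "cmod (Q_fun a b (psi_DE a b \<zeta>)) = ((b - a) / 2)\<^sup>2 * cmod ?c powr (- 2)"
      by (subst Q_psi_DE) (simp_all add: norm_divide norm_power powr_minus field_simps del: of_real_power)
    then have "cmod (Q_fun a b (psi_DE a b \<zeta>)) powr \<alpha> = (((b - a) / 2)\<^sup>2) powr \<alpha> * cmod ?c powr (- (2 * \<alpha>))"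
      by (simp add: powr_mult powr_powr)
    also have "\<dots> \<le> (((b - a) / 2)\<^sup>2) powr \<alpha> * q powr (- (2 * \<alpha>))"
      using q \<open>0 < \<alpha>\<close> by (intro mult_left_mono powr_mono2') auto
    finally have "\<bar>L0\<bar> * cmod (Q_fun a b (psi_DE a b \<zeta>)) powr \<alpha> \<le> L * q powr (- (2 * \<alpha>))"
      unfolding L_def mult.assoc by (intro mult_left_mono) auto
    moreover have "L0 * cmod (Q_fun a b (psi_DE a b \<zeta>)) powr \<alpha> \<le> \<bar>L0\<bar> * cmod (Q_fun a b (psi_DE a b \<zeta>)) powr \<alpha>"
      by (intro mult_right_mono) auto
    ultimately show ?thesis using L0[OF \<zeta>] by linarith
  qed
  have A_le: "cmod (A \<zeta>) \<le> cmod (G \<zeta>) * (k * cosh (Re \<zeta>))" for \<zeta>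
    unfolding A_def norm_mult norm_of_real k_def[symmetric] using k0 norm_cosh_le[of \<zeta>]
    by (intro mult_left_mono) auto
  \<comment> \<open>The real part of (pi / 2) sinh \<zeta> is (pi / 2) sinh(Re \<zeta>) cos(Im
    \<zeta>), and cos(Im \<zeta>) >= cos d > 0. This is where d < pi / 2 enters.\<close>
  define c where "c = pi / 2 * cos d"
  have c0: "0 < c" using assms cos_gt_zero[of d] by (simp add: c_def)
  have lim: "((\<lambda>x::real. sinh (c * sinh x) powr (- (2 * \<alpha>)) * (cosh x * (1 + x\<^sup>2))) \<longlongrightarrow> 0) at_top"
    using c0 \<open>0 < \<alpha>\<close> by real_asymp
  then have "\<forall>\<^sub>F x in at_top. \<bar>sinh (c * sinh x) powr (- (2 * \<alpha>)) * (cosh x * (1 + x\<^sup>2))\<bar> < 1"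
    unfolding tendsto_iff by (auto simp: dist_real_def dest: spec[of _ 1])
  then obtain X0 where X0: "\<And>x. X0 \<le> x \<Longrightarrow> \<bar>sinh (c * sinh x) powr (- (2 * \<alpha>)) * (cosh x * (1 + x\<^sup>2))\<bar> < 1"
    unfolding eventually_at_top_linorder by blast
  \<comment> \<open>Beyond X the decay wins. For smaller |Re \<zeta>| the lower bound for cosh
    degenerates near the imaginary axis, and the boundedness of \<open>G\<close> takes over. The 1
    in the maximum keeps sinh positive.\<close>
  define X where "X = max X0 1"
  define C where "C = L * k + B * k * cosh X * (1 + X\<^sup>2)"
  show "\<exists>C\<ge>0. \<forall>\<zeta>\<in>strip d. cmod (A \<zeta>) \<le> C / (1 + (Re \<zeta>)\<^sup>2)"
  proof (intro exI conjI ballI)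
    show "0 \<le> C" using L_nonneg k0 \<open>0 < B\<close> by (simp add: C_def)
    fix \<zeta> assume \<zeta>: "\<zeta> \<in> strip d"
    define x where "x = \<bar>Re \<zeta>\<bar>"
    have cx: "cosh (Re \<zeta>) = cosh x" "(Re \<zeta>)\<^sup>2 = x\<^sup>2" by (auto simp: x_def cosh_real_abs)
    have pos: "0 < 1 + x\<^sup>2" by (simp add: add_pos_nonneg)
    have "cmod (A \<zeta>) * (1 + x\<^sup>2) \<le> C"
    proof (cases "X \<le> x")
      case True
      then have x: "X0 \<le> x" "1 \<le> x" by (auto simp: X_def)
      have "Re (sinh \<zeta>) = sinh (Re \<zeta>) * cos (Im \<zeta>)"
        by (simp add: sinh_field_def Re_exp field_simps)
      then have "\<bar>Re (of_real (pi / 2) * sinh \<zeta>)\<bar> = pi / 2 * (sinh x * \<bar>cos (Im \<zeta>)\<bar>)"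
        by (simp add: abs_mult x_def sinh_real_abs)
      moreover have "cos d \<le> cos \<bar>Im \<zeta>\<bar>"
        using \<zeta> assms by (intro cos_monotone_0_pi_le) (auto simp: strip_def)
      then have "cos d \<le> \<bar>cos (Im \<zeta>)\<bar>" by simp
      then have "pi / 2 * (sinh x * cos d) \<le> pi / 2 * (sinh x * \<bar>cos (Im \<zeta>)\<bar>)"
        using x by (intro mult_left_mono) auto
      ultimately have "c * sinh x \<le> \<bar>Re (of_real (pi / 2) * sinh \<zeta>)\<bar>"
        by (simp add: c_def mult_ac)
      then have le: "sinh (c * sinh x) \<le> cmod (cosh (of_real (pi / 2) * sinh \<zeta>))"
        using sinh_abs_Re_le_norm_cosh[of "of_real (pi / 2) * sinh \<zeta>"]
        by (meson order_trans sinh_real_le_iff)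
      have "0 < sinh (c * sinh x)" using c0 x by simp
      from G_le[OF \<zeta> this le]
      have "cmod (A \<zeta>) \<le> (L * sinh (c * sinh x) powr (- (2 * \<alpha>))) * (k * cosh x)"
        using A_le[of \<zeta>] k0 unfolding cx by (meson mult_right_mono order_trans cosh_real_nonneg mult_nonneg_nonneg less_imp_le)
      then have "cmod (A \<zeta>) * (1 + x\<^sup>2) \<le> (L * sinh (c * sinh x) powr (- (2 * \<alpha>))) * (k * cosh x) * (1 + x\<^sup>2)"
        using pos by (intro mult_right_mono) auto
      also have "\<dots> = L * k * (sinh (c * sinh x) powr (- (2 * \<alpha>)) * (cosh x * (1 + x\<^sup>2)))"
        by (simp add: mult_ac)
      also have "\<dots> \<le> L * k * 1"
        using X0[OF x(1)] L_nonneg k0 by (intro mult_left_mono) auto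
      also have "\<dots> \<le> C" using \<open>0 < B\<close> k0 by (simp add: C_def)
      finally show ?thesis .
    next
      case False
      have "cmod (A \<zeta>) \<le> B * (k * cosh x)"
        using A_le[of \<zeta>] B[OF \<zeta>] k0 unfolding cx by (meson mult_right_mono order_trans cosh_real_nonneg mult_nonneg_nonneg less_imp_le)
      also have "\<dots> \<le> B * (k * cosh X)"
      proof -
        have "0 \<le> x" "x \<le> X" using False by (auto simp: x_def)
        then have "cosh x \<le> cosh X" by (subst cosh_real_nonneg_le_iff) auto
        then show ?thesis using \<open>0 < B\<close> k0 by (intro mult_left_mono) auto
      qed
      finally have "cmod (A \<zeta>) * (1 + x\<^sup>2) \<le> B * (k * cosh X) * (1 + X\<^sup>2)"
        using False \<open>0 < B\<close> k0 pos by (intro mult_mono add_left_mono power_mono) (auto simp: x_def)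
      also have "\<dots> \<le> C" using L_nonneg k0 by (simp add: C_def mult_ac)
      finally show ?thesis .
    qed
    then show "cmod (A \<zeta>) \<le> C / (1 + (Re \<zeta>)\<^sup>2)" using pos unfolding cx by (simp add: pos_le_divide_eq)
  qed
  \<comment> \<open>Half of the rate pi \<alpha> available on the real line; the other half absorbs
    the growth of cosh x (1 + x^2).\<close>
  define \<beta> where "\<beta> = pi * \<alpha> / 2"
  have b0: "0 < \<beta>" using \<open>0 < \<alpha>\<close> by (simp add: \<beta>_def)
  have "((\<lambda>x::real. exp (- \<beta> * sinh x) * (cosh x * (1 + x\<^sup>2))) \<longlongrightarrow> 0) at_top"
    using b0 by real_asymp
  then have "\<forall>\<^sub>F x in at_top. \<bar>exp (- \<beta> * sinh x) * (cosh x * (1 + x\<^sup>2))\<bar> < 1"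
    unfolding tendsto_iff by (auto simp: dist_real_def dest: spec[of _ 1])
  then obtain Z0 where Z0: "\<And>x. Z0 \<le> x \<Longrightarrow> \<bar>exp (- \<beta> * sinh x) * (cosh x * (1 + x\<^sup>2))\<bar> < 1"
    unfolding eventually_at_top_linorder by blast
  define Z where "Z = max Z0 0"
  define W where "W = 1 + cosh Z * (1 + Z\<^sup>2)"
  have W: "exp (- \<beta> * sinh x) * (cosh x * (1 + x\<^sup>2)) \<le> W" if "0 \<le> x" for x :: real
  proof (cases "Z \<le> x")
    case True
    then have "exp (- \<beta> * sinh x) * (cosh x * (1 + x\<^sup>2)) \<le> 1" using Z0[of x] by (simp add: Z_def)
    also have "1 \<le> W" by (simp add: W_def)
    finally show ?thesis .
  next
    case False
    have "exp (- \<beta> * sinh x) * (cosh x * (1 + x\<^sup>2)) \<le> 1 * (cosh Z * (1 + Z\<^sup>2))"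
      using False that b0 by (intro mult_mono add_left_mono power_mono) (auto simp: cosh_real_nonneg_le_iff)
    then show ?thesis by (simp add: W_def)
  qed
  have W0: "0 \<le> W" by (simp add: W_def)
  define C' where "C' = L * 2 powr (2 * \<alpha>) * k * W"
  show "\<exists>C\<ge>0. \<forall>x. cmod (A (of_real x)) \<le> C * exp (- (pi * \<alpha> / 2) * sinh \<bar>x\<bar>) / (1 + x\<^sup>2)"
  proof (intro exI conjI allI)
    show "0 \<le> C'" using L_nonneg k0 W0 by (simp add: C'_def)
    fix x0 :: real
    define x where "x = \<bar>x0\<bar>"
    have cx: "cosh x0 = cosh x" "x0\<^sup>2 = x\<^sup>2" "0 \<le> x" by (auto simp: x_def cosh_real_abs)
    have pos: "0 < 1 + x\<^sup>2" by (simp add: add_pos_nonneg)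
    have "exp (pi / 2 * sinh x) / 2 \<le> cosh (pi / 2 * sinh x0)"
      using cosh_ge_exp_abs[of "pi / 2 * sinh x0"] by (simp add: abs_mult x_def sinh_real_abs)
    also have "\<dots> \<le> cmod (cosh (of_real (pi / 2) * sinh (of_real x0)))"
      unfolding sinh_complex_of_real of_real_mult[symmetric] cosh_complex_of_real by simp
    finally have "cmod (G (of_real x0)) \<le> L * (exp (pi / 2 * sinh x) / 2) powr (- (2 * \<alpha>))"
      using \<open>0 < d\<close> by (intro G_le) (auto simp: strip_def)
    also have "(exp (pi / 2 * sinh x) / 2) powr (- (2 * \<alpha>)) = 2 powr (2 * \<alpha>) * exp (- (2 * \<beta>) * sinh x)"
    proof -
      have "exp (pi / 2 * sinh x) powr (- (2 * \<alpha>)) = exp (- (2 * \<beta>) * sinh x)"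
        by (simp add: exp_powr_real \<beta>_def mult_ac)
      moreover have "(exp (pi / 2 * sinh x) / 2) powr (- (2 * \<alpha>))
          = exp (pi / 2 * sinh x) powr (- (2 * \<alpha>)) / 2 powr (- (2 * \<alpha>))"
        by (rule powr_divide)
      moreover have "p / 2 powr (- (2 * \<alpha>)) = 2 powr (2 * \<alpha>) * p" for p
        unfolding powr_minus divide_inverse inverse_inverse_eq by (rule mult.commute)
      ultimately show ?thesis by simp
    qed
    finally have "cmod (A (of_real x0)) \<le> L * (2 powr (2 * \<alpha>) * exp (- (2 * \<beta>) * sinh x)) * (k * cosh x)"
      using A_le[of "of_real x0"] k0 unfolding Re_complex_of_real cx
      by (meson mult_right_mono order_trans cosh_real_nonneg mult_nonneg_nonneg less_imp_le)
    then have "cmod (A (of_real x0)) * (1 + x\<^sup>2)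
        \<le> L * (2 powr (2 * \<alpha>) * exp (- (2 * \<beta>) * sinh x)) * (k * cosh x) * (1 + x\<^sup>2)"
      using pos by (intro mult_right_mono) auto
    also have "exp (- (2 * \<beta>) * sinh x) = exp (- \<beta> * sinh x) * exp (- \<beta> * sinh x)"
      by (simp flip: exp_add)
    also have "L * (2 powr (2 * \<alpha>) * (exp (- \<beta> * sinh x) * exp (- \<beta> * sinh x))) * (k * cosh x) * (1 + x\<^sup>2)
        = L * 2 powr (2 * \<alpha>) * k * exp (- \<beta> * sinh x) * (exp (- \<beta> * sinh x) * (cosh x * (1 + x\<^sup>2)))"
      by (simp add: mult_ac)
    also have "\<dots> \<le> L * 2 powr (2 * \<alpha>) * k * exp (- \<beta> * sinh x) * W"
      using L_nonneg k0 by (intro mult_left_mono W cx) auto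
    also have "\<dots> = C' * exp (- \<beta> * sinh x)" by (simp add: C'_def)
    finally show "cmod (A (of_real x0)) \<le> C' * exp (- (pi * \<alpha> / 2) * sinh \<bar>x0\<bar>) / (1 + x0\<^sup>2)"
      using pos unfolding cx \<beta>_def[symmetric] x_def[symmetric] by (simp add: pos_le_divide_eq)
  qed
qed

section \<open>The linear system\<close>

text \<open>Summing norms over the components leaves a scalar inequality. Splitting |sigma| into an
  indicator and 1 / (1 + |p - q|) separates a Volterra part, whose weights sum to at most 4 pi n C,
  from a perturbation of order h sqrt N. The lemma serves twice: with \<beta> = 0 for injectivity of
  the system, and with the quadrature error as residual.\<close>

lemma system_stability:
  fixes A :: "nat \<Rightarrow> nat \<Rightarrow> nat \<Rightarrow> complex" and e \<epsilon> :: "nat \<Rightarrow> nat \<Rightarrow> complex"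
  assumes h: "0 < h" "h \<le> 1" and C: "0 \<le> C"
    and A: "\<And>i l q. i < n \<Longrightarrow> l < n \<Longrightarrow> q < 2 * N + 1 \<Longrightarrow>
      cmod (A i l q) \<le> C / (1 + (of_int (node N q) * h)\<^sup>2)"
    and e: "\<And>i p. i < n \<Longrightarrow> p < 2 * N + 1 \<Longrightarrow> e i p = \<epsilon> i p
      + (\<Sum>q<2 * N + 1. of_real (h * sigma (node N p - node N q)) * (\<Sum>l<n. A i l q * e l q))"
    and \<epsilon>: "\<And>i p. i < n \<Longrightarrow> p < 2 * N + 1 \<Longrightarrow> cmod (\<epsilon> i p) \<le> \<beta>" and \<beta>: "0 \<le> \<beta>"
    and small: "real n * C * h * (4 * sqrt (real (2 * N + 1))) * exp (real n * C * (4 * pi)) \<le> 1 / 2"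
    and ip: "i < n" "p < 2 * N + 1"
  shows "cmod (e i p) \<le> 2 * exp (real n * C * (4 * pi)) * (real n * \<beta>)"
proof -
  let ?m = "2 * N + 1"
  define u where "u p = (\<Sum>l<n. cmod (e l p))" for p
  define w where "w q = real n * C * (h / (1 + (of_int (node N q) * h)\<^sup>2))" for q
  define D where "D p q = real n * C * h * (1 / (1 + \<bar>real p - real q\<bar>))" for p q :: nat
  have u0: "0 \<le> u p" for p by (simp add: u_def sum_nonneg)
  have w0: "0 \<le> w q" for q using C h by (simp add: w_def)
  have D0: "0 \<le> D p q" for p q using C h by (simp add: D_def)
  have term_le: "real n * (h * \<bar>sigma (node N p - node N q)\<bar> * (C / (1 + (of_int (node N q) * h)\<^sup>2) * u q))
      \<le> of_bool (q < p) * (w q * u q) + D p q * u q" for p q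
  proof -
    define \<theta> where "\<theta> = 1 / (1 + \<bar>real p - real q\<bar>)"
    define x where "x = (of_int (node N q) * h)\<^sup>2"
    have x0: "0 \<le> x" by (simp add: x_def)
    have "\<bar>sigma (node N p - node N q) - of_bool (q < p)\<bar> \<le> \<theta>"
      using abs_sigma_minus_indicator_le[of "node N p - node N q"] by (simp add: node_def \<theta>_def)
    then have \<sigma>: "\<bar>sigma (node N p - node N q)\<bar> \<le> of_bool (q < p) + \<theta>"
      by (cases "q < p") auto
    have \<theta>0: "0 \<le> \<theta>" by (simp add: \<theta>_def)
    have "real n * (h * \<bar>sigma (node N p - node N q)\<bar> * (C / (1 + x) * u q))
        \<le> real n * (h * (of_bool (q < p) + \<theta>) * (C / (1 + x) * u q))"
      using h C u0[of q] x0 \<sigma> by (intro mult_left_mono mult_right_mono) auto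
    also have "\<dots> = of_bool (q < p) * (real n * C * (h / (1 + x)) * u q)
        + real n * C * h * \<theta> * u q * (1 / (1 + x))"
      by (simp add: algebra_simps add_divide_distrib)
    \<comment> \<open>The decay of the coefficients is discarded in the perturbation; the factor h
      alone makes its row sums small.\<close>
    also have "real n * C * h * \<theta> * u q * (1 / (1 + x)) \<le> real n * C * h * \<theta> * u q * 1"
      using h C u0[of q] x0 \<theta>0 by (intro mult_left_mono) auto
    finally show ?thesis unfolding w_def D_def \<theta>_def x_def by simp
  qed
  have "u p \<le> 2 * exp (real n * C * (4 * pi)) * (real n * \<beta>)"
  proof (rule perturbed_Volterra_stability[where m = ?m and w = w and D = D])
    fix p assume p: "p < ?m"
    have e_le: "cmod (e i p) \<le> \<beta> + (\<Sum>q<?m. h * \<bar>sigma (node N p - node N q)\<bar> * (C / (1 + (of_int (node N q) * h)\<^sup>2) * u q))"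
      if i: "i < n" for i
    proof -
      have "cmod (\<Sum>q<?m. of_real (h * sigma (node N p - node N q)) * (\<Sum>l<n. A i l q * e l q))
          \<le> (\<Sum>q<?m. h * \<bar>sigma (node N p - node N q)\<bar> * (C / (1 + (of_int (node N q) * h)\<^sup>2) * u q))"
      proof (rule sum_norm_le)
        fix q assume q: "q \<in> {..<?m}"
        have "cmod (\<Sum>l<n. A i l q * e l q) \<le> (\<Sum>l<n. C / (1 + (of_int (node N q) * h)\<^sup>2) * cmod (e l q))"
        proof (rule sum_norm_le)
          fix l assume "l \<in> {..<n}"
          then show "cmod (A i l q * e l q) \<le> C / (1 + (of_int (node N q) * h)\<^sup>2) * cmod (e l q)"
            unfolding norm_mult using i q by (intro mult_right_mono A) auto
        qed
        also have "\<dots> = C / (1 + (of_int (node N q) * h)\<^sup>2) * u q"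
          unfolding u_def by (rule sum_distrib_left[symmetric])
        finally have "h * \<bar>sigma (node N p - node N q)\<bar> * cmod (\<Sum>l<n. A i l q * e l q)
            \<le> h * \<bar>sigma (node N p - node N q)\<bar> * (C / (1 + (of_int (node N q) * h)\<^sup>2) * u q)"
          using h by (intro mult_left_mono) auto
        then show "cmod (of_real (h * sigma (node N p - node N q)) * (\<Sum>l<n. A i l q * e l q))
            \<le> h * \<bar>sigma (node N p - node N q)\<bar> * (C / (1 + (of_int (node N q) * h)\<^sup>2) * u q)"
          using h by (simp only: norm_mult norm_of_real abs_mult abs_of_pos)
      qed
      then show ?thesis
        unfolding e[OF i p] using \<epsilon>[OF i p] by (intro norm_triangle_le add_mono) auto
    qed
    have "u p \<le> (\<Sum>i<n. \<beta> + (\<Sum>q<?m. h * \<bar>sigma (node N p - node N q)\<bar> * (C / (1 + (of_int (node N q) * h)\<^sup>2) * u q)))"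
      unfolding u_def[of p] by (intro sum_mono e_le) simp
    also have "\<dots> = real n * \<beta> + (\<Sum>q<?m. real n * (h * \<bar>sigma (node N p - node N q)\<bar> * (C / (1 + (of_int (node N q) * h)\<^sup>2) * u q)))"
      by (simp add: distrib_left sum_distrib_left del: sum.lessThan_Suc)
    also have "\<dots> \<le> real n * \<beta> + (\<Sum>q<?m. of_bool (q < p) * (w q * u q) + D p q * u q)"
      by (intro add_left_mono sum_mono term_le)
    also have "\<dots> = real n * \<beta> + ((\<Sum>q<?m. of_bool (q < p) * (w q * u q)) + (\<Sum>q<?m. D p q * u q))"
      by (simp only: sum.distrib)
    also have "(\<Sum>q<?m. of_bool (q < p) * (w q * u q)) = (\<Sum>q<p. w q * u q)"
    proof -
      have "(\<Sum>q<?m. of_bool (q < p) * (w q * u q)) = (\<Sum>q\<in>{q\<in>{..<?m}. q < p}. w q * u q)"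
        by (subst sum.inter_filter, simp) (intro sum.cong refl, simp)
      also have "{q\<in>{..<?m}. q < p} = {..<p}" using p by auto
      finally show ?thesis .
    qed
    finally show "u p \<le> real n * \<beta> + (\<Sum>q<p. w q * u q) + (\<Sum>q<?m. D p q * u q)" by linarith
    have "(\<Sum>q<?m. D p q) = real n * C * h * (\<Sum>q<?m. 1 / (1 + \<bar>real p - real q\<bar>))"
      unfolding D_def by (rule sum_distrib_left[symmetric])
    also have "\<dots> \<le> real n * C * h * (4 * sqrt (real ?m))"
      using C h by (intro mult_left_mono sum_inverse_distance_le p) auto
    finally show "(\<Sum>q<?m. D p q) \<le> real n * C * h * (4 * sqrt (real ?m))" .
  next
    have "(\<Sum>q<?m. w q) = real n * C * (\<Sum>j = - int N..int N. h / (1 + (of_int j * h)\<^sup>2))"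
      unfolding w_def sum_nodes by (rule sum_distrib_left[symmetric])
    also have "\<dots> \<le> real n * C * (4 * pi)"
      using C h by (intro mult_left_mono sum_lorentzian_nodes_le) auto
    finally show "(\<Sum>q<?m. w q) \<le> real n * C * (4 * pi)" .
  qed (use u0 w0 D0 small \<beta> ip in auto)
  moreover have "cmod (e i p) \<le> u p"
    unfolding u_def using ip by (intro member_le_sum) auto
  ultimately show ?thesis by linarith
qed

section \<open>Stacked vectors and the componentwise form of the system\<close>

lemma block_index_less:
  fixes i p n m :: nat
  assumes "i < n" "p < m"
  shows "i * m + p < n * m"
proof -
  have "i * m + p < Suc i * m" using assms by simp
  also have "\<dots> \<le> n * m" using assms by (intro mult_le_mono1) simp
  finally show ?thesis .
qed

lemma block_index_div_mod:
  fixes i p m :: nat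
  assumes "p < m"
  shows "(i * m + p) div m = i" "(i * m + p) mod m = p"
  using assms by simp_all

lemma block_index_cases:
  fixes P n m :: nat
  assumes "P < n * m"
  obtains i p where "P = i * m + p" "i < n" "p < m"
proof -
  have "0 < m" using assms by (cases m) auto
  then show thesis
    using that[of "P div m" "P mod m"] assms by (simp add: less_mult_imp_div_less)
qed

lemma sum_blocks:
  fixes f :: "nat \<Rightarrow> 'a::comm_monoid_add"
  shows "(\<Sum>Q = 0..<n * m. f Q) = (\<Sum>l<n. \<Sum>q<m. f (l * m + q))"
proof -
  have "(\<Sum>Q = 0..<n * m. f Q) = (\<Sum>l<n. \<Sum>Q = l * m..<l * m + m. f Q)"
    by (simp add: sum.nat_group atLeast0LessThan)
  also have "\<dots> = (\<Sum>l<n. \<Sum>q<m. f (l * m + q))"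
  proof (rule sum.cong[OF refl])
    fix l
    show "(\<Sum>Q = l * m..<l * m + m. f Q) = (\<Sum>q<m. f (l * m + q))"
      by (rule sum.reindex_bij_witness[of _ "\<lambda>q. l * m + q" "\<lambda>Q. Q - l * m"]) auto
  qed
  finally show ?thesis .
qed

lemma mult_mat_vec_block:
  fixes A :: "complex mat"
  assumes "A \<in> carrier_mat (n * m) (n * m)" "v \<in> carrier_vec (n * m)" "i < n" "p < m"
  shows "(A *\<^sub>v v) $ (i * m + p) = (\<Sum>l<n. \<Sum>q<m. A $$ (i * m + p, l * m + q) * v $ (l * m + q))"
proof -
  have "(A *\<^sub>v v) $ (i * m + p) = (\<Sum>Q = 0..<n * m. A $$ (i * m + p, Q) * v $ Q)"
    using assms block_index_less[OF assms(3,4)] by (auto simp: scalar_prod_def intro!: sum.cong)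
  then show ?thesis by (simp only: sum_blocks)
qed

lemma system_matrices_carrier:
  "integration_mat a b n h N \<in> carrier_mat (n * (2 * N + 1)) (n * (2 * N + 1))"
  "K_mat a b n k h N \<in> carrier_mat (n * (2 * N + 1)) (n * (2 * N + 1))"
  "kron (1\<^sub>m n) (1\<^sub>m (2 * N + 1)) \<in> carrier_mat (n * (2 * N + 1)) (n * (2 * N + 1))"
  "G_vec a b n g h N \<in> carrier_vec (n * (2 * N + 1))"
  "R_vec n r N \<in> carrier_vec (n * (2 * N + 1))"
  by (auto simp: integration_mat_def kron_def K_mat_def block_mat_def G_vec_def R_vec_def
      I_mat_def D_mat_def diag_of_def)

lemma kron_one_index:
  assumes "B \<in> carrier_mat m m" "i < n" "p < m" "l < n" "q < m"
  shows "kron (1\<^sub>m n) B $$ (i * m + p, l * m + q) = (if i = l then B $$ (p, q) else 0)"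
  using assms block_index_less[of i n p m] block_index_less[of l n q m]
  by (auto simp: kron_def)

lemma integration_factor_index:
  assumes "p < 2 * N + 1" "q < 2 * N + 1"
  shows "(of_real h \<cdot>\<^sub>m (I_mat N * D_mat a b h N)) $$ (p, q)
    = of_real (h * sigma (node N p - node N q) * psi_DE_deriv a b (of_int (node N q) * h))"
proof -
  let ?m = "2 * N + 1"
  have "(I_mat N * D_mat a b h N) $$ (p, q) = (\<Sum>s = 0..<?m. I_mat N $$ (p, s) * D_mat a b h N $$ (s, q))"
    using assms by (auto simp: I_mat_def D_mat_def diag_of_def scalar_prod_def intro!: sum.cong simp del: sum.op_ivl_Suc)
  also have "\<dots> = (\<Sum>s = 0..<?m. if s = q then I_mat N $$ (p, q) * of_real (psi_DE_deriv a b (of_int (node N q) * h)) else 0)"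
    using assms by (intro sum.cong) (auto simp: D_mat_def diag_of_def)
  also have "\<dots> = of_real (sigma (node N p - node N q)) * of_real (psi_DE_deriv a b (of_int (node N q) * h))"
    using assms by (simp add: I_mat_def del: sum.op_ivl_Suc)
  finally show ?thesis
    using assms by (simp add: I_mat_def D_mat_def diag_of_def)
qed

lemma kron_one_mult_vec:
  assumes B: "B \<in> carrier_mat m m" and v: "v \<in> carrier_vec (n * m)" and ip: "i < n" "p < m"
  shows "(kron (1\<^sub>m n) B *\<^sub>v v) $ (i * m + p) = (\<Sum>q<m. B $$ (p, q) * v $ (i * m + q))"
proof -
  have "kron (1\<^sub>m n) B \<in> carrier_mat (n * m) (n * m)" using B by (auto simp: kron_def)
  from mult_mat_vec_block[OF this v ip]
  have "(kron (1\<^sub>m n) B *\<^sub>v v) $ (i * m + p)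
      = (\<Sum>l<n. \<Sum>q<m. kron (1\<^sub>m n) B $$ (i * m + p, l * m + q) * v $ (l * m + q))" .
  also have "\<dots> = (\<Sum>l<n. if l = i then (\<Sum>q<m. B $$ (p, q) * v $ (i * m + q)) else 0)"
    using ip by (intro sum.cong refl) (auto simp: kron_one_index[OF B])
  also have "\<dots> = (\<Sum>q<m. B $$ (p, q) * v $ (i * m + q))" using ip by simp
  finally show ?thesis .
qed

lemma block_diag_mult_vec:
  assumes v: "v \<in> carrier_vec (n * m)" and ip: "i < n" "p < m"
  shows "(block_mat n m (\<lambda>i l. diag_of m (f i l)) *\<^sub>v v) $ (i * m + p) = (\<Sum>l<n. f i l p * v $ (l * m + p))"
proof -
  have "block_mat n m (\<lambda>i l. diag_of m (f i l)) \<in> carrier_mat (n * m) (n * m)"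
    by (simp add: block_mat_def)
  from mult_mat_vec_block[OF this v ip]
  have "(block_mat n m (\<lambda>i l. diag_of m (f i l)) *\<^sub>v v) $ (i * m + p)
      = (\<Sum>l<n. \<Sum>q<m. block_mat n m (\<lambda>i l. diag_of m (f i l)) $$ (i * m + p, l * m + q) * v $ (l * m + q))" .
  also have "\<dots> = (\<Sum>l<n. \<Sum>q<m. if q = p then f i l p * v $ (l * m + p) else 0)"
  proof (intro sum.cong refl)
    fix l q assume "l \<in> {..<n}" "q \<in> {..<m}"
    then show "block_mat n m (\<lambda>i l. diag_of m (f i l)) $$ (i * m + p, l * m + q) * v $ (l * m + q)
        = (if q = p then f i l p * v $ (l * m + p) else 0)"
      using ip block_index_less[of i n p m] block_index_less[of l n q m]
      by (auto simp: block_mat_def diag_of_def)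
  qed
  also have "\<dots> = (\<Sum>l<n. f i l p * v $ (l * m + p))"
    using ip by simp
  finally show ?thesis .
qed

lemma integration_mat_mult_vec:
  assumes v: "v \<in> carrier_vec (n * (2 * N + 1))" and ip: "i < n" "p < 2 * N + 1"
  shows "(integration_mat a b n h N *\<^sub>v v) $ (i * (2 * N + 1) + p)
    = (\<Sum>q<2 * N + 1. of_real (h * sigma (node N p - node N q) * psi_DE_deriv a b (of_int (node N q) * h))
         * v $ (i * (2 * N + 1) + q))"
proof -
  have B: "of_real h \<cdot>\<^sub>m (I_mat N * D_mat a b h N) \<in> carrier_mat (2 * N + 1) (2 * N + 1)"
    by (auto simp: I_mat_def D_mat_def diag_of_def)
  show ?thesis
    unfolding integration_mat_def kron_one_mult_vec[OF B v ip]
    by (intro sum.cong refl arg_cong2[where f = "(*)"] integration_factor_index ip) simp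
qed

lemma K_mat_mult_vec:
  assumes v: "v \<in> carrier_vec (n * (2 * N + 1))" and ip: "i < n" "p < 2 * N + 1"
  shows "(K_mat a b n k h N *\<^sub>v v) $ (i * (2 * N + 1) + p)
    = (\<Sum>l<n. at_real a b (k i l) (t_DE a b h (node N p)) * v $ (l * (2 * N + 1) + p))"
  unfolding K_mat_def by (rule block_diag_mult_vec[OF v ip])

lemma system_matrix_mult_vec:
  assumes v: "v \<in> carrier_vec (n * (2 * N + 1))" and ip: "i < n" "p < 2 * N + 1"
  shows "((kron (1\<^sub>m n) (1\<^sub>m (2 * N + 1)) - integration_mat a b n h N * K_mat a b n k h N) *\<^sub>v v) $ (i * (2 * N + 1) + p)
    = v $ (i * (2 * N + 1) + p)
      - (\<Sum>q<2 * N + 1. of_real (h * sigma (node N p - node N q) * psi_DE_deriv a b (of_int (node N q) * h))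
           * (\<Sum>l<n. at_real a b (k i l) (t_DE a b h (node N q)) * v $ (l * (2 * N + 1) + q)))"
proof -
  let ?m = "2 * N + 1"
  have Kv: "K_mat a b n k h N *\<^sub>v v \<in> carrier_vec (n * ?m)"
    using system_matrices_carrier(2) v by (rule mult_mat_vec_carrier)
  have IKv: "integration_mat a b n h N *\<^sub>v (K_mat a b n k h N *\<^sub>v v) \<in> carrier_vec (n * ?m)"
    using system_matrices_carrier(1) Kv by (rule mult_mat_vec_carrier)
  have id: "kron (1\<^sub>m n) (1\<^sub>m ?m) *\<^sub>v v \<in> carrier_vec (n * ?m)"
    using system_matrices_carrier(3) v by (rule mult_mat_vec_carrier)
  have "(kron (1\<^sub>m n) (1\<^sub>m ?m) *\<^sub>v v) $ (i * ?m + p) = (\<Sum>q<?m. (1\<^sub>m ?m) $$ (p, q) * v $ (i * ?m + q))"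
    by (rule kron_one_mult_vec[OF one_carrier_mat v ip])
  also have "\<dots> = (\<Sum>q<?m. if q = p then v $ (i * ?m + p) else 0)"
    by (intro sum.cong refl) (use ip in \<open>auto simp: index_one_mat\<close>)
  also have "\<dots> = v $ (i * ?m + p)" using ip by (simp only: sum.delta finite_lessThan lessThan_iff if_True)
  finally have one: "(kron (1\<^sub>m n) (1\<^sub>m ?m) *\<^sub>v v) $ (i * ?m + p) = v $ (i * ?m + p)" .
  have "(kron (1\<^sub>m n) (1\<^sub>m ?m) - integration_mat a b n h N * K_mat a b n k h N) *\<^sub>v v
      = kron (1\<^sub>m n) (1\<^sub>m ?m) *\<^sub>v v - integration_mat a b n h N *\<^sub>v (K_mat a b n k h N *\<^sub>v v)"
    using minus_mult_distrib_mat_vec[OF system_matrices_carrier(3)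
        mult_carrier_mat[OF system_matrices_carrier(1,2)] v]
      assoc_mult_mat_vec[OF system_matrices_carrier(1,2) v] by simp
  then have "((kron (1\<^sub>m n) (1\<^sub>m ?m) - integration_mat a b n h N * K_mat a b n k h N) *\<^sub>v v) $ (i * ?m + p)
      = v $ (i * ?m + p) - (integration_mat a b n h N *\<^sub>v (K_mat a b n k h N *\<^sub>v v)) $ (i * ?m + p)"
    using block_index_less[OF ip] IKv one by (simp only: index_minus_vec(1) carrier_vecD)
  also have "(integration_mat a b n h N *\<^sub>v (K_mat a b n k h N *\<^sub>v v)) $ (i * ?m + p)
      = (\<Sum>q<?m. of_real (h * sigma (node N p - node N q) * psi_DE_deriv a b (of_int (node N q) * h))
           * (\<Sum>l<n. at_real a b (k i l) (t_DE a b h (node N q)) * v $ (l * ?m + q)))"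
    unfolding integration_mat_mult_vec[OF Kv ip]
    by (intro sum.cong refl arg_cong2[where f = "(*)"] K_mat_mult_vec[OF v] ip) simp
  finally show ?thesis .
qed

lemma DE_system_iff:
  "DE_system a b n k g r h N Y \<longleftrightarrow> Y \<in> carrier_vec (n * (2 * N + 1)) \<and>
    (\<forall>i<n. \<forall>p<2 * N + 1. Y $ (i * (2 * N + 1) + p) = r i
      + (\<Sum>q<2 * N + 1. of_real (h * sigma (node N p - node N q) * psi_DE_deriv a b (of_int (node N q) * h))
           * (at_real a b (g i) (t_DE a b h (node N q))
               + (\<Sum>l<n. at_real a b (k i l) (t_DE a b h (node N q)) * Y $ (l * (2 * N + 1) + q)))))"
proof (cases "Y \<in> carrier_vec (n * (2 * N + 1))")
  case True
  let ?m = "2 * N + 1"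
  let ?M = "kron (1\<^sub>m n) (1\<^sub>m ?m) - integration_mat a b n h N * K_mat a b n k h N"
  let ?b = "integration_mat a b n h N *\<^sub>v G_vec a b n g h N + R_vec n r N"
  have M: "?M *\<^sub>v Y \<in> carrier_vec (n * ?m)"
    by (intro mult_mat_vec_carrier[OF _ True] minus_carrier_mat mult_carrier_mat[OF system_matrices_carrier(1,2)])
  have b: "?b \<in> carrier_vec (n * ?m)"
    by (intro add_carrier_vec mult_mat_vec_carrier[OF system_matrices_carrier(1,4)] system_matrices_carrier)
  have G: "G_vec a b n g h N $ (i * ?m + q) = at_real a b (g i) (t_DE a b h (node N q))"
    if "i < n" "q < ?m" for i q
    using that by (simp only: G_vec_def index_vec block_index_less block_index_div_mod)
  have b_ip: "?b $ (i * ?m + p) = (\<Sum>q<?m. of_real (h * sigma (node N p - node N q) * psi_DE_deriv a b (of_int (node N q) * h))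
      * at_real a b (g i) (t_DE a b h (node N q))) + r i" if ip: "i < n" "p < ?m" for i p
  proof -
    have "?b $ (i * ?m + p) = (integration_mat a b n h N *\<^sub>v G_vec a b n g h N) $ (i * ?m + p) + R_vec n r N $ (i * ?m + p)"
      using block_index_less[OF ip] system_matrices_carrier(5)[of n r N] by (intro index_add_vec) auto
    also have "R_vec n r N $ (i * ?m + p) = r i"
      using ip by (simp only: R_vec_def index_vec block_index_less block_index_div_mod)
    also have "(integration_mat a b n h N *\<^sub>v G_vec a b n g h N) $ (i * ?m + p)
        = (\<Sum>q<?m. of_real (h * sigma (node N p - node N q) * psi_DE_deriv a b (of_int (node N q) * h))
            * at_real a b (g i) (t_DE a b h (node N q)))"
      unfolding integration_mat_mult_vec[OF system_matrices_carrier(4) ip]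
      by (intro sum.cong refl arg_cong2[where f = "(*)"] G ip) simp
    finally show ?thesis .
  qed
  have "?M *\<^sub>v Y = ?b \<longleftrightarrow> (\<forall>i<n. \<forall>p<?m. (?M *\<^sub>v Y) $ (i * ?m + p) = ?b $ (i * ?m + p))"
  proof
    assume eq: "\<forall>i<n. \<forall>p<?m. (?M *\<^sub>v Y) $ (i * ?m + p) = ?b $ (i * ?m + p)"
    show "?M *\<^sub>v Y = ?b"
    proof (rule eq_vecI)
      fix P assume "P < dim_vec ?b"
      then have "P < n * ?m" using b by (simp only: carrier_vecD)
      then obtain i p where "P = i * ?m + p" "i < n" "p < ?m" by (rule block_index_cases)
      then show "(?M *\<^sub>v Y) $ P = ?b $ P" using eq by blast
    qed (use M b in \<open>simp only: carrier_vecD\<close>)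
  qed simp
  also have "\<dots> \<longleftrightarrow> (\<forall>i<n. \<forall>p<?m. Y $ (i * ?m + p) = r i
      + (\<Sum>q<?m. of_real (h * sigma (node N p - node N q) * psi_DE_deriv a b (of_int (node N q) * h))
           * (at_real a b (g i) (t_DE a b h (node N q))
               + (\<Sum>l<n. at_real a b (k i l) (t_DE a b h (node N q)) * Y $ (l * ?m + q)))))"
  proof (intro all_cong)
    have shift: "(y - (\<Sum>q<m. c q * s q) = (\<Sum>q<m. c q * t q) + r0)
        \<longleftrightarrow> (y = r0 + (\<Sum>q<m. c q * (t q + s q)))"
      for y r0 :: complex and c s t :: "nat \<Rightarrow> complex" and m
      by (auto simp: distrib_left sum.distrib algebra_simps)
    fix i p assume ip: "i < n" "p < ?m"
    show "((?M *\<^sub>v Y) $ (i * ?m + p) = ?b $ (i * ?m + p)) \<longleftrightarrow> (Y $ (i * ?m + p) = r i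
      + (\<Sum>q<?m. of_real (h * sigma (node N p - node N q) * psi_DE_deriv a b (of_int (node N q) * h))
           * (at_real a b (g i) (t_DE a b h (node N q))
               + (\<Sum>l<n. at_real a b (k i l) (t_DE a b h (node N q)) * Y $ (l * ?m + q)))))"
      unfolding system_matrix_mult_vec[OF True ip] b_ip[OF ip]
      by (rule shift)
  qed
  finally show ?thesis unfolding DE_system_def using True by blast
next
  case False
  then show ?thesis by (simp add: DE_system_def)
qed

lemma unique_solution_of_trivial_kernel:
  fixes M :: "complex mat"
  assumes M: "M \<in> carrier_mat k k" and c: "c \<in> carrier_vec k"
    and ker: "\<And>v. v \<in> carrier_vec k \<Longrightarrow> M *\<^sub>v v = 0\<^sub>v k \<Longrightarrow> v = 0\<^sub>v k"
  shows "\<exists>!Y. Y \<in> carrier_vec k \<and> M *\<^sub>v Y = c"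
proof -
  have "det M \<noteq> 0" using det_0_iff_vec_prod_zero_field[OF M] ker by blast
  from det_non_zero_imp_unit[OF M this, of "()"]
  obtain B where B: "B \<in> carrier_mat k k" "B * M = 1\<^sub>m k" "M * B = 1\<^sub>m k"
    by (auto simp: Units_def ring_mat_def)
  show ?thesis
  proof (rule ex1I[of _ "B *\<^sub>v c"])
    show "B *\<^sub>v c \<in> carrier_vec k \<and> M *\<^sub>v (B *\<^sub>v c) = c"
      using B M c by (simp flip: assoc_mult_mat_vec)
    fix Y assume Y: "Y \<in> carrier_vec k \<and> M *\<^sub>v Y = c"
    then have "B *\<^sub>v c = (B * M) *\<^sub>v Y"
      using assoc_mult_mat_vec[OF B(1) M, of Y] by simp
    then show "Y = B *\<^sub>v c" using B Y by simp
  qed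
qed

text \<open>The system is square, so a trivial kernel suffices; the stability estimate with zero
  residual will supply it.\<close>

lemma DE_system_uniquely_solvable:
  assumes ker: "\<And>v. v \<in> carrier_vec (n * (2 * N + 1)) \<Longrightarrow>
    (\<And>i p. i < n \<Longrightarrow> p < 2 * N + 1 \<Longrightarrow> v $ (i * (2 * N + 1) + p)
      = (\<Sum>q<2 * N + 1. of_real (h * sigma (node N p - node N q) * psi_DE_deriv a b (of_int (node N q) * h))
           * (\<Sum>l<n. at_real a b (k i l) (t_DE a b h (node N q)) * v $ (l * (2 * N + 1) + q)))) \<Longrightarrow>
    (\<And>i p. i < n \<Longrightarrow> p < 2 * N + 1 \<Longrightarrow> v $ (i * (2 * N + 1) + p) = 0)"
  shows "\<exists>!Y. DE_system a b n k g r h N Y"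
  unfolding DE_system_def
proof (rule unique_solution_of_trivial_kernel)
  let ?m = "2 * N + 1"
  let ?M = "kron (1\<^sub>m n) (1\<^sub>m ?m) - integration_mat a b n h N * K_mat a b n k h N"
  show "?M \<in> carrier_mat (n * ?m) (n * ?m)"
    by (intro minus_carrier_mat mult_carrier_mat[OF system_matrices_carrier(1,2)])
  show "integration_mat a b n h N *\<^sub>v G_vec a b n g h N + R_vec n r N \<in> carrier_vec (n * ?m)"
    by (intro add_carrier_vec mult_mat_vec_carrier[OF system_matrices_carrier(1,4)] system_matrices_carrier)
  fix v assume v: "v \<in> carrier_vec (n * ?m)" and 0: "?M *\<^sub>v v = 0\<^sub>v (n * ?m)"
  have zero: "v $ (i * ?m + p) = 0" if ip: "i < n" "p < ?m" for i p
  proof (rule ker[OF v _ ip])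
    fix i p assume ip: "i < n" "p < ?m"
    show "v $ (i * ?m + p) = (\<Sum>q<?m. of_real (h * sigma (node N p - node N q) * psi_DE_deriv a b (of_int (node N q) * h))
           * (\<Sum>l<n. at_real a b (k i l) (t_DE a b h (node N q)) * v $ (l * ?m + q)))"
      using system_matrix_mult_vec[OF v ip, of a b h k] block_index_less[OF ip]
      unfolding 0 by (simp del: sum.lessThan_Suc One_nat_def)
  qed
  show "v = 0\<^sub>v (n * ?m)"
  proof (rule eq_vecI)
    fix P assume "P < dim_vec (0\<^sub>v (n * ?m) :: complex Matrix.vec)"
    then have P: "P < n * ?m" by simp
    then obtain i p where "P = i * ?m + p" "i < n" "p < ?m" by (rule block_index_cases)
    then show "v $ P = 0\<^sub>v (n * ?m) $ P" using P zero by simp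
  qed (use v in auto)
qed

section \<open>The convergence theorem\<close>

text \<open>Everything that the choice of the step size contributes. Because N h = ln(2 d N /
  \<alpha>), the left side of the last inequality is about exp(- pi d N / 2), while pi d / h = pi d
  N / ln(2 d N / \<alpha>) grows more slowly than N; this leaves room for the factor h.
  \<open>D\<close> will be the constant of the perturbation in the stability estimate.\<close>

lemma h_DE_eventually:
  assumes "0 < d" "0 < \<alpha>" "0 < \<delta>"
  shows "\<forall>\<^sub>F N in sequentially. 0 < h_DE d \<alpha> N \<and> h_DE d \<alpha> N \<le> 1
    \<and> D * (h_DE d \<alpha> N * sqrt (real (2 * N + 1))) \<le> \<delta>
    \<and> 1 / sinh (pi * d / h_DE d \<alpha> N) \<le> 4 * exp (- (pi * d / h_DE d \<alpha> N))
    \<and> exp (- (pi * \<alpha> / 2) * sinh (real N * h_DE d \<alpha> N)) \<le> h_DE d \<alpha> N * exp (- (pi * d / h_DE d \<alpha> N))"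
proof -
  have pos: "\<forall>\<^sub>F N :: nat in sequentially. 0 < ln (2 * d * real N / \<alpha>) / real N"
    using assms by real_asymp
  have "((\<lambda>N :: nat. ln (2 * d * real N / \<alpha>) / real N) \<longlonglongrightarrow> 0)"
    using assms by real_asymp
  then have h0: "(h_DE d \<alpha>) \<longlonglongrightarrow> 0" by (simp add: h_DE_def[abs_def])
  \<comment> \<open>The bound h < d gives pi d / h >= 1, the range in which the constant 4 is
    correct for the reciprocal of sinh.\<close>
  have small: "\<forall>\<^sub>F N in sequentially. h_DE d \<alpha> N < min 1 d"
    using order_tendstoD(2)[OF h0, of "min 1 d"] assms by simp
  have "((\<lambda>N :: nat. D * (ln (2 * d * real N / \<alpha>) / real N * sqrt (2 * real N + 1))) \<longlonglongrightarrow> 0)"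
    using assms by real_asymp
  then have D: "\<forall>\<^sub>F N in sequentially. D * (ln (2 * d * real N / \<alpha>) / real N * sqrt (2 * real N + 1)) < \<delta>"
    using assms by (intro order_tendstoD(2)[where y = 0])
  \<comment> \<open>The logarithm of the last claim, with the hyperbolic sine of a logarithm written
    out as (u - 1 / u) / 2 for u = 2 d N / \<alpha>.\<close>
  have "\<forall>\<^sub>F N :: nat in sequentially. - (pi * \<alpha> / 2) * ((2 * d * real N / \<alpha> - 1 / (2 * d * real N / \<alpha>)) / 2)
      \<le> ln (ln (2 * d * real N / \<alpha>) / real N) - pi * d / (ln (2 * d * real N / \<alpha>) / real N)"
    using assms by real_asymp
  then show ?thesis
    using pos small D eventually_gt_at_top[of 0]
  proof eventually_elim
    case (elim N)
    define h where "h = h_DE d \<alpha> N"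
    have h: "0 < h" "h \<le> 1" "h \<le> d" using elim by (simp_all add: h_def h_DE_def)
    have Nh: "real N * h = ln (2 * d * real N / \<alpha>)" using elim by (simp add: h_def h_DE_def)
    have arg: "0 < 2 * d * real N / \<alpha>" using elim assms by simp
    have sinh_eq: "sinh (real N * h) = (2 * d * real N / \<alpha> - 1 / (2 * d * real N / \<alpha>)) / 2"
      unfolding Nh using arg by (simp add: sinh_ln_real inverse_eq_divide)
    have e2: "exp (- (pi * \<alpha> / 2) * sinh (real N * h)) \<le> h * exp (- (pi * d / h))"
    proof -
      have "- (pi * \<alpha> / 2) * sinh (real N * h) \<le> ln h - pi * d / h"
        using elim(1) unfolding sinh_eq by (simp add: h_def h_DE_def)
      then have "exp (- (pi * \<alpha> / 2) * sinh (real N * h)) \<le> exp (ln h - pi * d / h)" by simp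
      also have "\<dots> = h * exp (- (pi * d / h))" using h by (simp only: exp_diff exp_ln exp_minus divide_inverse)
      finally show ?thesis .
    qed
    have e1: "1 / sinh z \<le> 4 * exp (- z)" if "1 \<le> z" for z :: real
    proof -
      define E where "E = exp z"
      have "1 + z \<le> E" unfolding E_def by (rule exp_ge_add_one_self)
      then have E: "2 \<le> E" using that by linarith
      have "4 \<le> E * E" using mult_mono[OF E E] E by simp
      then have "0 < E - inverse E" "E \<le> 2 * (E - inverse E)"
        using E by (auto simp: field_simps)
      then have "1 / ((E - inverse E) / 2) \<le> 4 / E"
        using E by (simp add: field_simps)
      moreover have "sinh z = (E - inverse E) / 2" by (simp add: sinh_field_def E_def exp_minus)
      moreover have "4 * exp (- z) = 4 / E" by (simp add: E_def exp_minus divide_inverse)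
      ultimately show ?thesis by (simp only:)
    qed
    have "h * 1 \<le> d * pi" using h pi_ge_two assms by (intro mult_mono) auto
    then have "1 \<le> pi * d / h" using h by (simp add: field_simps)
    from e1[OF this] e2 h elim show ?case
      by (simp add: h_def h_DE_def add.commute)
  qed
qed

lemma uniform_constant:
  fixes P :: "nat \<Rightarrow> real \<Rightarrow> bool"
  assumes "\<And>i. i < n \<Longrightarrow> \<exists>C\<ge>0. P i C" and mono: "\<And>i C C'. P i C \<Longrightarrow> C \<le> C' \<Longrightarrow> P i C'"
  shows "\<exists>C\<ge>0. \<forall>i<n. P i C"
  using assms(1)
proof (induction n)
  case 0
  then show ?case by (intro exI[of _ 0]) simp
next
  case (Suc n)
  then obtain C where C: "0 \<le> C" "\<forall>i<n. P i C" by auto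
  obtain C' where C': "0 \<le> C'" "P n C'" using Suc.prems[of n] by auto
  have "P i (max C C')" if "i < Suc n" for i
    using that C C' mono[of i C "max C C'"] mono[of n C' "max C C'"] by (cases "i = n") auto
  then show ?case using C by (intro exI[of _ "max C C'"]) auto
qed

section \<open>Transport of the initial value problem to the real line\<close>

lemma psi_DE_deriv_pos: "a < b \<Longrightarrow> 0 < psi_DE_deriv a b x"
  unfolding psi_DE_deriv_eq by (intro divide_pos_pos mult_pos_pos zero_less_power cosh_real_pos) auto

text \<open>Links the products appearing in the Nystroem formula, where the derivative of the map is
  taken on the real line only, to functions that are holomorphic on the strip.\<close>

lemma transported_of_real:
  fixes f :: "complex \<Rightarrow> complex"
  assumes "a < b"
  shows "f (of_real x) * of_real (psi_DE_deriv a b x)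
    = f (of_real x) * Q_fun a b (psi_DE a b (of_real x)) * (of_real (pi / (b - a)) * cosh (of_real x))"
proof -
  define c where "c = cosh (pi / 2 * sinh x)"
  have c: "cosh (of_real (pi / 2) * sinh (of_real x)) = complex_of_real c" "c \<noteq> 0"
    unfolding c_def sinh_complex_of_real of_real_mult[symmetric] cosh_complex_of_real
    using cosh_real_pos[of "pi / 2 * sinh x"] by auto
  have "Q_fun a b (psi_DE a b (of_real x)) = complex_of_real (((b - a) / 2)\<^sup>2 / c\<^sup>2)"
    using Q_psi_DE[where \<zeta> = "of_real x", unfolded c(1)] c(2) by simp
  then have "Q_fun a b (psi_DE a b (of_real x)) * (of_real (pi / (b - a)) * cosh (of_real x))
      = complex_of_real (((b - a) / 2)\<^sup>2 / c\<^sup>2 * (pi / (b - a) * cosh x))"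
    by (simp add: cosh_complex_of_real)
  also have "((b - a) / 2)\<^sup>2 / c\<^sup>2 * (pi / (b - a) * cosh x) = psi_DE_deriv a b x"
    unfolding psi_DE_deriv_eq c_def[symmetric] using assms c(2) by (simp add: field_simps power2_eq_square)
  finally show ?thesis by (simp only: mult.assoc)
qed

lemma at_real_psi_DE: "a < b \<Longrightarrow> at_real a b f (psi_DE a b x) = f (of_real x)"
  by (simp add: at_real_def phi_DE_psi_DE)

lemma continuous_on_phi_DE:
  assumes "a < b"
  shows "continuous_on {a<..<b} (phi_DE a b)"
  unfolding phi_DE_def using assms
  by (intro continuous_intros) (auto simp: field_simps)

text \<open>At an interior point the integrand is continuous, so the integrated equation can be
  differentiated; the chain rule does the rest. Possible singularities at a and b are met only
  through integrability.\<close>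

lemma ivp_solution_transported:
  assumes ab: "a < b" and ivp: "ivp_solution a b n k g r y" and i: "i < n"
    and k: "\<And>l. l < n \<Longrightarrow> continuous_on UNIV (\<lambda>x. k i l (of_real x))"
    and g: "continuous_on UNIV (\<lambda>x. g i (of_real x))"
  shows "((\<lambda>x. y i (psi_DE a b x)) has_vector_derivative
           of_real (psi_DE_deriv a b x) * (g i (of_real x) + (\<Sum>l<n. k i l (of_real x) * y l (psi_DE a b x)))) (at x)"
proof -
  define f where "f s = at_real a b (g i) s + (\<Sum>l<n. at_real a b (k i l) s * y l s)" for s
  define t where "t = psi_DE a b x"
  have t: "t \<in> {a<..<b}" using psi_DE_in_interval[OF ab] by (simp add: t_def)
  have y_cont: "continuous_on {a..b} (y l)" if "l < n" for l
    using ivp that unfolding ivp_solution_def by blast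
  have int: "(f has_integral y i s - r i) {a..s}" if "s \<in> {a..b}" for s
    using ivp i that unfolding ivp_solution_def f_def by blast
  have phi: "continuous_on {a<..<b} (\<lambda>s. F (of_real (phi_DE a b s)))"
    if "continuous_on UNIV (\<lambda>x. F (complex_of_real x))" for F :: "complex \<Rightarrow> complex"
    using continuous_on_compose2[OF that continuous_on_phi_DE[OF ab]] by simp
  have "continuous_on {a<..<b} f"
    unfolding f_def at_real_def
    by (intro continuous_on_add continuous_on_sum continuous_on_mult phi k g continuous_on_subset[OF y_cont]) auto
  then have "continuous (at t) f" using t by (simp add: continuous_on_eq_continuous_at)
  then have cont: "continuous (at t within {a..b}) f" by (rule continuous_at_imp_continuous_at_within)
  have "f integrable_on {a..b}" using int[of b] ab by (auto intro: has_integral_integrable)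
  then have "((\<lambda>u. integral {a..u} f) has_vector_derivative f t) (at t within {a..b})"
    using integral_has_vector_derivative_continuous_at[of f a b t "{}"] cont t by simp
  moreover have "at t within {a..b} = at t"
    using t by (intro at_within_interior) simp
  ultimately have "((\<lambda>u. integral {a..u} f) has_vector_derivative f t) (at t)" by simp
  from has_vector_derivative_add[OF has_vector_derivative_const[of "r i"] this]
  have "((\<lambda>u. r i + integral {a..u} f) has_vector_derivative f t) (at t)" by simp
  then have "(y i has_vector_derivative f t) (at t)"
  proof (rule has_vector_derivative_transform_within_open)
    show "r i + integral {a..s} f = y i s" if "s \<in> {a<..<b}" for s
      using integral_unique[OF int[of s]] that by simp
  qed (use t in auto)
  moreover have "((psi_DE a b) has_vector_derivative psi_DE_deriv a b x) (at x)"
    unfolding psi_DE_deriv_eq has_real_derivative_iff_has_vector_derivative[symmetric] by (rule psi_DE_has_derivative)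
  ultimately have "(y i \<circ> psi_DE a b has_vector_derivative psi_DE_deriv a b x *\<^sub>R f t) (at x)"
    unfolding t_def by (rule vector_diff_chain_at[rotated])
  moreover have "f t = g i (of_real x) + (\<Sum>l<n. k i l (of_real x) * y l (psi_DE a b x))"
    by (simp add: f_def t_def at_real_psi_DE[OF ab])
  ultimately show ?thesis by (simp add: o_def scaleR_conv_of_real)
qed

lemma ivp_solution_limits:
  assumes "a < b" "ivp_solution a b n k g r y" "i < n"
  shows "y i a = r i" and "((\<lambda>x. y i (psi_DE a b x)) \<longlongrightarrow> r i) at_bot"
    and "((\<lambda>x. y i (psi_DE a b x)) \<longlongrightarrow> y i b) at_top"
    and "\<exists>K. \<forall>x. cmod (y i (psi_DE a b x)) \<le> K"
proof -
  have cont: "continuous_on {a..b} (y i)" using assms unfolding ivp_solution_def by blast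
  obtain f where "(f has_integral y i a - r i) {a..a}"
    using assms unfolding ivp_solution_def by fastforce
  then show ya: "y i a = r i" using has_integral_unique[OF _ has_integral_refl(2)] by fastforce
  have in_ab: "psi_DE a b x \<in> {a..b}" for x using psi_DE_in_interval[OF assms(1)] by (auto intro: less_imp_le)
  show "((\<lambda>x. y i (psi_DE a b x)) \<longlongrightarrow> r i) at_bot"
    using continuous_on_tendsto_compose[OF cont psi_DE_at_bot] assms(1) in_ab by (simp flip: ya)
  show "((\<lambda>x. y i (psi_DE a b x)) \<longlongrightarrow> y i b) at_top"
    using continuous_on_tendsto_compose[OF cont psi_DE_at_top] assms(1) in_ab by simp
  have "bounded (y i ` {a..b})" by (intro compact_imp_bounded compact_continuous_image cont compact_Icc)
  then show "\<exists>K. \<forall>x. cmod (y i (psi_DE a b x)) \<le> K"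
    unfolding bounded_iff using in_ab by blast
qed

text \<open>Discretisation and truncation are brought to the same rate. The tail sum over nodes
  costs 1 / h, which cancels against the factor h in the bound for \<open>J_fun\<close>; the factor
  h of the truncation part therefore comes from \<open>trunc\<close>.\<close>

lemma sinc_quadrature_error_DE:
  fixes F Y :: "complex \<Rightarrow> complex"
  assumes F: "F holomorphic_on strip d" and K: "0 \<le> K"
    and bound: "\<And>\<zeta>. \<zeta> \<in> strip d \<Longrightarrow> cmod (F \<zeta>) \<le> K / (1 + (Re \<zeta>)\<^sup>2)"
    and decay: "\<And>x. cmod (F (of_real x)) \<le> K * exp (- (pi * \<alpha> / 2) * sinh \<bar>x\<bar>) / (1 + x\<^sup>2)"
    and Y: "\<And>\<zeta>. \<zeta> \<in> strip d \<Longrightarrow> (Y has_field_derivative F \<zeta>) (at \<zeta>)"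
    and lim: "((\<lambda>x. Y (of_real x)) \<longlongrightarrow> L) at_bot"
    and d: "0 < d" and \<alpha>: "0 < \<alpha>" and h: "0 < h" "h \<le> 1"
    and c: "\<And>j x. \<bar>J_fun j h x\<bar> \<le> c * h" "0 \<le> c"
    and sinh: "1 / sinh (pi * d / h) \<le> 4 * exp (- (pi * d / h))"
    and trunc: "exp (- (pi * \<alpha> / 2) * sinh (real N * h)) \<le> h * exp (- (pi * d / h))"
  shows "cmod (Y (of_real x) - L - (\<Sum>j = - int N..int N. F (of_real (of_int j * h)) * of_real (J_fun j h x)))
    \<le> K * (4 / pi * (2 / d + 4 * pi * (1 + 1 / d\<^sup>2)) + 8 * pi * c) * (h * exp (- (pi * d / h)))"
proof -
  let ?e = "exp (- (pi * \<alpha> / 2) * sinh (real N * h))"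
  define q where "q = 2 / d + 4 * pi * (1 + 1 / d\<^sup>2)"
  have q0: "0 \<le> q" using d by (simp add: q_def)
  have tail: "(\<Sum>j\<in>{- int M..int M} - {- int N..int N}. cmod (F (of_real (of_int j * h)))) \<le> K * ?e / h * (4 * pi)"
    for M
  proof -
    have "(\<Sum>j\<in>{- int M..int M} - {- int N..int N}. cmod (F (of_real (of_int j * h))))
        \<le> (\<Sum>j\<in>{- int M..int M} - {- int N..int N}. K * ?e / h * (h / (1 + (of_int j * h)\<^sup>2)))"
    proof (rule sum_mono)
      fix j assume "j \<in> {- int M..int M} - {- int N..int N}"
      then have "real N \<le> \<bar>real_of_int j\<bar>" by auto
      then have "real N * h \<le> \<bar>of_int j * h\<bar>" using h by (simp add: abs_mult)
      then have "sinh (real N * h) \<le> sinh \<bar>of_int j * h\<bar>" by (subst sinh_real_le_iff)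
      then have "pi * \<alpha> / 2 * sinh (real N * h) \<le> pi * \<alpha> / 2 * sinh \<bar>of_int j * h\<bar>"
        using \<alpha> by (intro mult_left_mono) auto
      then have "exp (- (pi * \<alpha> / 2) * sinh \<bar>of_int j * h\<bar>) \<le> ?e"
        by (simp only: exp_le_cancel_iff mult_minus_left neg_le_iff_le)
      then have "K * exp (- (pi * \<alpha> / 2) * sinh \<bar>of_int j * h\<bar>) / (1 + (of_int j * h)\<^sup>2)
          \<le> K * ?e / (1 + (of_int j * h)\<^sup>2)"
        using K by (intro divide_right_mono mult_left_mono) auto
      with decay[of "of_int j * h"]
      have "cmod (F (of_real (of_int j * h))) \<le> K * ?e / (1 + (of_int j * h)\<^sup>2)" by (rule order_trans)
      also have "\<dots> = K * ?e / h * (h / (1 + (of_int j * h)\<^sup>2))" using h by simp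
      finally show "cmod (F (of_real (of_int j * h))) \<le> K * ?e / h * (h / (1 + (of_int j * h)\<^sup>2))" .
    qed
    also have "\<dots> \<le> (\<Sum>j = - int M..int M. K * ?e / h * (h / (1 + (of_int j * h)\<^sup>2)))"
      using K h by (intro sum_mono2) auto
    also have "\<dots> = K * ?e / h * (\<Sum>j = - int M..int M. h / (1 + (of_int j * h)\<^sup>2))"
      by (rule sum_distrib_left[symmetric])
    also have "\<dots> \<le> K * ?e / h * (4 * pi)"
      using K h by (intro mult_left_mono sum_lorentzian_nodes_le) auto
    finally show ?thesis .
  qed
  have "cmod (Y (of_real x) - L - (\<Sum>j = - int N..int N. F (of_real (of_int j * h)) * of_real (J_fun j h x)))
      \<le> h / pi * (K / sinh (pi * d / h) * q) + 2 * c * h * (K * ?e / h * (4 * pi))"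
    unfolding q_def by (rule sinc_quadrature_error[OF F K bound Y lim d h(1) c tail])
  also have "\<dots> = h / pi * K * q * (1 / sinh (pi * d / h)) + 8 * pi * c * K * ?e"
    using h by simp
  also have "\<dots> \<le> h / pi * K * q * (4 * exp (- (pi * d / h))) + 8 * pi * c * K * (h * exp (- (pi * d / h)))"
    using h K q0 c by (intro add_mono mult_left_mono sinh trunc) auto
  also have "\<dots> = K * (4 / pi * q + 8 * pi * c) * (h * exp (- (pi * d / h)))"
    by (simp add: algebra_simps)
  finally show ?thesis unfolding q_def .
qed

lemma J_fun_node:
  assumes "h \<noteq> 0"
  shows "J_fun j h (of_int i * h) = h * sigma (i - j)"
  using assms by (simp add: J_fun_def sigma_def)

lemma nystroem_psi_DE:
  fixes A :: "nat \<Rightarrow> complex \<Rightarrow> complex" and B :: "complex \<Rightarrow> complex"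
  assumes ab: "a < b"
    and A: "\<And>l x. l < n \<Longrightarrow> k i l (of_real x) * of_real (psi_DE_deriv a b x) = A l (of_real x)"
    and B: "\<And>x. g i (of_real x) * of_real (psi_DE_deriv a b x) = B (of_real x)"
  shows "nystroem a b n k g r h N Y i (psi_DE a b x)
    = r i + (\<Sum>p<2 * N + 1. (B (of_real (of_int (node N p) * h))
        + (\<Sum>l<n. A l (of_real (of_int (node N p) * h)) * Y $ (l * (2 * N + 1) + p)))
        * of_real (J_fun (node N p) h x))"
proof -
  have J: "J_DE a b j h (psi_DE a b x) = J_fun j h x" for j
    using psi_DE_in_interval[OF ab, of x] by (simp add: J_DE_def phi_DE_psi_DE[OF ab])
  have nat_node: "nat (node N p + int N) = p" for p by (simp add: node_def)
  have "(g i z + (\<Sum>l<n. k i l z * v l)) * \<psi>' = g i z * \<psi>' + (\<Sum>l<n. (k i l z * \<psi>') * v l)"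
    for z \<psi>' :: complex and v
    by (subst distrib_right, subst sum_distrib_right) (simp only: mult_ac)
  then have eq: "(g i (of_real x) + (\<Sum>l<n. k i l (of_real x) * v l)) * of_real (psi_DE_deriv a b x)
      = B (of_real x) + (\<Sum>l<n. A l (of_real x) * v l)" for x v
    by (simp add: A B)
  then show ?thesis
    unfolding nystroem_def sum_nodes J t_DE_def at_real_psi_DE[OF ab] nat_node by (simp only: eq)
qed

text \<open>At the node with index i, \<open>J_fun\<close> for index j has the value h sigma(i - j).
  The system is thus collocation of the Nystroem formula at its own nodes, and the nodal errors
  satisfy a closed discrete equation.\<close>

lemma DE_system_iff_nystroem:
  assumes "a < b" and h: "h \<noteq> 0"
  shows "DE_system a b n k g r h N Y \<longleftrightarrow> Y \<in> carrier_vec (n * (2 * N + 1)) \<and>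
    (\<forall>i<n. \<forall>p<2 * N + 1. Y $ (i * (2 * N + 1) + p)
      = nystroem a b n k g r h N Y i (psi_DE a b (of_int (node N p) * h)))"
proof -
  have J: "J_DE a b j h (psi_DE a b (of_int (node N p) * h)) = h * sigma (node N p - j)" for j p
    using psi_DE_in_interval[OF assms(1), of "of_int (node N p) * h"]
    by (simp add: J_DE_def phi_DE_psi_DE[OF assms(1)] J_fun_node[OF h])
  have nat_node: "nat (node N p + int N) = p" for p by (simp add: node_def)
  have comm: "of_real (h * s * \<psi>') * z = z * of_real \<psi>' * of_real (h * s)" for s \<psi>' and z :: complex
    by simp
  show ?thesis
    unfolding DE_system_iff nystroem_def sum_nodes J nat_node comm by (rule refl)
qed

theorem theorem12:
  fixes a b d \<alpha> :: real and n :: nat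
    and k :: "nat \<Rightarrow> nat \<Rightarrow> complex \<Rightarrow> complex"
    and g :: "nat \<Rightarrow> complex \<Rightarrow> complex"
    and r :: "nat \<Rightarrow> complex"
    and y :: "nat \<Rightarrow> real \<Rightarrow> complex"
  assumes "a < b" and "n \<ge> 1" and "0 < d" and "d < pi / 2" and "\<alpha> > 0"
    and "\<And>i j. i < n \<Longrightarrow> j < n \<Longrightarrow>
           (\<lambda>\<zeta>. k i j \<zeta> * Q_fun a b (psi_DE a b \<zeta>)) \<in> L_space a b d \<alpha>"
    and "\<And>i. i < n \<Longrightarrow> (\<lambda>\<zeta>. g i \<zeta> * Q_fun a b (psi_DE a b \<zeta>)) \<in> L_space a b d \<alpha>"
    and "ivp_solution a b n k g r y"
  shows "\<exists>N0 :: nat. \<exists>C :: real. \<forall>N. N > 0 \<and> N \<ge> N0 \<longrightarrow>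
           (\<exists>!Y. DE_system a b n k g r (h_DE d \<alpha> N) N Y) \<and>
           (\<forall>Y. DE_system a b n k g r (h_DE d \<alpha> N) N Y \<longrightarrow>
             (\<forall>i<n. \<forall>t\<in>{a..b}.
               cmod (y i t - nystroem a b n k g r (h_DE d \<alpha> N) N Y i t)
                 \<le> C * (ln (2 * d * real N / \<alpha>) / real N)
                     * exp (- (pi * d * real N) / ln (2 * d * real N / \<alpha>))))"
proof -
  note ab = \<open>a < b\<close>
  define A where "A i l \<zeta> = k i l \<zeta> * Q_fun a b (psi_DE a b \<zeta>) * (of_real (pi / (b - a)) * cosh \<zeta>)" for i l \<zeta>
  define B where "B i \<zeta> = g i \<zeta> * Q_fun a b (psi_DE a b \<zeta>) * (of_real (pi / (b - a)) * cosh \<zeta>)" for i \<zeta>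
  have kA: "k i l (of_real x) * of_real (psi_DE_deriv a b x) = A i l (of_real x)" for i l x
    unfolding A_def by (rule transported_of_real[OF ab])
  have gB: "g i (of_real x) * of_real (psi_DE_deriv a b x) = B i (of_real x)" for i x
    unfolding B_def by (rule transported_of_real[OF ab])
  \<comment> \<open>Both decay properties with one common constant, a form that is monotone in the
    constant and so can be made uniform over the finitely many coefficients.\<close>
  define env where "env f C \<longleftrightarrow> (\<forall>\<zeta>\<in>strip d. cmod (f \<zeta>) \<le> C / (1 + (Re \<zeta>)\<^sup>2)) \<and>
      (\<forall>x. cmod (f (of_real x)) \<le> C * exp (- (pi * \<alpha> / 2) * sinh \<bar>x\<bar>) / (1 + x\<^sup>2))" for f and C :: real
  have env_mono: "env f C'" if "env f C" "C \<le> C'" for f C C'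
  proof -
    have "C / (1 + x\<^sup>2) \<le> C' / (1 + x\<^sup>2)" for x :: real
      using that(2) by (intro divide_right_mono) auto
    moreover have "C * exp z / (1 + x\<^sup>2) \<le> C' * exp z / (1 + x\<^sup>2)" for x z :: real
      using that(2) by (intro divide_right_mono mult_right_mono) auto
    ultimately show ?thesis using that(1) unfolding env_def by (meson order_trans)
  qed
  have env_ex: "\<exists>C\<ge>0. env (\<lambda>\<zeta>. G \<zeta> * (of_real (pi / (b - a)) * cosh \<zeta>)) C" if G: "G \<in> L_space a b d \<alpha>" for G
  proof -
    obtain C1 C2 where "0 \<le> C1" "0 \<le> C2"
      and "\<forall>\<zeta>\<in>strip d. cmod (G \<zeta> * (of_real (pi / (b - a)) * cosh \<zeta>)) \<le> C1 / (1 + (Re \<zeta>)\<^sup>2)"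
      and "\<forall>x. cmod (G (of_real x) * (of_real (pi / (b - a)) * cosh (of_real x)))
        \<le> C2 * exp (- (pi * \<alpha> / 2) * sinh \<bar>x\<bar>) / (1 + x\<^sup>2)"
      using L_space_transported(2,3)[OF ab assms(3-5) G] by blast
    moreover have "C1 / (1 + x\<^sup>2) \<le> max C1 C2 / (1 + x\<^sup>2)" for x :: real
      by (intro divide_right_mono) auto
    moreover have "C2 * exp z / (1 + x\<^sup>2) \<le> max C1 C2 * exp z / (1 + x\<^sup>2)" for x z :: real
      by (intro divide_right_mono mult_right_mono) auto
    ultimately have "env (\<lambda>\<zeta>. G \<zeta> * (of_real (pi / (b - a)) * cosh \<zeta>)) (max C1 C2)"
      unfolding env_def by (meson order_trans)
    then show ?thesis using \<open>0 \<le> C1\<close> by (intro exI[of _ "max C1 C2"]) auto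
  qed
  have "\<exists>C\<ge>0. \<forall>i<n. env (B i) C \<and> (\<forall>l<n. env (A i l) C)"
  proof (rule uniform_constant)
    fix i assume i: "i < n"
    obtain C1 where C1: "0 \<le> C1" "env (B i) C1"
      using env_ex[OF assms(7)[OF i]] unfolding B_def[abs_def] by blast
    obtain C2 where C2: "0 \<le> C2" "\<forall>l<n. env (A i l) C2"
      using uniform_constant[of n "\<lambda>l C. env (A i l) C"] env_ex[OF assms(6)[OF i]] env_mono
      unfolding A_def[abs_def] by blast
    show "\<exists>C\<ge>0. env (B i) C \<and> (\<forall>l<n. env (A i l) C)"
      using C1 C2 env_mono by (intro exI[of _ "max C1 C2"]) (meson max.cobounded1 max.cobounded2 order_trans)
  qed (use env_mono in blast)
  then obtain C where C: "0 \<le> C" and envB: "\<And>i. i < n \<Longrightarrow> env (B i) C"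
    and envA: "\<And>i l. i < n \<Longrightarrow> l < n \<Longrightarrow> env (A i l) C" by blast
  have holA: "A i l holomorphic_on strip d" if "i < n" "l < n" for i l
    unfolding A_def[abs_def] using L_space_transported(1)[OF ab assms(3-5) assms(6)[OF that]] .
  have holB: "B i holomorphic_on strip d" if "i < n" for i
    unfolding B_def[abs_def] using L_space_transported(1)[OF ab assms(3-5) assms(7)[OF that]] .
  obtain Y M where Y: "\<And>i \<zeta>. i < n \<Longrightarrow> \<zeta> \<in> strip d \<Longrightarrow>
       (Y i has_field_derivative (B i \<zeta> + (\<Sum>l<n. A i l \<zeta> * Y l \<zeta>))) (at \<zeta>)"
    and Y_r: "\<And>i \<zeta>. i < n \<Longrightarrow> \<zeta> \<in> strip d \<Longrightarrow> cmod (Y i \<zeta> - r i) \<le> M * (arctan (Re \<zeta>) + pi / 2)"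
    and M: "0 \<le> M"
    by (rule linear_system_on_strip[where A = A and b = B and C = C and n = n and r = r, OF \<open>0 < d\<close> holA holB])
       (use envA envB C in \<open>auto simp: env_def\<close>)
  define F where "F i \<zeta> = B i \<zeta> + (\<Sum>l<n. A i l \<zeta> * Y l \<zeta>)" for i \<zeta>
  define R where "R = (\<Sum>l<n. cmod (r l)) + M * pi"
  have R0: "0 \<le> R" using M by (simp add: R_def sum_nonneg)
  have Y_R: "cmod (Y l \<zeta>) \<le> R" if "l < n" "\<zeta> \<in> strip d" for l \<zeta>
  proof -
    have "M * (arctan (Re \<zeta>) + pi / 2) \<le> M * pi"
      using M arctan_ubound[of "Re \<zeta>"] by (intro mult_left_mono) auto
    moreover have "cmod (r l) \<le> (\<Sum>l<n. cmod (r l))" using that by (intro member_le_sum) auto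
    ultimately show ?thesis
      using Y_r[OF that] norm_triangle_sub[of "Y l \<zeta>" "r l"] unfolding R_def by linarith
  qed
  define K where "K = C + real n * C * R"
  have K0: "0 \<le> K" using C R0 by (simp add: K_def)
  \<comment> \<open>The factor \<open>z\<close> stays generic so that the estimate yields the bound
    on the strip and the decay on the real line alike.\<close>
  have F_le: "cmod (F i \<zeta>) \<le> K * z" if i: "i < n" and \<zeta>: "\<zeta> \<in> strip d"
    and z: "cmod (B i \<zeta>) \<le> C * z" "\<And>l. l < n \<Longrightarrow> cmod (A i l \<zeta>) \<le> C * z" "0 \<le> z" for i \<zeta> z
  proof -
    have "cmod (\<Sum>l<n. A i l \<zeta> * Y l \<zeta>) \<le> (\<Sum>l<n. (C * z) * R)"
      unfolding norm_mult[symmetric]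
    proof (rule sum_norm_le)
      fix l assume "l \<in> {..<n}"
      then show "cmod (A i l \<zeta> * Y l \<zeta>) \<le> (C * z) * R"
        unfolding norm_mult using z C R0 \<zeta> Y_R by (intro mult_mono) auto
    qed
    then have "cmod (F i \<zeta>) \<le> C * z + real n * ((C * z) * R)"
      unfolding F_def using z(1) by (intro norm_triangle_le add_mono) auto
    then show ?thesis by (simp add: K_def algebra_simps)
  qed
  have F_env: "env (F i) K" if i: "i < n" for i
    unfolding env_def
  proof (intro conjI ballI allI)
    fix \<zeta> assume \<zeta>: "\<zeta> \<in> strip d"
    show "cmod (F i \<zeta>) \<le> K / (1 + (Re \<zeta>)\<^sup>2)"
      using F_le[OF i \<zeta>, of "1 / (1 + (Re \<zeta>)\<^sup>2)"] envA[OF i] envB[OF i] \<zeta> by (simp add: env_def)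
  next
    fix x :: real
    show "cmod (F i (of_real x)) \<le> K * exp (- (pi * \<alpha> / 2) * sinh \<bar>x\<bar>) / (1 + x\<^sup>2)"
      using F_le[OF i, of "of_real x" "exp (- (pi * \<alpha> / 2) * sinh \<bar>x\<bar>) / (1 + x\<^sup>2)"]
        envA[OF i] envB[OF i] \<open>0 < d\<close> by (simp add: env_def strip_def)
  qed
  have F_hol: "F i holomorphic_on strip d" if "i < n" for i
    unfolding F_def
  proof (intro holomorphic_intros holA holB that)
    fix l assume "l \<in> {..<n}"
    then show "Y l holomorphic_on strip d"
      using Y[of l] unfolding holomorphic_on_open[OF open_strip] by blast
  qed auto
  have real_strip: "complex_of_real x \<in> strip d" for x using \<open>0 < d\<close> by (simp add: strip_def)
  have Y_lim: "((\<lambda>x. Y i (of_real x)) \<longlongrightarrow> r i) at_bot" if i: "i < n" for i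
  proof -
    have "((\<lambda>x. Y i (of_real x) - r i) \<longlongrightarrow> 0) at_bot"
    proof (rule Lim_null_comparison)
      show "\<forall>\<^sub>F x in at_bot. cmod (Y i (of_real x) - r i) \<le> M * (arctan x + pi / 2)"
        using Y_r[OF i real_strip] by simp
      show "((\<lambda>x. M * (arctan x + pi / 2)) \<longlongrightarrow> 0) at_bot"
        using tendsto_mult[OF tendsto_const tendsto_add[OF tendsto_arctan_at_bot tendsto_const[of "pi / 2"]], of M]
        by simp
    qed
    then show ?thesis by (simp add: LIM_zero_iff)
  qed
  have A_real: "cmod (A i l (of_real x)) \<le> C / (1 + x\<^sup>2)" if "i < n" "l < n" for i l x
    using envA[OF that] real_strip[of x] unfolding env_def by fastforce
  \<comment> \<open>The given solution and the one built on the strip satisfy the same system on the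
    real line and have the same limit r at minus infinity.\<close>
  have y_eq: "y i (psi_DE a b x) = Y i (of_real x)" if i: "i < n" for i x
  proof -
    obtain Ky where Ky: "0 \<le> Ky" "\<forall>i<n. \<forall>x. cmod (y i (psi_DE a b x)) \<le> Ky"
    proof -
      have "\<exists>K\<ge>0. \<forall>i<n. \<forall>x. cmod (y i (psi_DE a b x)) \<le> K"
      proof (rule uniform_constant)
        fix i assume "i < n"
        then obtain K where "\<forall>x. cmod (y i (psi_DE a b x)) \<le> K"
          using ivp_solution_limits(4)[OF ab assms(8)] by blast
        then show "\<exists>K\<ge>0. \<forall>x. cmod (y i (psi_DE a b x)) \<le> K"
          by (intro exI[of _ "\<bar>K\<bar>"]) (auto intro: order_trans)
      qed (meson order_trans)
      then show thesis using that by blast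
    qed
    \<comment> \<open>Regularity is assumed only for the products with Q. On the real line division
      by the positive derivative of the map recovers continuity of the coefficients
      themselves.\<close>
    have cont_real: "continuous_on UNIV (\<lambda>x. f (complex_of_real x))"
      if f: "\<And>x. f (of_real x) * of_real (psi_DE_deriv a b x) = H (of_real x)" and H: "H holomorphic_on strip d"
      for f H
    proof -
      have "continuous_on UNIV (\<lambda>x. H (complex_of_real x))"
        by (rule continuous_on_compose2[OF holomorphic_on_imp_continuous_on[OF H]])
           (use real_strip in \<open>auto intro!: continuous_intros\<close>)
      moreover have "continuous_on UNIV (\<lambda>x. complex_of_real (psi_DE_deriv a b x))"
        unfolding psi_DE_deriv_eq
        by (intro continuous_intros) (use cosh_real_pos in \<open>auto simp: less_imp_neq[symmetric]\<close>)
      moreover have "psi_DE_deriv a b x \<noteq> 0" for x using psi_DE_deriv_pos[OF ab, of x] by simp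
      ultimately have "continuous_on UNIV (\<lambda>x. H (complex_of_real x) / of_real (psi_DE_deriv a b x))"
        by (intro continuous_on_divide) auto
      moreover have "H (of_real x) / of_real (psi_DE_deriv a b x) = f (of_real x)" for x
        using psi_DE_deriv_pos[OF ab, of x] unfolding f[symmetric] by simp
      ultimately show ?thesis by simp
    qed
    have "y i (psi_DE a b x) - Y i (of_real x) = 0"
    proof (rule linear_system_unique_at_bot[where n = n and A = "\<lambda>i l x. A i l (of_real x)" and C = C and K = "Ky + R"
          and u = "\<lambda>i x. y i (psi_DE a b x) - Y i (of_real x)"])
      fix i x assume i: "i < n"
      have "((\<lambda>x. y i (psi_DE a b x)) has_vector_derivative
           of_real (psi_DE_deriv a b x) * (g i (of_real x) + (\<Sum>l<n. k i l (of_real x) * y l (psi_DE a b x)))) (at x)"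
        using ivp_solution_transported[OF ab assms(8) i] cont_real[OF kA holA[OF i]] cont_real[OF gB holB[OF i]] by blast
      moreover have "of_real (psi_DE_deriv a b x) * (g i (of_real x) + (\<Sum>l<n. k i l (of_real x) * y l (psi_DE a b x)))
          = B i (of_real x) + (\<Sum>l<n. A i l (of_real x) * y l (psi_DE a b x))"
        unfolding kA[symmetric] gB[symmetric] by (simp add: distrib_left sum_distrib_left mult_ac)
      moreover have "((\<lambda>x. Y i (of_real x)) has_vector_derivative
          B i (of_real x) + (\<Sum>l<n. A i l (of_real x) * Y l (of_real x))) (at x)"
        by (intro has_vector_derivative_real_field Y i real_strip)
      ultimately have "((\<lambda>x. y i (psi_DE a b x) - Y i (of_real x)) has_vector_derivative
          (B i (of_real x) + (\<Sum>l<n. A i l (of_real x) * y l (psi_DE a b x)))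
          - (B i (of_real x) + (\<Sum>l<n. A i l (of_real x) * Y l (of_real x)))) (at x)"
        by (intro has_vector_derivative_diff) auto
      then show "((\<lambda>x. y i (psi_DE a b x) - Y i (of_real x)) has_vector_derivative
          (\<Sum>l<n. A i l (of_real x) * (y l (psi_DE a b x) - Y l (of_real x)))) (at x)"
        by (simp add: right_diff_distrib sum_subtractf)
      show "((\<lambda>x. y i (psi_DE a b x) - Y i (of_real x)) \<longlongrightarrow> 0) at_bot"
        using tendsto_diff[OF ivp_solution_limits(2)[OF ab assms(8) i] Y_lim[OF i]] by simp
      show "cmod (y i (psi_DE a b x) - Y i (of_real x)) \<le> Ky + R"
        using Ky(2) Y_R[OF i real_strip[of x]] i by (meson add_mono norm_triangle_le_diff order_trans norm_triangle_ineq4)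
    qed (use A_real C Ky R0 i in auto)
    then show ?thesis by simp
  qed
  obtain c where c0: "0 \<le> c" and c: "\<And>j h x. 0 < h \<Longrightarrow> \<bar>J_fun j h x\<bar> \<le> c * h"
    using J_fun_bounded by blast
  \<comment> \<open>\<open>c1\<close> is the constant of the quadrature residual and
    \<open>c2\<close> the stability factor of the system. \<open>Cfin\<close> adds to
    \<open>c1\<close> the effect of nodal errors on the quadrature sum: c bounds the basis
    functions, n C the coefficients, and 4 pi the sum over the nodes.\<close>
  define W where "W = exp (real n * C * (4 * pi))"
  define c1 where "c1 = K * (4 / pi * (2 / d + 4 * pi * (1 + 1 / d\<^sup>2)) + 8 * pi * c)"
  define c2 where "c2 = 2 * W * real n"
  define Cfin where "Cfin = c1 + c * (4 * pi) * (real n * C * (c2 * c1))"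
  have c1: "0 \<le> c1" using K0 c0 \<open>0 < d\<close> by (simp add: c1_def)
  have c2: "0 \<le> c2" by (simp add: c2_def W_def)
  obtain N0 where N0: "\<And>N. N0 \<le> N \<Longrightarrow> 0 < h_DE d \<alpha> N \<and> h_DE d \<alpha> N \<le> 1
    \<and> real n * C * 4 * W * (h_DE d \<alpha> N * sqrt (real (2 * N + 1))) \<le> 1 / 2
    \<and> 1 / sinh (pi * d / h_DE d \<alpha> N) \<le> 4 * exp (- (pi * d / h_DE d \<alpha> N))
    \<and> exp (- (pi * \<alpha> / 2) * sinh (real N * h_DE d \<alpha> N)) \<le> h_DE d \<alpha> N * exp (- (pi * d / h_DE d \<alpha> N))"
    using h_DE_eventually[OF assms(3,5), of "1 / 2" "real n * C * 4 * W"]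
    unfolding eventually_sequentially by auto
  show ?thesis
  proof (rule exI[of _ N0], rule exI[of _ Cfin], intro allI impI)
    fix N :: nat assume N: "N > 0 \<and> N \<ge> N0"
    define h where "h = h_DE d \<alpha> N"
    let ?m = "2 * N + 1"
    define x where "x p = of_int (node N p) * h" for p
    have h: "0 < h" "h \<le> 1" and small: "real n * C * 4 * W * (h * sqrt (real ?m)) \<le> 1 / 2"
      and sinh: "1 / sinh (pi * d / h) \<le> 4 * exp (- (pi * d / h))"
      and trunc: "exp (- (pi * \<alpha> / 2) * sinh (real N * h)) \<le> h * exp (- (pi * d / h))"
      using N0[of N] N by (simp_all only: h_def simp_thms)
    have small': "real n * C * h * (4 * sqrt (real ?m)) * exp (real n * C * (4 * pi)) \<le> 1 / 2"
      using small unfolding W_def by (simp only: mult_ac)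
    define \<beta> where "\<beta> = c1 * (h * exp (- (pi * d / h)))"
    have \<beta>: "0 \<le> \<beta>" using c1 h by (simp add: \<beta>_def)
    have A_node: "cmod (A i l (of_real (x p))) \<le> C / (1 + (of_int (node N p) * h)\<^sup>2)"
      if "i < n" "l < n" for i l p
      unfolding x_def by (rule A_real[OF that])
    have J_node: "of_real (J_fun (node N q) h (x p)) = complex_of_real (h * sigma (node N p - node N q))" for p q
      unfolding x_def by (subst J_fun_node) (use h in auto)
    \<comment> \<open>The residual left when the exact solution is inserted into the quadrature
      formula.\<close>
    define E where "E i s = Y i (of_real s) - r i - (\<Sum>p<?m. F i (of_real (x p)) * of_real (J_fun (node N p) h s))"
      for i s
    have E: "cmod (E i s) \<le> \<beta>" if i: "i < n" for i s
    proof -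
      have "cmod (Y i (of_real s) - r i - (\<Sum>j = - int N..int N. F i (of_real (of_int j * h)) * of_real (J_fun j h s)))
          \<le> K * (4 / pi * (2 / d + 4 * pi * (1 + 1 / d\<^sup>2)) + 8 * pi * c) * (h * exp (- (pi * d / h)))"
      proof (rule sinc_quadrature_error_DE[OF F_hol[OF i] K0 _ _ _ Y_lim[OF i] \<open>0 < d\<close> \<open>\<alpha> > 0\<close> h _ c0 sinh trunc])
        show "\<bar>J_fun j h x\<bar> \<le> c * h" for j x by (rule c[OF h(1)])
      qed (use F_env[OF i] Y[OF i] in \<open>auto simp: env_def F_def\<close>)
      then show ?thesis unfolding sum_nodes \<beta>_def c1_def E_def x_def .
    qed
    have unique: "\<exists>!Y. DE_system a b n k g r h N Y"
    proof (rule DE_system_uniquely_solvable)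
      fix v :: "complex Matrix.vec" and i p
      assume v: "\<And>i p. i < n \<Longrightarrow> p < ?m \<Longrightarrow> v $ (i * ?m + p)
        = (\<Sum>q<?m. of_real (h * sigma (node N p - node N q) * psi_DE_deriv a b (of_int (node N q) * h))
           * (\<Sum>l<n. at_real a b (k i l) (t_DE a b h (node N q)) * v $ (l * ?m + q)))"
        and ip: "i < n" "p < ?m"
      \<comment> \<open>A kernel vector satisfies the error equation with residual 0, so the
        stability estimate makes it vanish.\<close>
      have "cmod (v $ (i * ?m + p)) \<le> 2 * exp (real n * C * (4 * pi)) * (real n * 0)"
      proof (rule system_stability[where e = "\<lambda>i p. v $ (i * ?m + p)" and \<epsilon> = "\<lambda>i p. 0"
            and A = "\<lambda>i l q. A i l (of_real (x q))", OF h C A_node _ _ order_refl small' ip])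
        fix i p assume ip: "i < n" "p < ?m"
        have regroup: "of_real (h * s * \<psi>') * (\<Sum>l<n. f l * w l)
            = of_real (h * s) * (\<Sum>l<n. f l * of_real \<psi>' * w l)"
          for s \<psi>' :: real and f w :: "nat \<Rightarrow> complex"
          by (simp add: sum_distrib_left mult_ac)
        have "of_real (h * sigma (node N p - node N q) * psi_DE_deriv a b (of_int (node N q) * h))
            * (\<Sum>l<n. at_real a b (k i l) (t_DE a b h (node N q)) * v $ (l * ?m + q))
          = of_real (h * sigma (node N p - node N q)) * (\<Sum>l<n. A i l (of_real (x q)) * v $ (l * ?m + q))" for q
          unfolding kA[symmetric] x_def t_DE_def at_real_psi_DE[OF ab] by (rule regroup)
        then show "v $ (i * ?m + p) = 0 + (\<Sum>q<?m. of_real (h * sigma (node N p - node N q))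
            * (\<Sum>l<n. A i l (of_real (x q)) * v $ (l * ?m + q)))"
          using v[OF ip] by (simp only: add_0)
      qed auto
      then show "v $ (i * ?m + p) = 0" by simp
    qed
    have err: "cmod (y i t - nystroem a b n k g r h N V i t) \<le> Cfin * (h * exp (- (pi * d / h)))"
      if V: "DE_system a b n k g r h N V" and i: "i < n" and t: "t \<in> {a..b}" for V i t
    proof -
      define e where "e l p = Y l (of_real (x p)) - V $ (l * ?m + p)" for l p
      have ny: "nystroem a b n k g r h N V i (psi_DE a b s) = r i + (\<Sum>p<?m. (B i (of_real (x p))
          + (\<Sum>l<n. A i l (of_real (x p)) * V $ (l * ?m + p))) * of_real (J_fun (node N p) h s))" for i s
        unfolding x_def by (rule nystroem_psi_DE[OF ab kA gB])
      \<comment> \<open>The Nystroem formula applies the same quadrature with nodal values of V in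
        place of Y, and the inhomogeneity cancels; what remains is the residual plus the quadrature
        of the nodal errors.\<close>
      have diff: "Y i (of_real s) - nystroem a b n k g r h N V i (psi_DE a b s)
          = E i s + (\<Sum>p<?m. of_real (J_fun (node N p) h s) * (\<Sum>l<n. A i l (of_real (x p)) * e l p))" for i s
      proof -
        have "(\<Sum>p<?m. of_real (J_fun (node N p) h s) * (\<Sum>l<n. A i l (of_real (x p)) * e l p))
            = (\<Sum>p<?m. F i (of_real (x p)) * of_real (J_fun (node N p) h s)
                - (B i (of_real (x p)) + (\<Sum>l<n. A i l (of_real (x p)) * V $ (l * ?m + p))) * of_real (J_fun (node N p) h s))"
          by (intro sum.cong refl)
             (simp only: e_def F_def right_diff_distrib sum_subtractf, simp only: algebra_simps)
        then show ?thesis unfolding E_def ny sum_subtractf by simp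
      qed
      have e_le: "cmod (e l p) \<le> c2 * \<beta>" if "l < n" "p < ?m" for l p
      proof -
        have "cmod (e l p) \<le> 2 * exp (real n * C * (4 * pi)) * (real n * \<beta>)"
        proof (rule system_stability[where \<epsilon> = "\<lambda>i p. E i (x p)"
              and A = "\<lambda>i l q. A i l (of_real (x q))", OF h C A_node _ _ \<beta> small' that])
          \<comment> \<open>At a node the left side of \<open>diff\<close> is the nodal error
            itself, which closes the equation.\<close>
          fix i p assume ip: "i < n" "p < ?m"
          have "V $ (i * ?m + p) = nystroem a b n k g r h N V i (psi_DE a b (x p))"
            using V ip h unfolding DE_system_iff_nystroem[OF ab less_imp_neq[OF h(1), symmetric]] x_def by blast
          then show "e i p = E i (x p) + (\<Sum>q<?m. of_real (h * sigma (node N p - node N q))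
              * (\<Sum>l<n. A i l (of_real (x q)) * e l q))"
            using diff[of i "x p"] unfolding J_node e_def by simp
        qed (use E in auto)
        then show ?thesis unfolding c2_def W_def by (simp only: mult_ac)
      qed
      have on_line: "cmod (y i (psi_DE a b s) - nystroem a b n k g r h N V i (psi_DE a b s)) \<le> Cfin * (h * exp (- (pi * d / h)))"
        for s
      proof -
        \<comment> \<open>The decay of the coefficients at the nodes, together with the factor h,
          gives a sum bounded independently of N, so the number of nodes does not enter the
          constant.\<close>
        have "cmod (\<Sum>p<?m. of_real (J_fun (node N p) h s) * (\<Sum>l<n. A i l (of_real (x p)) * e l p))
            \<le> (\<Sum>p<?m. c * (real n * C * (c2 * \<beta>)) * (h / (1 + (of_int (node N p) * h)\<^sup>2)))"
        proof (rule sum_norm_le)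
          fix p assume p: "p \<in> {..<?m}"
          have "cmod (\<Sum>l<n. A i l (of_real (x p)) * e l p) \<le> (\<Sum>l<n. C / (1 + (of_int (node N p) * h)\<^sup>2) * (c2 * \<beta>))"
          proof (rule sum_norm_le)
            fix l assume "l \<in> {..<n}"
            then show "cmod (A i l (of_real (x p)) * e l p) \<le> C / (1 + (of_int (node N p) * h)\<^sup>2) * (c2 * \<beta>)"
              unfolding norm_mult using C i p by (intro mult_mono A_node e_le) auto
          qed
          also have "\<dots> = real n * (C / (1 + (of_int (node N p) * h)\<^sup>2) * (c2 * \<beta>))"
            by (simp only: sum_constant card_lessThan)
          finally have "\<bar>J_fun (node N p) h s\<bar> * cmod (\<Sum>l<n. A i l (of_real (x p)) * e l p)
              \<le> (c * h) * (real n * (C / (1 + (of_int (node N p) * h)\<^sup>2) * (c2 * \<beta>)))"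
            using c[OF h(1)] c0 h by (intro mult_mono) auto
          also have "\<dots> = c * (real n * C * (c2 * \<beta>)) * (h / (1 + (of_int (node N p) * h)\<^sup>2))"
            by (simp add: mult_ac)
          finally show "cmod (of_real (J_fun (node N p) h s) * (\<Sum>l<n. A i l (of_real (x p)) * e l p))
              \<le> c * (real n * C * (c2 * \<beta>)) * (h / (1 + (of_int (node N p) * h)\<^sup>2))"
            unfolding norm_mult norm_of_real .
        qed
        also have "\<dots> = c * (real n * C * (c2 * \<beta>)) * (\<Sum>j = - int N..int N. h / (1 + (of_int j * h)\<^sup>2))"
          unfolding sum_nodes by (rule sum_distrib_left[symmetric])
        also have "\<dots> \<le> c * (real n * C * (c2 * \<beta>)) * (4 * pi)"
          using c0 C c2 \<beta> h by (intro mult_left_mono sum_lorentzian_nodes_le) auto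
        finally have "cmod (y i (psi_DE a b s) - nystroem a b n k g r h N V i (psi_DE a b s))
            \<le> \<beta> + c * (real n * C * (c2 * \<beta>)) * (4 * pi)"
          unfolding y_eq[OF i] diff using E[OF i, of s] by (intro norm_triangle_le add_mono) auto
        also have "\<dots> = Cfin * (h * exp (- (pi * d / h)))"
          by (simp add: Cfin_def \<beta>_def algebra_simps)
        finally show ?thesis .
      qed
      consider "t = a" | "t = b" | "a < t" "t < b" using t by fastforce
      then show ?thesis
      proof cases
        case 1
        have "nystroem a b n k g r h N V i a = r i"
          by (simp add: nystroem_def J_DE_def)
        then show ?thesis
          using 1 ivp_solution_limits(1)[OF ab assms(8) i] c1 c2 c0 C h by (simp add: Cfin_def)
      next
        \<comment> \<open>The end point corresponds to plus infinity and is reached by a limit: the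
          prescribed value h of the basis functions at b is their limit there, and the bound on the
          line is uniform.\<close>
        case 2
        have "nystroem a b n k g r h N V i b = r i + (\<Sum>p<?m. (B i (of_real (x p))
          + (\<Sum>l<n. A i l (of_real (x p)) * V $ (l * ?m + p))) * of_real h)"
        proof -
          have nat_node: "nat (node N p + int N) = p" for p by (simp add: node_def)
          have J: "J_DE a b j h b = h" for j using ab by (simp add: J_DE_def)
          have "(at_real a b (g i) (t_DE a b h (node N p))
              + (\<Sum>l<n. at_real a b (k i l) (t_DE a b h (node N p)) * V $ (l * ?m + p))) * of_real (psi_DE_deriv a b (of_int (node N p) * h))
            = B i (of_real (x p)) + (\<Sum>l<n. A i l (of_real (x p)) * V $ (l * ?m + p))" for p
            unfolding kA[symmetric] gB[symmetric] x_def t_DE_def at_real_psi_DE[OF ab]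
            by (subst distrib_right, subst sum_distrib_right) (simp only: mult_ac)
          then show ?thesis unfolding nystroem_def sum_nodes J nat_node by simp
        qed
        moreover have "((\<lambda>s. nystroem a b n k g r h N V i (psi_DE a b s)) \<longlongrightarrow> r i + (\<Sum>p<?m. (B i (of_real (x p))
          + (\<Sum>l<n. A i l (of_real (x p)) * V $ (l * ?m + p))) * of_real h)) at_top"
          unfolding ny by (intro tendsto_add tendsto_const tendsto_sum tendsto_mult tendsto_of_real J_fun_at_top h)
        ultimately have "((\<lambda>s. cmod (y i (psi_DE a b s) - nystroem a b n k g r h N V i (psi_DE a b s)))
            \<longlongrightarrow> cmod (y i b - nystroem a b n k g r h N V i b)) at_top"
          using ivp_solution_limits(3)[OF ab assms(8) i] by (intro tendsto_norm tendsto_diff) auto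
        then have "cmod (y i b - nystroem a b n k g r h N V i b) \<le> Cfin * (h * exp (- (pi * d / h)))"
          by (rule tendsto_upperbound) (use on_line in auto)
        then show ?thesis using 2 by simp
      next
        case 3
        then show ?thesis using on_line[of "phi_DE a b t"] psi_DE_phi_DE by simp
      qed
    qed
    have "Cfin * (h * exp (- (pi * d / h))) = Cfin * (ln (2 * d * real N / \<alpha>) / real N)
        * exp (- (pi * d * real N) / ln (2 * d * real N / \<alpha>))"
      by (simp add: h_def h_DE_def)
    then show "(\<exists>!Y. DE_system a b n k g r (h_DE d \<alpha> N) N Y) \<and>
           (\<forall>Y. DE_system a b n k g r (h_DE d \<alpha> N) N Y \<longrightarrow>
             (\<forall>i<n. \<forall>t\<in>{a..b}.
               cmod (y i t - nystroem a b n k g r (h_DE d \<alpha> N) N Y i t)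
                 \<le> Cfin * (ln (2 * d * real N / \<alpha>) / real N)
                     * exp (- (pi * d * real N) / ln (2 * d * real N / \<alpha>))))"
      using unique err unfolding h_def by auto
  qed
qed

end
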